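(* Let $p\ge q\ge 2$ and $1\le k<q-1$. Let $F_0,F_\infty$ be the standard transverse $(1,\dots,k)$-flags of $\mathbb{R}^{p,q}$. Then the space $\Omega(F_0)\cap\Omega(F_\infty)\subset \mathrm{SO}_0(p,q)/P_{1,\dots,k}$ of flags transverse to both $F_0$ and $F_\infty$ has exactly $2^k$ connected components, and the component of a flag $U\cdot F_0$ ($U\in U_{1,\dots,k}$) is determined by the signs of the upper-right $j\times j$ minors $\det_j(U)$ for $1\le j\le k$.
   Context: $\mathbb{R}^{p,q}$ is $\mathbb{R}^{p+q}$ with basis $(e_1,\dots,e_q,x_1,\dots,x_{p-q},\tilde e_q,\dots,\tilde e_1)$ and the symmetric bilinear form of matrix $\begin{pmatrix} 0 & 0 & J \\ 0 & I_{p-q} & 0 \\ J & 0 & 0 \end{pmatrix}$, where $J$ is the $q\times q$ antidiagonal matrix with all antidiagonal entries $1$. $\mathrm{SO}_0(p,q)$ is the identity component of its isometry group. A $(1,\dots,k)$-flag is a nested family $F=(F^1\subset\dots\subset F^k)$ of isotropic subspaces with $\dim F^j=j$; the space of these flags is $\mathrm{SO}_0(p,q)/P_{1,\dots,k}$. Two flags $F,G$ are transverse if $F^j\oplus (G^j)^\perp=\mathbb{R}^{p,q}$ for $1\le j\le k$; $\Omega(F)$ is the set of flags transverse to $F$. The standard flags are $F_0^j=\mathrm{Span}(\tilde e_1,\dots,\tilde e_j)$ and $F_\infty^j=\mathrm{Span}(e_1,\dots,e_j)$. $U_{1,\dots,k}$ is the unipotent radical of the stabilizer of $F_\infty$; the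 map $U\mapsto U\cdot F_0$ is a diffeomorphism $U_{1,\dots,k}\to\Omega(F_\infty)$. For a matrix $U$ written in the basis $(e_1,\dots,e_q,x_1,\dots,x_{p-q},\tilde e_q,\dots,\tilde e_1)$, $\det_j(U)$ is the determinant of its upper-right $j\times j$ block; $U\cdot F_0$ is transverse to $F_0$ if and only if $\det_j(U)\ne0$ for all $1\le j\le k$. *)

theory Defs
  imports
    "HOL-Algebra.Coset"
    "Jordan_Normal_Form.Determinant"
    "HOL-Analysis.Analysis"
begin

text \<open>
  The space $R^{p,q}$ is \<^typ>\<open>real ^ 'n\<close> for a linearly ordered index type with
  \<open>CARD('n) = p + q\<close>; the order of the indices is the order of the basis
  $(e_1,\dots,e_q,x_1,\dots,x_{p-q},\tilde e_q,\dots,\tilde e_1)$. Positions are counted from 0, so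
  $e_a$ is at position \<open>a - 1\<close> and $\tilde e_a$ at position \<open>p + q - a\<close>.
\<close>

type_synonym 'n rvec = "real ^ 'n"
type_synonym 'n rmat = "real ^ 'n ^ 'n"

definition pos :: "'n::{finite,linorder} \<Rightarrow> nat" where
  "pos i = card {..<i}"

definition idx :: "nat \<Rightarrow> 'n::{finite,linorder}" where
  "idx = inv_into UNIV pos"

lemma bij_betw_pos: "bij_betw pos (UNIV :: 'n::{finite,linorder} set) {..<CARD('n)}"
proof -
  have lt: "pos i < pos j" if "i < j" for i j :: 'n
    unfolding pos_def using that by (intro psubset_card_mono) (auto intro: less_trans)
  have inj: "inj (pos :: 'n \<Rightarrow> nat)"
    by (rule injI) (metis lt less_irrefl linorder_neqE)
  have sub: "range (pos :: 'n \<Rightarrow> nat) \<subseteq> {..<CARD('n)}"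
  proof clarsimp
    fix i :: 'n
    have "{..<i} \<subset> UNIV" by blast
    then show "pos i < CARD('n)" unfolding pos_def by (intro psubset_card_mono) auto
  qed
  have "range (pos :: 'n \<Rightarrow> nat) = {..<CARD('n)}"
    by (rule card_subset_eq) (use sub inj in \<open>auto simp: card_image\<close>)
  with inj show ?thesis by (simp add: bij_betw_def)
qed

lemma idx_pos [simp]: "idx (pos i) = i"
  unfolding idx_def using bij_betw_pos by (metis bij_betw_def inv_f_f)

lemma pos_idx: "a < CARD('n) \<Longrightarrow> pos (idx a :: 'n::{finite,linorder}) = a"
  unfolding idx_def using bij_betw_pos[where 'n='n]
  by (metis bij_betw_def f_inv_into_f lessThan_iff)


subsection \<open>The bilinear form and its isometry group\<close>

definition gram :: "nat \<Rightarrow> nat \<Rightarrow> 'n::{finite,linorder} rmat" where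
  "gram p q = (\<chi> i j.
     if q \<le> pos i \<and> pos i < p then (if i = j then 1 else 0)
     else (if pos i + pos j = p + q - 1 then 1 else 0))"

definition bform :: "nat \<Rightarrow> nat \<Rightarrow> 'n::{finite,linorder} rvec \<Rightarrow> 'n rvec \<Rightarrow> real" where
  "bform p q x y = inner x (gram p q *v y)"

definition perp :: "nat \<Rightarrow> nat \<Rightarrow> 'n::{finite,linorder} rvec set \<Rightarrow> 'n rvec set" where
  "perp p q S = {x. \<forall>y\<in>S. bform p q x y = 0}"

definition isometries :: "nat \<Rightarrow> nat \<Rightarrow> 'n::{finite,linorder} rmat set" where
  "isometries p q = {A. invertible A \<and> (\<forall>x y. bform p q (A *v x) (A *v y) = bform p q x y)}"

definition SO0 :: "nat \<Rightarrow> nat \<Rightarrow> 'n::{finite,linorder} rmat set" where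
  "SO0 p q = connected_component_set (isometries p q) (Finite_Cartesian_Product.mat 1)"


subsection \<open>Flags\<close>

text \<open>A $(1,\dots,k)$-flag is a function on \<open>{1..k}\<close>, made \<open>undefined\<close> elsewhere so that
  equality of flags is equality of functions.\<close>

definition flags :: "nat \<Rightarrow> nat \<Rightarrow> nat \<Rightarrow> (nat \<Rightarrow> 'n::{finite,linorder} rvec set) set" where
  "flags p q k = {F \<in> extensional {1..k}.
     (\<forall>j\<in>{1..k}. subspace (F j) \<and> dim (F j) = j \<and> (\<forall>x\<in>F j. \<forall>y\<in>F j. bform p q x y = 0)) \<and>
     (\<forall>i\<in>{1..k}. \<forall>j\<in>{1..k}. i \<le> j \<longrightarrow> F i \<subseteq> F j)}"

definition flag_act :: "nat \<Rightarrow> 'n::finite rmat \<Rightarrow> (nat \<Rightarrow> 'n rvec set) \<Rightarrow> nat \<Rightarrow> 'n rvec set"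
  where "flag_act k g F = (\<lambda>j\<in>{1..k}. (*v) g ` F j)"

definition std_flag_0 :: "nat \<Rightarrow> nat \<Rightarrow> nat \<Rightarrow> nat \<Rightarrow> 'n::{finite,linorder} rvec set" where
  "std_flag_0 p q k = (\<lambda>j\<in>{1..k}. span ((\<lambda>a. axis (idx (p + q - a)) 1) ` {1..j}))"

definition std_flag_inf :: "nat \<Rightarrow> nat \<Rightarrow> nat \<Rightarrow> nat \<Rightarrow> 'n::{finite,linorder} rvec set" where
  "std_flag_inf p q k = (\<lambda>j\<in>{1..k}. span ((\<lambda>a. axis (idx (a - 1)) 1) ` {1..j}))"

definition transverse ::
  "nat \<Rightarrow> nat \<Rightarrow> nat \<Rightarrow> (nat \<Rightarrow> 'n::{finite,linorder} rvec set) \<Rightarrow> (nat \<Rightarrow> 'n rvec set) \<Rightarrow> bool"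
  where "transverse p q k F G \<longleftrightarrow>
    (\<forall>j\<in>{1..k}. F j \<inter> perp p q (G j) = {0} \<and>
       {x + y | x y. x \<in> F j \<and> y \<in> perp p q (G j)} = UNIV)"

definition \<Omega> ::
  "nat \<Rightarrow> nat \<Rightarrow> nat \<Rightarrow> (nat \<Rightarrow> 'n::{finite,linorder} rvec set) \<Rightarrow> (nat \<Rightarrow> 'n rvec set) set"
  where "\<Omega> p q k F = {G \<in> flags p q k. transverse p q k F G}"

definition flag_stabilizer ::
  "nat \<Rightarrow> nat \<Rightarrow> nat \<Rightarrow> (nat \<Rightarrow> 'n::{finite,linorder} rvec set) \<Rightarrow> 'n rmat set"
  where "flag_stabilizer p q k F = {g \<in> SO0 p q. flag_act k g F = F}"

text \<open>The topology of $SO_0(p,q)/P_{1,\dots,k}$ on the set of flags: the quotient topology of the orbit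
  map \<open>g \<mapsto> g \<cdot> F\<^sub>\<infinity>\<close>, whose fibres are the cosets of the stabilizer of \<open>F\<^sub>\<infinity>\<close>.\<close>

definition flag_topology ::
  "nat \<Rightarrow> nat \<Rightarrow> nat \<Rightarrow> (nat \<Rightarrow> 'n::{finite,linorder} rvec set) topology" where
  "flag_topology p q k = topology (\<lambda>S. S \<subseteq> flags p q k \<and>
     openin (top_of_set (SO0 p q)) {g \<in> SO0 p q. flag_act k g (std_flag_inf p q k) \<in> S})"

lemma openin_flag_topology:
  "openin (flag_topology p q k) S \<longleftrightarrow> S \<subseteq> flags p q k \<and>
     openin (top_of_set (SO0 p q)) {g \<in> SO0 p q. flag_act k g (std_flag_inf p q k) \<in> S}"
proof -
  let ?X = "top_of_set (SO0 p q)"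
  let ?f = "\<lambda>S. {g \<in> SO0 p q. flag_act k g (std_flag_inf p q k) \<in> S}"
  have I: "?f (S \<inter> T) = ?f S \<inter> ?f T" for S T by auto
  have U: "?f (\<Union>K) = (\<Union>S\<in>K. ?f S)" for K by auto
  have "istopology (\<lambda>S. S \<subseteq> flags p q k \<and> openin ?X (?f S))"
    unfolding istopology_def I U by (auto intro!: openin_Int openin_Union)
  from topology_inverse'[OF this] show ?thesis unfolding flag_topology_def by (rule fun_cong)
qed


subsection \<open>The unipotent radical and the minors\<close>

definition matrix_group :: "'n::finite rmat set \<Rightarrow> 'n rmat monoid" where
  "matrix_group G = \<lparr>carrier = G, monoid.mult = (**), one = Finite_Cartesian_Product.mat 1\<rparr>"

text \<open>The product \<open>*\<close> on \<^typ>\<open>real ^ 'n ^ 'n\<close> is entrywise, so powers are iterates of \<open>**\<close>.\<close>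

definition unipotent :: "'n::finite rmat \<Rightarrow> bool" where
  "unipotent A \<longleftrightarrow>
     (\<exists>m. ((**) (A - Finite_Cartesian_Product.mat 1) ^^ m) (Finite_Cartesian_Product.mat 1) = 0)"

text \<open>The largest closed connected normal subgroup consisting of unipotent matrices.\<close>

definition unipotent_radical :: "'n::finite rmat set \<Rightarrow> 'n rmat set" where
  "unipotent_radical G =
     \<Union>{N. N \<lhd> matrix_group G \<and> closed N \<and> connected N \<and> (\<forall>A\<in>N. unipotent A)}"

definition U_group :: "nat \<Rightarrow> nat \<Rightarrow> nat \<Rightarrow> 'n::{finite,linorder} rmat set" where
  "U_group p q k = unipotent_radical (flag_stabilizer p q k (std_flag_inf p q k))"

definition det_ur :: "nat \<Rightarrow> 'n::{finite,linorder} rmat \<Rightarrow> real" where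
  "det_ur j A = Determinant.det
     (Matrix.mat j j (\<lambda>(a, b). vec_nth (vec_nth A (idx a)) (idx (CARD('n) - j + b))))"

end

theory Submission
  imports Defs
begin

no_notation vec_index (infixl "$" 100)

text \<open>
  A flag transverse to $F_\infty$ is \<open>U \<cdot> F\<^sub>0\<close> for a product $U = E_1(w_1) \cdots E_k(w_k)$ of Eichler
  transformations, where $w_j$ runs over the nondegenerate space
  $W_j = \mathrm{Span}(e_1,\dots,e_j,\tilde e_1,\dots,\tilde e_j)^\perp$. For fixed
  $w_1,\dots,w_{j-1}$ the minor $\det_j$ is a quadratic function of $w_j$ of the form
  $c + \langle w_j, v\rangle - \frac{\alpha}{2}\langle w_j, w_j\rangle$ with
  $2\alpha c + \langle v, v\rangle = 0$, so it is an affine function or a translated multiple of the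
  quadratic form. Since $W_j$ has signature at least $(2,2)$ when $j \le k < q - 1$, each of its two
  sides is connected and nonempty unless $\alpha = v = 0$. Thus the sign classes would be iterated open
  fibrations with connected fibres, were it not for the degenerate case; the latter is avoided by
  keeping $U$ generic at every step, which removes from each fibre only a subset of a subspace of
  codimension at least 2 and leaves a dense subset of the sign class.
\<close>


text \<open>The relation between c, v and \<alpha> is the isotropy of a single vector. The minor
  pairs the moving image of tilde e_j with a cofactor vector z in F_0^j, and c, v, \<alpha> are
  components of y = U^-1 z. In the degenerate case y is a nonzero vector of a coordinate subspace
  that U sends into F_0^k. The next factor must control e_(j+1) as well, so genericity has to test
  all of e_j, ..., e_k at once to be inductive.

  Both ends of the theorem are phrased without Eichler products: the topology is a quotient along
  the orbit of F_inf, and U ranges over an abstractly defined unipotent radical. The first is met by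
  an element s of SO_0 with s F_inf = F_0. The second is met by an invariant of the flag alone, the
  sign of the product of the upper and lower j x j minors of any basis of G^j. For U F_0 the lower
  minor is 1, both for Eichler products and for elements of the radical, so the invariant is the
  sign of det_j.\<close>

subsection \<open>Topological preliminaries\<close>


text \<open>A separation of \<open>Z\<close> cannot split a connected fibre, so it sorts the points
  of \<open>A\<close> into two classes. These are relatively open because, by \<open>op\<close>, a
  point \<open>w\<close> of a fibre stays in all nearby fibres; this takes the place of local
  triviality.\<close>

lemma connected_open_fibres:
  fixes Z :: "('a::topological_space \<times> 'b::topological_space) set"
  assumes A: "connected A" and sub: "fst ` Z \<subseteq> A"
    and fib: "\<And>x. x \<in> A \<Longrightarrow> connected {w. (x, w) \<in> Z}"
    and ne: "\<And>x. x \<in> A \<Longrightarrow> \<exists>w. (x, w) \<in> Z"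
    and op: "\<And>x w. (x, w) \<in> Z \<Longrightarrow> \<exists>V. open V \<and> x \<in> V \<and> (\<forall>x'\<in>V \<inter> A. (x', w) \<in> Z)"
  shows "connected Z"
  unfolding connected_def
proof (rule notI, elim exE conjE)
  fix U1 U2 :: "('a \<times> 'b) set"
  assume o: "open U1" "open U2" and cov: "Z \<subseteq> U1 \<union> U2" and dis: "U1 \<inter> U2 \<inter> Z = {}"
    and ne1: "U1 \<inter> Z \<noteq> {}" and ne2: "U2 \<inter> Z \<noteq> {}"
  have slice: "open ((\<lambda>x. (x, w)) -` U)" if "open U" for U :: "('a \<times> 'b) set" and w
    by (intro open_vimage that continuous_intros)
  have slice': "open ((\<lambda>w. (x, w)) -` U)" if "open U" for U :: "('a \<times> 'b) set" and x
    by (intro open_vimage that continuous_intros)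
  define G where "G U x \<longleftrightarrow> {x} \<times> {w. (x, w) \<in> Z} \<subseteq> U" for U x
  have one: "G U1 x \<or> G U2 x" if x: "x \<in> A" for x
  proof -
    let ?V1 = "(\<lambda>w. (x, w)) -` U1" and ?V2 = "(\<lambda>w. (x, w)) -` U2"
    have "?V1 \<inter> {w. (x, w) \<in> Z} = {} \<or> ?V2 \<inter> {w. (x, w) \<in> Z} = {}"
      by (rule connectedD[OF fib[OF x] slice'[OF o(1)] slice'[OF o(2)]]) (use cov dis in auto)
    then show ?thesis unfolding G_def using cov by auto
  qed
  have pick: "G U x" if "x \<in> A" "(x, w) \<in> Z" "(x, w) \<in> U" "U \<in> {U1, U2}" for x w U
  proof -
    have "\<not> ((x, w) \<in> U1 \<and> (x, w) \<in> U2)" using dis that(2) by auto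
    moreover have "G U' x \<Longrightarrow> (x, w) \<in> U'" for U' using that(2) unfolding G_def by auto
    ultimately show ?thesis using one[OF that(1)] that(3,4) by auto
  qed
  \<comment> \<open>\<open>connectedD\<close> wants open sets of the ambient space, so each class is
    enlarged to the union of all open sets whose points in \<open>A\<close> have their whole fibre
    in \<open>U\<close>.\<close>
  define B where "B U = \<Union>{V. open V \<and> (\<forall>x\<in>V \<inter> A. G U x)}" for U
  have openB: "open (B U)" for U unfolding B_def by (intro open_Union) auto
  have BG: "G U x" if "x \<in> A" "x \<in> B U" for x U
    using that unfolding B_def by auto
  have GB: "x \<in> B U" if x: "x \<in> A" "(x, w) \<in> Z" "(x, w) \<in> U" and U: "U \<in> {U1, U2}" for x w U
  proof -
    obtain V where V: "open V" "x \<in> V" "\<forall>x'\<in>V \<inter> A. (x', w) \<in> Z" using op[OF x(2)] by auto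
    let ?V = "V \<inter> (\<lambda>x. (x, w)) -` U"
    have "open U" using U o by auto
    then have "open ?V" using V(1) slice by (intro open_Int) auto
    moreover have "\<forall>x'\<in>?V \<inter> A. G U x'" using pick V(3) U by auto
    ultimately have "?V \<subseteq> B U" unfolding B_def by (intro Union_upper) simp
    then show ?thesis using V(2) x(3) by auto
  qed
  have AZ: "x \<in> A" if "(x, w) \<in> Z" for x w using sub image_eqI[of x fst "(x, w)"] that by auto
  have "A \<subseteq> B U1 \<union> B U2"
  proof
    fix x assume x: "x \<in> A"
    then obtain w where w: "(x, w) \<in> Z" using ne by auto
    then have "(x, w) \<in> U1 \<or> (x, w) \<in> U2" using cov by auto
    then show "x \<in> B U1 \<union> B U2" using GB[OF x w, of U1] GB[OF x w, of U2] by auto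
  qed
  moreover have "B U1 \<inter> B U2 \<inter> A = {}"
  proof (rule equals0I)
    fix x assume x: "x \<in> B U1 \<inter> B U2 \<inter> A"
    then obtain w where w: "(x, w) \<in> Z" using ne by auto
    have "(x, w) \<in> U1" "(x, w) \<in> U2" using BG[of x U1] BG[of x U2] x w unfolding G_def by auto
    with w dis show False by auto
  qed
  moreover have "B U \<inter> A \<noteq> {}" if ne: "U \<inter> Z \<noteq> {}" and U: "U \<in> {U1, U2}" for U
  proof -
    obtain z where z: "z \<in> U" "z \<in> Z" using ne by auto
    obtain x w where "z = (x, w)" by (cases z)
    with z have xw: "(x, w) \<in> U" "(x, w) \<in> Z" by auto
    from GB[OF AZ[OF xw(2)] xw(2,1) U] AZ[OF xw(2)] show ?thesis by auto
  qed
  ultimately show False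
    using connectedD[OF A openB openB, of U1 U2] ne1 ne2 by auto
qed

lemma ex_small_scaleR:
  fixes v :: "'a::real_normed_vector"
  assumes "e > 0"
  shows "\<exists>t>0. norm (t *\<^sub>R v) < e"
proof -
  have pos: "norm v + 1 > 0" by (rule add_nonneg_pos) auto
  have "norm v / (norm v + 1) < 1" using pos by (simp only: divide_less_eq) simp
  from mult_strict_left_mono[OF this assms]
  have "norm ((e / (norm v + 1)) *\<^sub>R v) < e" using pos assms by (simp add: field_simps)
  with pos assms show ?thesis by (intro exI[of _ "e / (norm v + 1)"]) simp
qed

text \<open>A segment that meets \<open>H\<close> is replaced by a detour: \<open>x\<close>,
  \<open>y\<close> and \<open>H\<close> then lie in a subspace \<open>H'\<close> of dimension at
  most \<open>dim H + 1\<close>, still proper in \<open>W\<close>, and a segment from a point of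
  \<open>H'\<close> to a point \<open>z\<close> outside \<open>H'\<close> leaves \<open>H'\<close>
  at once.\<close>

lemma convex_diff_subspace_connected:
  fixes D W H :: "'a::euclidean_space set"
  assumes D: "convex D" and op: "openin (top_of_set W) D"
    and W: "subspace W" and H: "subspace H" and HW: "H \<subseteq> W" and dim: "dim H + 2 \<le> dim W"
    and x: "x \<in> D - H" and y: "y \<in> D - H"
  shows "\<exists>T. connected T \<and> T \<subseteq> D - H \<and> x \<in> T \<and> y \<in> T"
proof (cases "closed_segment x y \<inter> H = {}")
  case True
  have "closed_segment x y \<subseteq> D" using D x y by (simp add: convex_contains_segment)
  then show ?thesis using True by (intro exI[of _ "closed_segment x y"]) auto
next
  case False
  have DW: "D \<subseteq> W" using op by (rule openin_imp_subset)
  define H' where "H' = span (insert x H)"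
  have H'W: "H' \<subseteq> W" unfolding H'_def using x HW DW W by (intro span_minimal) auto
  have "dim H' \<le> dim H + 1" unfolding H'_def by (simp add: dim_insert)
  then have "H' \<noteq> W" using dim by auto
  then obtain v where v: "v \<in> W" "v \<notin> H'" using H'W by blast
  have H'sub: "subspace H'" unfolding H'_def by simp
  have HH': "H \<subseteq> H'" "x \<in> H'" unfolding H'_def by (auto intro: span_base)
  obtain s where s: "s \<in> {0..1}" "(1 - s) *\<^sub>R x + s *\<^sub>R y \<in> H"
    using False by (auto simp: closed_segment_def)
  have s0: "s \<noteq> 0" using s x by auto
  have "s *\<^sub>R y = ((1 - s) *\<^sub>R x + s *\<^sub>R y) - (1 - s) *\<^sub>R x" by simp
  also have "\<dots> \<in> H'" using s HH' H'sub by (intro subspace_diff subspace_scale) auto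
  finally have "(1 / s) *\<^sub>R s *\<^sub>R y \<in> H'" by (rule subspace_scale[OF H'sub])
  then have yH': "y \<in> H'" using s0 by simp
  obtain e where e: "e > 0" "ball y e \<inter> W \<subseteq> D"
    using op y unfolding openin_contains_ball by blast
  obtain t where t: "t > 0" "norm (t *\<^sub>R v) < e" using ex_small_scaleR[OF e(1)] by blast
  define z where "z = y + t *\<^sub>R v"
  have zW: "z \<in> W" unfolding z_def using y DW v W by (intro subspace_add subspace_scale) auto
  have zD: "z \<in> D" using e zW t by (auto simp: z_def dist_norm)
  have seg: "(1 - r) *\<^sub>R a + r *\<^sub>R z \<notin> H" if "a \<in> H'" "a \<notin> H" for r a
  proof
    assume h: "(1 - r) *\<^sub>R a + r *\<^sub>R z \<in> H"
    have "(r * t) *\<^sub>R v = ((1 - r) *\<^sub>R a + r *\<^sub>R z) - (1 - r) *\<^sub>R a - r *\<^sub>R y"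
      by (simp add: z_def algebra_simps)
    also have "\<dots> \<in> H'" using h HH' H'sub yH' that by (intro subspace_diff subspace_scale) auto
    finally have "(r * t) *\<^sub>R v \<in> H'" .
    then have *: "(1 / (r * t)) *\<^sub>R (r * t) *\<^sub>R v \<in> H'" by (rule subspace_scale[OF H'sub])
    have "r = 0"
    proof (rule ccontr)
      assume "r \<noteq> 0"
      with * t v show False by simp
    qed
    with h that show False by simp
  qed
  let ?T = "closed_segment x z \<union> closed_segment y z"
  have "connected ?T" by (intro connected_Un) auto
  moreover have "?T \<subseteq> D" using D x y zD by (simp add: convex_contains_segment)
  moreover have "?T \<inter> H = {}"
    using seg[of x] seg[of y] HH' yH' x y by (auto simp: closed_segment_def)
  ultimately show ?thesis by (intro exI[of _ ?T]) auto
qed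

lemma subspace_complement_dense:
  fixes T W H :: "'a::euclidean_space set"
  assumes op: "openin (top_of_set W) T" and W: "subspace W" and H: "subspace H"
    and HW: "H \<subseteq> W" and dim: "dim H < dim W" and x: "x \<in> T"
  shows "\<exists>z\<in>T. z \<notin> H"
proof (cases "x \<in> H")
  case True
  have TW: "T \<subseteq> W" using op by (rule openin_imp_subset)
  obtain v where v: "v \<in> W" "v \<notin> H" using dim HW by (metis less_irrefl subsetI subset_antisym)
  obtain e where e: "e > 0" "ball x e \<inter> W \<subseteq> T"
    using op x unfolding openin_contains_ball by blast
  obtain t where t: "t > 0" "norm (t *\<^sub>R v) < e" using ex_small_scaleR[OF e(1)] by blast
  have "x + t *\<^sub>R v \<in> T"
    using e t x TW v W by (intro subsetD[OF e(2)]) (auto simp: dist_norm intro!: subspace_add subspace_scale)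
  moreover have "x + t *\<^sub>R v \<notin> H"
  proof
    assume "x + t *\<^sub>R v \<in> H"
    then have "(1 / t) *\<^sub>R ((x + t *\<^sub>R v) - x) \<in> H" using True H by (intro subspace_scale subspace_diff)
    then show False using v t by simp
  qed
  ultimately show ?thesis by blast
qed (use x in blast)

text \<open>Small balls of \<open>W\<close> around points of \<open>C\<close> are convex, so
  \<open>convex_diff_subspace_connected\<close> joins their points off \<open>H\<close>;
  connectedness of \<open>C\<close> chains these local pieces, the links being points off
  \<open>H\<close>, which exist in every nonempty open piece.\<close>

lemma connected_diff_subspace:
  fixes C W H :: "'a::euclidean_space set"
  assumes C: "connected C" and op: "openin (top_of_set W) C"
    and W: "subspace W" and H: "subspace H" and HW: "H \<subseteq> W" and dim: "dim H + 2 \<le> dim W"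
  shows "connected (C - H)"
proof -
  define R where "R x y \<longleftrightarrow> (\<exists>T. connected T \<and> T \<subseteq> C - H \<and> x \<in> T \<and> y \<in> T)" for x y
  have trans: "R x z" if xy: "R x y" and yz: "R y z" for x y z
  proof -
    obtain S where S: "connected S" "S \<subseteq> C - H" "x \<in> S" "y \<in> S" using xy unfolding R_def by auto
    obtain T where T: "connected T" "T \<subseteq> C - H" "y \<in> T" "z \<in> T" using yz unfolding R_def by auto
    have "connected (S \<union> T)" using S T by (intro connected_Un) auto
    then show ?thesis using S T unfolding R_def by (intro exI[of _ "S \<union> T"]) auto
  qed
  have dense: "\<exists>z. z \<in> T \<and> z \<notin> H" if "openin (top_of_set C) T" "x \<in> T" for T x
    using subspace_complement_dense[OF openin_trans[OF that(1) op] W H HW _ that(2)] dim by auto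
  have loc: "\<exists>T. openin (top_of_set C) T \<and> x \<in> T \<and> (\<forall>y\<in>T. \<forall>z\<in>T. y \<notin> H \<and> z \<notin> H \<longrightarrow> R y z)"
    if x: "x \<in> C" for x
  proof -
    obtain e where e: "e > 0" "ball x e \<inter> W \<subseteq> C"
      using op x unfolding openin_contains_ball by auto
    define D where "D = ball x e \<inter> W"
    have CW: "C \<subseteq> W" using op by (rule openin_imp_subset)
    have opD: "openin (top_of_set W) D"
      unfolding D_def Int_commute[of "ball x e"] by (intro openin_open_Int open_ball)
    have DC: "D \<subseteq> C" using e(2) unfolding D_def .
    have "openin (top_of_set C) D" using opD DC CW by (rule openin_subset_trans)
    moreover have "x \<in> D" using x CW e unfolding D_def by auto
    moreover have "R y z" if yz: "y \<in> D" "z \<in> D" "y \<notin> H" "z \<notin> H" for y z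
    proof -
      have "convex D" unfolding D_def by (intro convex_Int subspace_imp_convex[OF W] convex_ball)
      from convex_diff_subspace_connected[OF this opD W H HW dim, of y z] yz
      obtain T where "connected T" "T \<subseteq> D - H" "y \<in> T" "z \<in> T" by auto
      then show ?thesis using DC unfolding R_def by (intro exI[of _ T]) auto
    qed
    ultimately show ?thesis by (intro exI[of _ D]) simp
  qed
  have R: "R a b" if a: "a \<in> C - H" and b: "b \<in> C - H" for a b
  proof (rule connected_equivalence_relation_gen[OF C, where P = "\<lambda>x. x \<notin> H" and R = R])
    show "a \<in> C" "b \<in> C" "a \<notin> H" "b \<notin> H" using a b by auto
  qed (fact trans dense loc)+
  show ?thesis unfolding connected_iff_connected_component
  proof (intro ballI)
    fix a b assume "a \<in> C - H" "b \<in> C - H"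
    from R[OF this] show "connected_component (C - H) a b"
      unfolding R_def connected_component_def .
  qed
qed

text \<open>\<open>S\<close> is only sandwiched because in the application the removed set is some
  unspecified subset of \<open>H\<close>; since \<open>C - H\<close> is dense in \<open>C\<close>,
  everything in between is connected.\<close>

lemma connected_open_inter_super:
  fixes C W H S :: "'a::euclidean_space set"
  assumes C: "connected C" and op: "openin (top_of_set W) C"
    and W: "subspace W" and H: "subspace H" and HW: "H \<subseteq> W" and dim: "dim H + 2 \<le> dim W"
    and S: "C - H \<subseteq> S" "S \<subseteq> C"
  shows "connected S"
proof (rule connected_intermediate_closure[OF connected_diff_subspace[OF C op W H HW dim] S(1)])
  show "S \<subseteq> closure (C - H)"
  proof
    fix x assume x: "x \<in> S"
    show "x \<in> closure (C - H)"
      unfolding closure_iff_nhds_not_empty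
    proof (intro allI impI)
      fix A V assume A: "V \<subseteq> A" "open V" "x \<in> V"
      have "openin (top_of_set W) (C \<inter> V)" using op A(2) by (simp add: openin_Int_open)
      moreover have "x \<in> C \<inter> V" using x S(2) A(3) by auto
      ultimately obtain z where "z \<in> C \<inter> V" "z \<notin> H"
        using subspace_complement_dense[OF _ W H HW, of "C \<inter> V" x] dim by auto
      then show "(C - H) \<inter> A \<noteq> {}" using A(1) by auto
    qed
  qed
qed

text \<open>The fibres of \<open>f\<close> are open, so the union of all fibres but one is open too
  and no connected set meets two of them. As each fibre is connected, components correspond to
  values of \<open>f\<close>.\<close>

lemma connected_components_of_fibres:
  assumes op: "\<And>s. s \<in> S \<Longrightarrow> openin T {x \<in> topspace T. f x = s}"
    and con: "\<And>s. s \<in> S \<Longrightarrow> connectedin T {x \<in> topspace T. f x = s}"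
    and surj: "f ` topspace T = S"
  shows "card (connected_components_of T) = card S"
    and "\<And>x y. x \<in> topspace T \<Longrightarrow> y \<in> topspace T \<Longrightarrow> connected_component_of T x y \<longleftrightarrow> f x = f y"
proof -
  have same: "f x = f y" if cc: "connected_component_of T x y" for x y
  proof (rule ccontr)
    assume ne: "f x \<noteq> f y"
    obtain C where C: "connectedin T C" "x \<in> C" "y \<in> C"
      using cc unfolding connected_component_of_def by blast
    have CT: "C \<subseteq> topspace T" using C(1) by (rule connectedin_subset_topspace)
    define A where "A = {z \<in> topspace T. f z = f x}"
    define B where "B = (\<Union>s\<in>S - {f x}. {z \<in> topspace T. f z = s})"
    have S: "f z \<in> S" if "z \<in> C" for z using that CT surj by auto
    have "openin T A" unfolding A_def using S C by (intro op) auto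
    moreover have "openin T B" unfolding B_def using op by (intro openin_clauses) auto
    moreover have "C \<subseteq> A \<union> B" using CT S unfolding A_def B_def by auto
    moreover have "A \<inter> B \<inter> C = {}" unfolding A_def B_def by auto
    moreover have "A \<inter> C \<noteq> {}" using C CT unfolding A_def by auto
    moreover have "y \<in> B" using C CT ne S[OF C(3)] unfolding B_def by auto
    then have "B \<inter> C \<noteq> {}" using C by auto
    ultimately show False using C(1) unfolding connectedin by meson
  qed
  show iff: "connected_component_of T x y \<longleftrightarrow> f x = f y" if "x \<in> topspace T" "y \<in> topspace T" for x y
  proof
    assume "f x = f y"
    then show "connected_component_of T x y"
      using con[of "f x"] that surj unfolding connected_component_of_def
      by (intro exI[of _ "{z \<in> topspace T. f z = f x}"]) auto
  qed (rule same)
  have eq: "connected_component_of_set T x = {y \<in> topspace T. f y = f x}" if x: "x \<in> topspace T" for x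
  proof -
    have "connected_component_of_set T x \<subseteq> topspace T"
      by (rule connected_component_of_subset_topspace)
    with iff[OF x] show ?thesis by auto
  qed
  have "connected_components_of T = (\<lambda>s. {y \<in> topspace T. f y = s}) ` S"
    unfolding connected_components_of_def surj[symmetric] image_image by (intro image_cong refl) (rule eq)
  moreover have "inj_on (\<lambda>s. {y \<in> topspace T. f y = s}) S"
  proof (rule inj_onI)
    fix s t assume s: "s \<in> S" "{y \<in> topspace T. f y = s} = {y \<in> topspace T. f y = t}"
    then obtain x where "x \<in> topspace T" "f x = s" using surj by blast
    then show "s = t" using s(2) by blast
  qed
  ultimately show "card (connected_components_of T) = card S" by (simp add: card_image)
qed


subsection \<open>The bilinear form and Eichler transformations\<close>

text \<open>Positions start at 0: for m < q, \<open>bas m\<close> is e_(m+1) and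
  \<open>bas (p + q - 1 - m)\<close> is tilde e_(m+1).\<close>

definition bas :: "nat \<Rightarrow> 'n::{finite,linorder} rvec" where
  "bas a = axis (idx a) 1"

text \<open>Recording coordinate subspaces by sets of positions lets W_j, both standard flags and
  the subspaces tested by \<open>good\<close> be handled through inclusion and cardinality of index
  sets.\<close>

definition supp :: "nat set \<Rightarrow> 'n::{finite,linorder} rvec set" where
  "supp A = {x. \<forall>i. x $ i \<noteq> 0 \<longrightarrow> pos i \<in> A}"

lemma subspace_supp [simp]: "subspace (supp A)"
proof (rule subspaceI)
  fix x y :: "'a rvec" assume x: "x \<in> supp A" and y: "y \<in> supp A"
  show "x + y \<in> supp A" unfolding supp_def
  proof safe
    fix i assume "(x + y) $ i \<noteq> 0"
    then have "x $ i \<noteq> 0 \<or> y $ i \<noteq> 0" by auto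
    then show "pos i \<in> A" using x y unfolding supp_def by blast
  qed
qed (auto simp: supp_def)

lemma supp_mono: "A \<subseteq> A' \<Longrightarrow> supp A \<subseteq> supp A'"
  unfolding supp_def by blast

lemma suppD: "x \<in> supp A \<Longrightarrow> pos i \<notin> A \<Longrightarrow> x $ i = 0"
  unfolding supp_def by blast

lemma suppI: "(\<And>i. pos i \<notin> A \<Longrightarrow> x $ i = 0) \<Longrightarrow> x \<in> supp A"
  unfolding supp_def by blast

lemma dim_supp:
  assumes "A \<subseteq> {..<CARD('n)}"
  shows "dim (supp A :: 'n::{finite,linorder} rvec set) = card A"
proof -
  let ?I = "{i::'n. pos i \<in> A}"
  let ?d = "(\<lambda>i::'n. axis i (1::real)) ` ?I"
  have "supp A = {x :: 'n rvec. \<forall>b\<in>Basis. b \<notin> ?d \<longrightarrow> inner x b = 0}"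
    (is "_ = ?R")
  proof (intro equalityI subsetI)
    fix x :: "'n rvec" assume "x \<in> supp A"
    then show "x \<in> ?R" by (auto simp: Basis_vec_def inner_axis dest: suppD)
  next
    fix x :: "'n rvec" assume x: "x \<in> ?R"
    show "x \<in> supp A"
    proof (rule suppI)
      fix i :: 'n assume "pos i \<notin> A"
      then have "axis i 1 \<notin> ?d" by (auto simp: axis_eq_axis)
      then show "x $ i = 0" using x by (auto simp: Basis_vec_def inner_axis)
    qed
  qed
  moreover have "?d \<subseteq> (Basis :: 'n rvec set)" by (auto simp: Basis_vec_def)
  ultimately have "dim (supp A :: 'n rvec set) = card ?d" by (simp add: dim_substandard)
  also have "\<dots> = card ?I" by (rule card_image) (simp add: inj_on_def axis_eq_axis)
  also have "\<dots> = card (pos ` ?I)"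
    by (rule card_image[symmetric]) (rule inj_on_subset[OF bij_betw_imp_inj_on[OF bij_betw_pos] subset_UNIV])
  also have "pos ` ?I = A"
  proof
    show "A \<subseteq> pos ` ?I"
    proof
      fix a assume "a \<in> A"
      then show "a \<in> pos ` ?I" using assms by (intro image_eqI[of _ _ "idx a"]) (auto simp: pos_idx)
    qed
  qed auto
  finally show ?thesis .
qed

text \<open>The Gram matrix is the permutation matrix of this involution: the form pairs coordinate
  \<open>i\<close> with coordinate \<open>dual p q i\<close>.\<close>

definition dual :: "nat \<Rightarrow> nat \<Rightarrow> 'n::{finite,linorder} \<Rightarrow> 'n" where
  "dual p q i = (if q \<le> pos i \<and> pos i < p then i else idx (p + q - 1 - pos i))"

text \<open>The Eichler transformation attached to an isotropic vector \<open>a\<close> and \<open>w\<close> orthogonal to it.\<close>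

definition eich :: "nat \<Rightarrow> nat \<Rightarrow> 'n::{finite,linorder} rvec \<Rightarrow> 'n rvec \<Rightarrow> 'n rmat" where
  "eich p q a w = (\<chi> i j. (if i = j then 1 else 0) + w $ i * a $ dual p q j - a $ i * w $ dual p q j
     - bform p q w w / 2 * a $ i * a $ dual p q j)"

text \<open>The bound k < q - 1 is stored without truncated subtraction. It leaves e_(k+1) and
  e_(k+2) as isotropic basis vectors beyond the flag, and \<open>bf_bas\<close> covers them
  too.\<close>

locale rpq =
  fixes p q k :: nat and N :: "'n::{finite,linorder} itself"
  assumes card_n: "CARD('n) = p + q" and qp: "q \<le> p" and kq: "k + 2 \<le> q"
begin

abbreviation n :: nat where "n \<equiv> p + q"
abbreviation bf :: "'n rvec \<Rightarrow> 'n rvec \<Rightarrow> real" where "bf \<equiv> bform p q"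
abbreviation E :: "'n rvec \<Rightarrow> 'n rvec \<Rightarrow> 'n rmat" where "E \<equiv> eich p q"
abbreviation Isom :: "'n rmat set" where "Isom \<equiv> isometries p q"

lemma pos_lt: "pos (i::'n) < n"
  using bij_betw_pos[where 'n='n] card_n by (metis UNIV_I bij_betw_apply lessThan_iff)

lemma pos_idx_n [simp]: "a < n \<Longrightarrow> pos (idx a :: 'n) = a"
  by (simp add: pos_idx card_n)

lemma pos_inj: "pos (i::'n) = pos j \<longleftrightarrow> i = j"
  by (metis idx_pos)

lemma idx_eq_iff: "a < n \<Longrightarrow> b < n \<Longrightarrow> (idx a :: 'n) = idx b \<longleftrightarrow> a = b"
  by (metis pos_idx_n)

lemma pos_dual: "pos (dual p q (i::'n)) = (if q \<le> pos i \<and> pos i < p then pos i else n - 1 - pos i)"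
  using pos_lt[of i] by (auto simp: dual_def)

lemma dual_dual [simp]: "dual p q (dual p q (i::'n)) = i"
  unfolding pos_inj[symmetric] using pos_lt[of i] qp by (auto simp: pos_dual)

lemma bij_dual: "bij (dual p q :: 'n \<Rightarrow> 'n)"
  by (rule bij_betw_byWitness[where f' = "dual p q"]) auto

lemma dual_idx: "a < k + 2 \<or> n - k - 2 \<le> a \<Longrightarrow> a < n \<Longrightarrow> dual p q (idx a :: 'n) = idx (n - 1 - a)"
  using kq qp by (auto simp: dual_def)

lemma gram_nth: "(gram p q *v (y :: 'n rvec)) $ i = y $ dual p q i"
proof -
  have "gram p q $ i $ j = (if j = dual p q i then 1 else 0 :: real)" for j :: 'n
    using pos_lt[of i] pos_lt[of j]
    by (auto simp: gram_def pos_inj[symmetric] pos_dual)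
  then show ?thesis by (simp add: matrix_vector_mult_def if_distrib[of "\<lambda>x. x * _"] cong: if_cong)
qed

lemma bf_sum: "bf x y = (\<Sum>i\<in>UNIV. x $ i * y $ dual p q i)"
  by (simp add: bform_def inner_vec_def gram_nth)

lemma bf_commute: "bf x y = bf y x"
proof -
  have "(\<Sum>i\<in>UNIV. x $ i * y $ dual p q i) = (\<Sum>i\<in>UNIV. x $ dual p q i * y $ dual p q (dual p q i))"
    by (rule sum.reindex_bij_betw[OF bij_dual, where g = "\<lambda>i. x $ i * y $ dual p q i", symmetric])
  also have "\<dots> = (\<Sum>i\<in>UNIV. y $ i * x $ dual p q i)"
    unfolding dual_dual by (intro sum.cong refl mult.commute)
  finally show ?thesis unfolding bf_sum .
qed

lemma bf_linear [simp]:
  "bf (x + y) z = bf x z + bf y z" "bf z (x + y) = bf z x + bf z y"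
  "bf (x - y) z = bf x z - bf y z" "bf z (x - y) = bf z x - bf z y"
  "bf (c *\<^sub>R x) z = c * bf x z" "bf z (c *\<^sub>R x) = c * bf z x"
  "bf 0 z = 0" "bf z 0 = 0" "bf (- x) z = - bf x z" "bf z (- x) = - bf z x"
  by (simp_all add: bf_sum algebra_simps sum.distrib sum_subtractf sum_distrib_left sum_negf)

lemma bf_sum_right: "bf z (\<Sum>i\<in>I. f i) = (\<Sum>i\<in>I. bf z (f i))"
  by (induction I rule: infinite_finite_induct) auto

lemma bf_axis: "bf (axis i 1) y = y $ dual p q i"
  by (simp add: bf_sum axis_def if_distrib[of "\<lambda>x. x * _"] cong: if_cong)

lemma bas_nth: "a < n \<Longrightarrow> (bas a :: 'n rvec) $ i = (if pos i = a then 1 else 0)"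
  by (auto simp: bas_def axis_def)

lemma bas_supp: "a < n \<Longrightarrow> a \<in> A \<Longrightarrow> (bas a :: 'n rvec) \<in> supp A"
  by (auto simp: supp_def bas_nth)

lemma bf_bas: "a < k + 2 \<or> n - k - 2 \<le> a \<Longrightarrow> a < n \<Longrightarrow> bf (bas a) y = y $ idx (n - 1 - a)"
  by (simp add: bas_def bf_axis dual_idx)

lemma bf_bas': "a < k + 2 \<or> n - k - 2 \<le> a \<Longrightarrow> a < n \<Longrightarrow> bf y (bas a) = y $ idx (n - 1 - a)"
  by (metis bf_commute bf_bas)

lemma bf_nondeg: "(\<And>y. bf x y = 0) \<Longrightarrow> x = 0"
  unfolding vec_eq_iff by (metis bf_axis bf_commute dual_dual zero_index)

lemma bf_gram: "bf (gram p q *v x) x = inner x x"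
  unfolding bf_commute[of _ x] by (simp add: bf_sum gram_nth inner_vec_def)

lemma continuous_bf [continuous_intros]:
  assumes "continuous_on S f" "continuous_on S g"
  shows "continuous_on S (\<lambda>x. bf (f x) (g x))"
  unfolding bf_sum by (intro continuous_intros assms)

lemma E_vec: "E a w *v x = x + bf a x *\<^sub>R w - bf w x *\<^sub>R a - (bf w w / 2 * bf a x) *\<^sub>R a"
proof -
  have "(E a w *v x) $ i = x $ i + (\<Sum>j\<in>UNIV. a $ dual p q j * x $ j) * w $ i
     - (\<Sum>j\<in>UNIV. w $ dual p q j * x $ j) * a $ i
     - bf w w / 2 * (\<Sum>j\<in>UNIV. a $ dual p q j * x $ j) * a $ i" for i
    by (simp add: eich_def matrix_vector_mult_def algebra_simps sum.distrib sum_subtractf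
        sum_distrib_left sum_distrib_right if_distrib[of "\<lambda>x. _ * x"] cong: if_cong)
  moreover have "(\<Sum>j\<in>UNIV. a $ dual p q j * x $ j) = bf a x" for a
    unfolding bf_commute[of a x] by (simp add: bf_sum mult.commute)
  ultimately show ?thesis unfolding vec_eq_iff by simp
qed

lemma Isom_bf: "U \<in> Isom \<Longrightarrow> bf (U *v x) (U *v y) = bf x y"
  unfolding isometries_def by blast

lemma Isom_inj: "U \<in> Isom \<Longrightarrow> U *v x = U *v y \<longleftrightarrow> x = y"
  unfolding isometries_def by (metis (mono_tags) inj_def invertible_eq_bij bij_def mem_Collect_eq)

lemma Isom_surj: "U \<in> Isom \<Longrightarrow> \<exists>x. U *v x = y"
  unfolding isometries_def by (metis (mono_tags) surj_def invertible_eq_bij bij_def mem_Collect_eq)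

lemma Isom_mult: "U \<in> Isom \<Longrightarrow> V \<in> Isom \<Longrightarrow> U ** V \<in> Isom"
  unfolding isometries_def by (auto simp: invertible_mult simp flip: matrix_vector_mul_assoc)

lemma one_Isom: "Finite_Cartesian_Product.mat 1 \<in> Isom"
  unfolding isometries_def by (auto simp: invertible_def)

lemma E_Isom:
  assumes "bf a a = 0" "bf a w = 0"
  shows "E a w \<in> Isom"
proof -
  have wa: "bf w a = 0" using assms(2) bf_commute[of w a] by simp
  \<comment> \<open>For fixed isotropic \<open>a\<close>, the map from \<open>w\<close> to
    \<open>E a w\<close> turns addition into multiplication on the orthogonal of \<open>a\<close>,
    so the inverse is \<open>E a (- w)\<close>.\<close>
  have inv: "E a w ** E a (- w) = Finite_Cartesian_Product.mat 1" if "bf a w = 0" "bf w a = 0" for w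
    unfolding matrix_eq matrix_vector_mul_assoc[symmetric]
    by (simp add: E_vec assms that algebra_simps flip: scaleR_add_left)
  have "invertible (E a w)" unfolding invertible_def
    using inv[of w] inv[of "- w"] wa assms by (intro exI[of _ "E a (- w)"]) auto
  moreover have "bf (E a w *v x) (E a w *v y) = bf x y" for x y
    by (simp add: E_vec assms wa bf_commute[of x a] bf_commute[of x w] algebra_simps)
  ultimately show ?thesis unfolding isometries_def by blast
qed

lemma E_zero: "E a 0 = Finite_Cartesian_Product.mat 1"
  unfolding matrix_eq by (simp add: E_vec)

lemma continuous_E [continuous_intros]:
  assumes "continuous_on S f" "continuous_on S g"
  shows "continuous_on S (\<lambda>x. E (f x) (g x))"
  unfolding eich_def by (intro continuous_intros assms) auto

lemma SO0_Isom: "SO0 p q \<subseteq> Isom"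
  unfolding SO0_def by (rule connected_component_subset)

lemma one_SO0: "Finite_Cartesian_Product.mat 1 \<in> (SO0 p q :: 'n rmat set)"
  unfolding SO0_def using one_Isom by (simp add: connected_component_refl)

lemma SO0I:
  assumes "connected T" "T \<subseteq> Isom" "Finite_Cartesian_Product.mat 1 \<in> T" "U \<in> T"
  shows "U \<in> SO0 p q"
  unfolding SO0_def using assms by (auto simp: connected_component_def)

lemma continuous_matrix_mult [continuous_intros]:
  fixes f g :: "'b::topological_space \<Rightarrow> 'n rmat"
  assumes "continuous_on S f" "continuous_on S g"
  shows "continuous_on S (\<lambda>x. f x ** g x)"
  unfolding matrix_matrix_mult_def by (intro continuous_intros assms)

text \<open>The translate of \<open>SO0 p q\<close> by \<open>U\<close> is connected, consists of
  isometries and meets \<open>SO0 p q\<close> in \<open>U\<close>, so it stays in the identity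
  component.\<close>

lemma SO0_mult:
  fixes U V :: "'n rmat"
  assumes U: "U \<in> SO0 p q" and V: "V \<in> SO0 p q"
  shows "U ** V \<in> SO0 p q"
proof -
  have con: "connected (SO0 p q :: 'n rmat set)" unfolding SO0_def by simp
  let ?S = "SO0 p q :: 'n rmat set"
  have "connected ((\<lambda>X. U ** X) ` ?S)"
    by (rule connected_continuous_image[OF continuous_matrix_mult con]) (intro continuous_on_const continuous_on_id)+
  moreover have "U \<in> (\<lambda>X. U ** X) ` ?S"
    by (rule image_eqI[OF _ one_SO0]) simp
  ultimately have "connected (?S \<union> (\<lambda>X. U ** X) ` ?S)"
    using con U by (intro connected_Un) auto
  moreover have "?S \<union> (\<lambda>X. U ** X) ` ?S \<subseteq> Isom" using U SO0_Isom Isom_mult by auto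
  ultimately show ?thesis by (rule SO0I) (use one_SO0 V in auto)
qed

lemma E_SO0:
  assumes "bf a a = 0" "bf a w = 0"
  shows "E a w \<in> SO0 p q"
proof (rule SO0I[of "(\<lambda>t. E a (t *\<^sub>R w)) ` {0..1}"])
  show "connected ((\<lambda>t. E a (t *\<^sub>R w)) ` {0..1::real})"
    by (intro connected_continuous_image continuous_intros) simp
  show "Finite_Cartesian_Product.mat 1 \<in> (\<lambda>t. E a (t *\<^sub>R w)) ` {0..1::real}"
    by (rule image_eqI[of _ _ 0]) (simp_all add: E_zero)
  show "E a w \<in> (\<lambda>t. E a (t *\<^sub>R w)) ` {0..1::real}" by (rule image_eqI[of _ _ 1]) simp_all
qed (use assms in \<open>auto intro!: E_Isom\<close>)

end


subsection \<open>Sides of a quadric\<close>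

context rpq
begin

abbreviation Wsp :: "nat \<Rightarrow> 'n rvec set" where "Wsp m \<equiv> supp {m..<n - m}"
text \<open>As a linear map the Gram matrix is an involution that preserves \<open>Wsp m\<close> for
  m at most q. Its eigenspaces for 1 and -1 are orthogonal, and the form is positive definite on the
  first and negative definite on the second.\<close>

abbreviation flip :: "'n rvec \<Rightarrow> 'n rvec" where "flip x \<equiv> gram p q *v x"

lemma flip_flip [simp]: "flip (flip x) = x"
  by (simp add: vec_eq_iff gram_nth)

lemma flip_linear [simp]:
  "flip (x + y) = flip x + flip y" "flip (x - y) = flip x - flip y" "flip (c *\<^sub>R x) = c *\<^sub>R flip x"
  by (simp_all add: vec_eq_iff gram_nth)

lemma flip_Wsp: "m \<le> q \<Longrightarrow> x \<in> Wsp m \<Longrightarrow> flip x \<in> Wsp m"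
proof (rule suppI)
  fix i :: 'n assume m: "m \<le> q" and x: "x \<in> Wsp m" and i: "pos i \<notin> {m..<n - m}"
  have "pos (dual p q i) \<notin> {m..<n - m}" using i m qp pos_lt[of i] by (auto simp: pos_dual)
  then show "flip x $ i = 0" using x by (simp add: gram_nth suppD)
qed

text \<open>Every position \<open>a\<close> with m <= a < q contributes an eigenvector
  \<open>u a\<close>, and q - 1 and q - 2 always qualify. Dimension 2 matters because a punctured
  line is disconnected.\<close>

lemma eigenspace_dim:
  assumes m: "m \<le> q - 2" and s: "s = 1 \<or> s = - 1"
  shows "subspace {w \<in> Wsp m. flip w = s *\<^sub>R w}" "2 \<le> dim {w \<in> Wsp m. flip w = s *\<^sub>R w}"
proof -
  let ?P = "{w \<in> Wsp m. flip w = s *\<^sub>R w}"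
  show "subspace ?P"
  proof (rule subspaceI)
    show "0 \<in> ?P" by (simp add: subspace_0)
  qed (auto intro: subspace_add subspace_scale simp: algebra_simps)
  define u :: "nat \<Rightarrow> 'n rvec" where "u a = bas a + s *\<^sub>R flip (bas a)" for a
  have ss: "s * s = 1" using s by auto
  have uP: "u a \<in> ?P" if a: "m \<le> a" "a < q" for a
  proof -
    have "(bas a :: 'n rvec) \<in> Wsp m" using a m qp kq by (intro bas_supp) auto
    then have "u a \<in> Wsp m" unfolding u_def
      using m by (intro subspace_add subspace_scale subspace_supp flip_Wsp) auto
    moreover have "flip (u a) = s *\<^sub>R u a" by (simp add: u_def scaleR_add_right ss)
    ultimately show ?thesis by simp
  qed
  have u_nth: "u a $ idx b = (if a = b then 1 else 0)" if "a < q" "b < q" for a b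
    using that qp by (auto simp: u_def bas_nth gram_nth pos_dual)
  have "independent {u (q - 1), u (q - 2)}"
  proof -
    have q: "q - 1 < q" "q - 2 < q" "q - 1 \<noteq> q - 2" using kq by auto
    have "u (q - 2) \<noteq> 0" using u_nth[OF q(2) q(2)] by auto
    moreover have "u (q - 1) \<notin> span {u (q - 2)}"
    proof
      assume "u (q - 1) \<in> span {u (q - 2)}"
      then obtain c where "u (q - 1) = c *\<^sub>R u (q - 2)" by (auto simp: span_singleton)
      then have "u (q - 1) $ idx (q - 1) = c * u (q - 2) $ idx (q - 1)" by simp
      then show False using u_nth[OF q(1) q(1)] u_nth[OF q(2) q(1)] q(3) by simp
    qed
    ultimately show ?thesis by (simp add: independent_insert)
  qed
  moreover have "{u (q - 1), u (q - 2)} \<subseteq> ?P" using uP m kq by auto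
  moreover have "u (q - 1) \<noteq> u (q - 2)"
  proof
    have q: "q - 1 < q" "q - 2 < q" "q - 1 \<noteq> q - 2" using kq by auto
    assume "u (q - 1) = u (q - 2)"
    then show False using u_nth[OF q(1) q(1)] u_nth[OF q(2) q(1)] q(3) by simp
  qed
  ultimately show "2 \<le> dim ?P" using independent_card_le_dim[of "{u (q - 1), u (q - 2)}" ?P] by simp
qed

text \<open>Split w = x + y along the two eigenspaces of \<open>flip\<close>: then
  \<open>s * bf w w\<close> is |x|^2 - |y|^2, so the cone is the image of the pairs with |y| < |x|.
  These fibre over the punctured space \<open>P - {0}\<close> with balls of \<open>Q\<close> as
  fibres.\<close>

lemma cone_connected:
  assumes m: "m \<le> q - 2" and s: "s = 1 \<or> s = - 1"
  shows "connected {w \<in> Wsp m. s * bf w w > 0}" "{w \<in> Wsp m. s * bf w w > 0} \<noteq> {}"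
proof -
  define P where "P = {w \<in> Wsp m. flip w = s *\<^sub>R w}"
  define Q where "Q = {w \<in> Wsp m. flip w = (- s) *\<^sub>R w}"
  define Z where "Z = {(x, y). x \<in> P - {0} \<and> y \<in> Q \<and> norm y < norm x}"
  have ss: "s * s = 1" using s by auto
  have P: "subspace P" "2 \<le> dim P" unfolding P_def using eigenspace_dim[OF m s] by auto
  have Q: "subspace Q" unfolding Q_def using eigenspace_dim(1)[OF m, of "- s"] s by auto
  have bfP: "bf y x = s * inner y x" if "x \<in> P" for x y
    using that by (simp add: P_def bform_def)
  have bfQ: "bf y x = - s * inner y x" if "x \<in> Q" for x y
    using that by (simp add: Q_def bform_def)
  have split: "s * bf (x + y) (x + y) = norm x ^ 2 - norm y ^ 2" if x: "x \<in> P" and y: "y \<in> Q" for x y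
  proof -
    have "bf x y = - bf x y"
      using bfQ[OF y, of x] bfP[OF x, of y] bf_commute[of x y] by (simp add: inner_commute)
    then have "bf x y = 0" "bf y x = 0" using bf_commute[of x y] by auto
    then show ?thesis using bfP[OF x, of x] bfQ[OF y, of y] s
      by (auto simp: power2_norm_eq_inner)
  qed
  have "connected Z"
  proof (rule connected_open_fibres[where A = "P - {0}"])
    have "aff_dim P \<noteq> 1" using P by (simp add: aff_dim_subspace)
    then show "connected (P - {0})"
      by (intro connected_punctured_convex subspace_imp_convex P)
    show "fst ` Z \<subseteq> P - {0}" by (auto simp: Z_def)
    fix x assume x: "x \<in> P - {0}"
    have "{y. (x, y) \<in> Z} = Q \<inter> ball 0 (norm x)" using x by (auto simp: Z_def)
    then show "connected {y. (x, y) \<in> Z}"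
      using Q by (simp add: convex_connected convex_Int subspace_imp_convex)
    show "\<exists>y. (x, y) \<in> Z" using x subspace_0[OF Q] by (intro exI[of _ 0]) (simp add: Z_def)
  next
    fix x y assume xy: "(x, y) \<in> Z"
    have "open {x'. norm y < norm x'}" by (intro open_Collect_less continuous_intros)
    then show "\<exists>V. open V \<and> x \<in> V \<and> (\<forall>x'\<in>V \<inter> (P - {0}). (x', y) \<in> Z)"
      using xy by (intro exI[of _ "{x'. norm y < norm x'}"]) (auto simp: Z_def)
  qed
  then have "connected ((\<lambda>z. fst z + snd z) ` Z)"
    by (intro connected_continuous_image continuous_intros)
  also have "(\<lambda>z. fst z + snd z) ` Z = {w \<in> Wsp m. s * bf w w > 0}"
  proof (intro equalityI subsetI)
    fix w assume "w \<in> (\<lambda>z. fst z + snd z) ` Z"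
    then obtain x y where w: "w = x + y" "x \<in> P" "y \<in> Q" "norm y < norm x" by (auto simp: Z_def)
    have "norm y ^ 2 < norm x ^ 2" using w(4) by (intro power_strict_mono) auto
    moreover have "w \<in> Wsp m" using w by (auto simp: P_def Q_def intro!: subspace_add)
    ultimately show "w \<in> {w \<in> Wsp m. s * bf w w > 0}" using w split by simp
  next
    fix w assume w: "w \<in> {w \<in> Wsp m. s * bf w w > 0}"
    define x where "x = (1 / 2) *\<^sub>R (w + s *\<^sub>R flip w)"
    define y where "y = (1 / 2) *\<^sub>R (w - s *\<^sub>R flip w)"
    have fw: "flip w \<in> Wsp m" using w m by (intro flip_Wsp) auto
    have x: "x \<in> P" unfolding P_def x_def using w fw ss
      by (auto simp: scaleR_add_right algebra_simps intro!: subspace_scale subspace_add)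
    have y: "y \<in> Q" unfolding Q_def y_def using w fw ss
      by (auto simp: scaleR_diff_right algebra_simps intro!: subspace_scale subspace_diff)
    have xy: "w = x + y" unfolding x_def y_def by (simp add: algebra_simps flip: scaleR_add_left)
    have "norm y ^ 2 < norm x ^ 2" using split[OF x y] w unfolding xy by simp
    then have "norm y < norm x" by (rule power_less_imp_less_base) simp
    then have "(x, y) \<in> Z" using x y by (auto simp: Z_def)
    then show "w \<in> (\<lambda>z. fst z + snd z) ` Z" using xy by (intro image_eqI[of _ _ "(x, y)"]) auto
  qed
  finally show "connected {w \<in> Wsp m. s * bf w w > 0}" .
  obtain x where x: "x \<in> P" "x \<noteq> 0" using P(2) subspace_0[OF P(1)]
    by (metis dim_eq_0 insertCI not_numeral_le_zero subset_singleton_iff subsetI dim_singleton le_zero_eq)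
  then have "s * bf (x + 0) (x + 0) > 0" using split[OF x(1) subspace_0[OF Q]] by simp
  then show "{w \<in> Wsp m. s * bf w w > 0} \<noteq> {}" using x(1) by (auto simp: P_def)
qed

text \<open>For \<alpha> nonzero, completing the square at \<open>u\<close>, that is v / \<alpha>,
  leaves the constant c + <v,v> / (2 \<alpha>), which \<open>rel\<close> makes 0; the side is a
  translated cone. For \<alpha> = 0 it is an open half space of \<open>Wsp m\<close>, nonempty
  because \<open>flip v\<close> pairs positively with \<open>v\<close>.\<close>

lemma quadric_side_connected:
  assumes m: "m \<le> q - 2" and s: "s = 1 \<or> s = - 1"
    and v: "v \<in> Wsp m" and rel: "2 * \<alpha> * c + bf v v = 0" and ne: "\<alpha> \<noteq> 0 \<or> v \<noteq> 0"
  defines "C \<equiv> {w \<in> Wsp m. s * (c + bf w v - \<alpha> / 2 * bf w w) > 0}"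
  shows "connected C" "C \<noteq> {}" "openin (top_of_set (Wsp m)) C"
proof -
  have "C = Wsp m \<inter> {w. s * (c + bf w v - \<alpha> / 2 * bf w w) > 0}" unfolding C_def by auto
  moreover have "open {w. s * (c + bf w v - \<alpha> / 2 * bf w w) > 0}"
    by (intro open_Collect_less continuous_intros)
  ultimately show "openin (top_of_set (Wsp m)) C" by (simp add: openin_open_Int)
  have "connected C \<and> C \<noteq> {}"
  proof (cases "\<alpha> = 0")
    case True
    then have C: "C = {w \<in> Wsp m. s * (c + bf w v) > 0}" unfolding C_def by simp
    have "convex C"
    proof (rule convexI)
      fix x y :: "'n rvec" and a b :: real
      assume x: "x \<in> C" and y: "y \<in> C" and ab: "0 \<le> a" "0 \<le> b" "a + b = 1"
      \<comment> \<open>The last summand vanishes; it makes the identity purely algebraic,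
        independent of the relation a + b = 1.\<close>
      have "s * (c + bf (a *\<^sub>R x + b *\<^sub>R y) v) = a * (s * (c + bf x v)) + b * (s * (c + bf y v))
          + (1 - a - b) * (s * c)"
        by (simp add: algebra_simps)
      also have "\<dots> > 0"
      proof (cases "a = 0")
        case True then show ?thesis using ab y by (simp add: C)
      next
        case False
        have pos: "s * (c + bf x v) > 0" "s * (c + bf y v) > 0" using x y by (auto simp: C)
        have "a * (s * (c + bf x v)) > 0" using ab False pos(1) by (intro mult_pos_pos[of a]) auto
        moreover have "b * (s * (c + bf y v)) \<ge> 0" using ab pos(2) by (intro mult_nonneg_nonneg[of b]) auto
        moreover have "(1 - a - b) * (s * c) = 0" using ab by simp
        ultimately show ?thesis by linarith
      qed
      finally show "a *\<^sub>R x + b *\<^sub>R y \<in> C"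
        using x y by (auto simp: C intro!: subspace_add subspace_scale)
    qed
    moreover have "C \<noteq> {}"
    proof -
      define b where "b = inner v v"
      have b: "b > 0" using ne True by (simp add: b_def)
      \<comment> \<open>Chosen so that the affine function takes the value \<open>s\<close> at
        \<open>?w\<close>.\<close>
      let ?w = "((s - c) / b) *\<^sub>R flip v"
      have "bf ?w v = s - c" using b by (simp add: bf_gram b_def[symmetric])
      then have "s * (c + bf ?w v) = 1" using s by auto
      moreover have "?w \<in> Wsp m" using v m by (intro subspace_scale flip_Wsp) auto
      ultimately have "?w \<in> C" by (simp add: C)
      then show ?thesis by blast
    qed
    ultimately show ?thesis by (simp add: convex_connected)
  next
    case False
    \<comment> \<open>After the translation the side \<open>s\<close> of - \<alpha> / 2 <w,w> is the
      cone where <w,w> has sign \<open>t\<close>.\<close>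
    define t where "t = - s * sgn \<alpha>"
    have t: "t = 1 \<or> t = - 1" using s False by (auto simp: t_def sgn_if)
    define u where "u = (1 / \<alpha>) *\<^sub>R v"
    have u: "u \<in> Wsp m" unfolding u_def using v by (intro subspace_scale) auto
    have eq: "c + bf (u + w) v - \<alpha> / 2 * bf (u + w) (u + w) = - \<alpha> / 2 * bf w w" for w
    proof -
      have c: "c = - bf v v / (2 * \<alpha>)" using rel False by (simp add: field_simps)
      have "bf v w = bf w v" by (rule bf_commute)
      then show ?thesis using False unfolding c u_def by (simp add: field_simps power2_eq_square)
    qed
    have pos: "s * (- \<alpha> / 2 * x) > 0 \<longleftrightarrow> t * x > 0" for x
    proof -
      have "s * (- \<alpha> / 2 * x) = (\<bar>\<alpha>\<bar> / 2) * (t * x)" unfolding t_def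
        using s False by (auto simp: sgn_if abs_if)
      moreover have "\<bar>\<alpha>\<bar> / 2 > 0" using False by simp
      ultimately show ?thesis by (metis zero_less_mult_pos mult_pos_pos)
    qed
    have "C = (+) u ` {w \<in> Wsp m. t * bf w w > 0}"
    proof (intro equalityI subsetI)
      fix w assume w: "w \<in> C"
      then have "w - u \<in> Wsp m" using u by (auto simp: C_def intro: subspace_diff)
      moreover have "t * bf (w - u) (w - u) > 0"
        using w eq[of "w - u"] pos[of "bf (w - u) (w - u)"] by (simp add: C_def)
      ultimately show "w \<in> (+) u ` {w \<in> Wsp m. t * bf w w > 0}"
        by (intro image_eqI[of _ _ "w - u"]) auto
    next
      fix w assume "w \<in> (+) u ` {w \<in> Wsp m. t * bf w w > 0}"
      then obtain w' where w': "w = u + w'" "w' \<in> Wsp m" "t * bf w' w' > 0" by auto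
      then show "w \<in> C" unfolding C_def using u eq[of w'] pos[of "bf w' w'"]
        by (auto intro: subspace_add)
    qed
    moreover have "connected ((+) u ` {w \<in> Wsp m. t * bf w w > 0})"
      by (rule connected_continuous_image[OF _ cone_connected(1)[OF m t]]) (intro continuous_intros)
    ultimately show ?thesis using cone_connected(2)[OF m t] by simp
  qed
  then show "connected C" "C \<noteq> {}" by auto
qed

end


subsection \<open>Minors\<close>

text \<open>Rows are selected by \<open>r\<close> and columns are vectors of a family, so that the
  upper and the lower minors of a basis of a flag step are two instances with the same
  \<open>f\<close>.\<close>

definition minor :: "(nat \<Rightarrow> 'n) \<Rightarrow> nat \<Rightarrow> (nat \<Rightarrow> real ^ 'n) \<Rightarrow> real" where
  "minor r j f = Determinant.det (Matrix.mat j j (\<lambda>(a, b). f b $ r a))"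

lemma minor_cong: "(\<And>b. b < j \<Longrightarrow> f b = g b) \<Longrightarrow> minor r j f = minor r j g"
  unfolding minor_def by (intro arg_cong[of _ _ Determinant.det] eq_matI) auto

lemma minor_basis_change:
  assumes "\<And>b. b < j \<Longrightarrow> g b = (\<Sum>c<j. C c b *\<^sub>R f c)"
  shows "minor r j g = minor r j f * Determinant.det (Matrix.mat j j (\<lambda>(a, b). C a b))"
proof -
  let ?F = "Matrix.mat j j (\<lambda>(a, b). f b $ r a)" and ?C = "Matrix.mat j j (\<lambda>(a, b). C a b)"
  have "Matrix.mat j j (\<lambda>(a, b). g b $ r a) = ?F * ?C"
  proof (rule eq_matI)
    fix a b assume ab: "a < dim_row (?F * ?C)" "b < dim_col (?F * ?C)"
    then show "Matrix.mat j j (\<lambda>(a, b). g b $ r a) $$ (a, b) = (?F * ?C) $$ (a, b)"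
      using assms[of b] by (simp add: scalar_prod_def lessThan_atLeast0 mult.commute)
  qed auto
  then show ?thesis unfolding minor_def by (simp add: det_mult[of _ j])
qed

lemma span_family:
  fixes f :: "nat \<Rightarrow> 'a::real_vector"
  assumes "x \<in> span (f ` {..<j})"
  shows "\<exists>u. x = (\<Sum>c<j. u c *\<^sub>R f c)"
  using assms
proof (induction j arbitrary: x)
  case (Suc j)
  then obtain t where "x - t *\<^sub>R f j \<in> span (f ` {..<j})"
    by (auto simp: lessThan_Suc span_breakdown_eq)
  from Suc.IH[OF this] obtain u where u: "x - t *\<^sub>R f j = (\<Sum>c<j. u c *\<^sub>R f c)" by auto
  have "x = (\<Sum>c<j. (u(j := t)) c *\<^sub>R f c) + t *\<^sub>R f j" using u by (simp add: algebra_simps)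
  then show ?case by (intro exI[of _ "u(j := t)"]) simp
qed simp

text \<open>The factor is the determinant of the change of family and is the same for every choice
  of rows \<open>r\<close>; this uniformity later makes the product of two different minors change
  by a square.\<close>

lemma span_family_change:
  fixes f g :: "nat \<Rightarrow> real ^ 'n"
  assumes "span (g ` {..<j}) \<subseteq> span (f ` {..<j})"
  shows "\<exists>d. \<forall>r. minor r j g = minor r j f * d"
proof -
  have "\<exists>u. g b = (\<Sum>c<j. u c *\<^sub>R f c)" if "b < j" for b
    using that assms by (intro span_family subsetD[OF assms] span_base) auto
  then have "\<forall>b. \<exists>u. b < j \<longrightarrow> g b = (\<Sum>c<j. u c *\<^sub>R f c)" by auto
  then obtain U where U: "\<forall>b. b < j \<longrightarrow> g b = (\<Sum>c<j. U b c *\<^sub>R f c)" unfolding choice_iff by auto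
  show ?thesis
    by (intro exI allI) (rule minor_basis_change[where C = "\<lambda>c b. U b c"], use U in auto)
qed

text \<open>Vanishing is expressed by a relation among rows rather than columns, because the
  coefficients \<open>u\<close> will be the coordinates of a vector orthogonal to all the columns
  \<open>f b\<close>.\<close>

lemma minor_zero_iff:
  "minor r j f = 0 \<longleftrightarrow> (\<exists>u. (\<exists>a<j. u a \<noteq> 0) \<and> (\<forall>b<j. (\<Sum>a<j. u a * f b $ r a) = 0))"
proof -
  let ?M = "Matrix.mat j j (\<lambda>(b, a). f b $ r a)"
  have "minor r j f = Determinant.det ?M"
    unfolding minor_def
    by (subst Determinant.det_transpose[of _ j, symmetric]) (auto intro!: arg_cong[of _ _ Determinant.det] eq_matI)
  then have "minor r j f = 0 \<longleftrightarrow>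
      (\<exists>v. v \<in> carrier_vec j \<and> v \<noteq> 0\<^sub>v j \<and> ?M *\<^sub>v v = 0\<^sub>v j)"
    by (simp add: det_0_iff_vec_prod_zero[of _ j])
  also have "\<dots> \<longleftrightarrow> (\<exists>u. (\<exists>a<j. u a \<noteq> 0) \<and> (\<forall>b<j. (\<Sum>a<j. u a * f b $ r a) = 0))"
  proof
    assume "\<exists>v. v \<in> carrier_vec j \<and> v \<noteq> 0\<^sub>v j \<and> ?M *\<^sub>v v = 0\<^sub>v j"
    then obtain v where v: "v \<in> carrier_vec j" "v \<noteq> 0\<^sub>v j" "?M *\<^sub>v v = 0\<^sub>v j" by auto
    have "\<exists>a<j. vec_index v a \<noteq> 0"
    proof (rule ccontr)
      assume "\<not> ?thesis"
      then have "v = 0\<^sub>v j" using v(1) by (intro eq_vecI) auto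
      with v(2) show False by simp
    qed
    moreover have "(\<Sum>a<j. vec_index v a * f b $ r a) = 0" if "b < j" for b
    proof -
      have "vec_index (?M *\<^sub>v v) b = 0" using v(3) that by simp
      then show ?thesis using that v(1)
        by (simp add: mult_mat_vec_def scalar_prod_def lessThan_atLeast0 mult.commute)
    qed
    ultimately show "\<exists>u. (\<exists>a<j. u a \<noteq> 0) \<and> (\<forall>b<j. (\<Sum>a<j. u a * f b $ r a) = 0)"
      by (intro exI[of _ "vec_index v"]) auto
  next
    assume "\<exists>u. (\<exists>a<j. u a \<noteq> 0) \<and> (\<forall>b<j. (\<Sum>a<j. u a * f b $ r a) = 0)"
    then obtain u where u: "\<exists>a<j. u a \<noteq> 0" "\<forall>b<j. (\<Sum>a<j. u a * f b $ r a) = 0" by auto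
    let ?v = "Matrix.vec j u"
    have "?v \<noteq> 0\<^sub>v j"
    proof
      assume v0: "?v = 0\<^sub>v j"
      obtain a where a: "a < j" "u a \<noteq> 0" using u(1) by auto
      then have "vec_index ?v a = vec_index (0\<^sub>v j) a" by (simp only: v0)
      with a show False by simp
    qed
    moreover have "?M *\<^sub>v ?v = 0\<^sub>v j"
      using u(2) by (intro eq_vecI) (auto simp: mult_mat_vec_def scalar_prod_def lessThan_atLeast0 mult.commute)
    ultimately show "\<exists>v. v \<in> carrier_vec j \<and> v \<noteq> 0\<^sub>v j \<and> ?M *\<^sub>v v = 0\<^sub>v j"
      by (intro exI[of _ ?v]) auto
  qed
  finally show ?thesis .
qed

lemma minor_unitriangular:
  assumes "\<And>a b. b < a \<Longrightarrow> a < j \<Longrightarrow> f b $ r a = 0" and "\<And>a. a < j \<Longrightarrow> f a $ r a = 1"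
  shows "minor r j f = 1"
proof -
  let ?M = "Matrix.mat j j (\<lambda>(a, b). f b $ r a)"
  have "Determinant.det ?M = prod_list (diag_mat ?M)"
    by (rule det_upper_triangular[of _ j]) (auto simp: upper_triangular_def assms(1))
  also have "diag_mat ?M = map (\<lambda>_. 1) [0..<j]"
    unfolding diag_mat_def using assms(2) by simp
  also have "prod_list \<dots> = 1" by (induction j) auto
  finally show ?thesis unfolding minor_def .
qed

lemma minor_repeat:
  assumes "a < j" "b < j" "a \<noteq> b" "f a = f b"
  shows "minor r j f = 0"
  unfolding minor_def
  by (rule Determinant.det_identical_columns[of _ j a b]) (use assms in \<open>auto intro!: eq_vecI\<close>)

text \<open>Laplace expansion along column 0, whose cofactors do not see \<open>u\<close>. The last
  cofactor is singled out since it will be det_m up to sign, which keeps the coefficient vector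
  nonzero.\<close>

lemma minor_expand_first:
  "\<exists>c. (\<forall>u. minor r (Suc m) (f(0 := u)) = (\<Sum>a<Suc m. u $ r a * c a)) \<and>
       c m = (- 1) ^ m * minor r m (\<lambda>b. f (Suc b))"
proof -
  define M where "M u = Matrix.mat (Suc m) (Suc m) (\<lambda>(a, b). (f(0 := u)) b $ r a)" for u
  define c where "c a = cofactor (M 0) a 0" for a
  have cof: "cofactor (M u) a 0 = c a" if "a < Suc m" for u a
  proof -
    have "mat_delete (M u) a 0 = mat_delete (M 0) a 0"
      by (rule eq_matI) (auto simp: M_def mat_delete_def)
    then show ?thesis unfolding c_def cofactor_def by simp
  qed
  have "minor r (Suc m) (f(0 := u)) = (\<Sum>a<Suc m. u $ r a * c a)" for u
  proof -
    have "minor r (Suc m) (f(0 := u)) = Determinant.det (M u)" unfolding minor_def M_def ..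
    also have "\<dots> = (\<Sum>a<Suc m. M u $$ (a, 0) * cofactor (M u) a 0)"
      by (rule laplace_expansion_column) (auto simp: M_def)
    also have "\<dots> = (\<Sum>a<Suc m. u $ r a * c a)"
      by (rule sum.cong[OF refl]) (simp add: cof, simp add: M_def)
    finally show ?thesis .
  qed
  moreover have "c m = (- 1) ^ m * minor r m (\<lambda>b. f (Suc b))"
  proof -
    have "mat_delete (M 0) m 0 = Matrix.mat m m (\<lambda>(a, b). f (Suc b) $ r a)"
      by (rule eq_matI) (auto simp: M_def mat_delete_def)
    then show ?thesis unfolding c_def cofactor_def minor_def by simp
  qed
  ultimately show ?thesis by (intro exI[of _ c]) auto
qed

lemma continuous_minor [continuous_intros]:
  fixes F :: "'a::topological_space \<Rightarrow> nat \<Rightarrow> real ^ 'n"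
  assumes "\<And>b. continuous_on S (\<lambda>x. F x b)"
  shows "continuous_on S (\<lambda>x. minor r j (F x))"
proof -
  have "minor r j g = (\<Sum>\<pi> | \<pi> permutes {0..<j}. signof \<pi> * (\<Prod>i = 0..<j. g (\<pi> i) $ r i))"
    for g :: "nat \<Rightarrow> real ^ 'n"
    unfolding minor_def det_def'[OF mat_carrier]
    by (intro sum.cong prod.cong arg_cong2[where f = "(*)"] refl)
       (auto dest: permutes_in_image)
  moreover have "continuous_on S (\<lambda>x. \<Sum>\<pi> | \<pi> permutes {0..<j}. signof \<pi> * (\<Prod>i = 0..<j. F x (\<pi> i) $ r i))"
    by (intro continuous_intros assms)
  ultimately show ?thesis by simp
qed

text \<open>The columns are the images of tilde e_j, ..., tilde e_1 in this order; for j = m + 1,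
  column 0 is the one that belongs to the newest vector tilde e_(m+1).\<close>

lemma det_ur_minor:
  "det_ur j (A :: 'n::{finite,linorder} rmat) =
     minor idx j (\<lambda>b. A *v bas (CARD('n) - j + b))"
  unfolding det_ur_def minor_def bas_def by (simp add: matrix_vector_mult_basis column_def)


subsection \<open>Products of Eichler transformations\<close>

definition restr :: "nat set \<Rightarrow> 'n::{finite,linorder} rvec \<Rightarrow> 'n rvec" where
  "restr A x = (\<chi> i. if pos i \<in> A then x $ i else 0)"

lemma restr_nth: "restr A x $ i = (if pos i \<in> A then x $ i else 0)"
  by (simp add: restr_def)

lemma linear_restr: "linear (restr A)"
  by (rule linearI) (simp_all add: vec_eq_iff restr_nth)

lemma restr_supp: "restr A x \<in> supp A"
  by (rule suppI) (simp add: restr_nth)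

text \<open>The property of Eichler products through which they stabilize F_inf and have lower-right
  minors equal to 1.\<close>

definition unitri :: "'n::{finite,linorder} rmat \<Rightarrow> bool" where
  "unitri U \<longleftrightarrow> (\<forall>i j. pos j < pos i \<longrightarrow> U $ i $ j = 0) \<and> (\<forall>i. U $ i $ i = 1)"

lemma unitri_mult:
  fixes U V :: "'n::{finite,linorder} rmat"
  assumes U: "unitri U" and V: "unitri V"
  shows "unitri (U ** V)"
  unfolding unitri_def
proof (intro conjI allI impI)
  fix i j :: 'n assume ij: "pos j < pos i"
  have "U $ i $ l * V $ l $ j = 0" for l
  proof (cases "pos l < pos i")
    case True then show ?thesis using U unfolding unitri_def by simp
  next
    case False then have "pos j < pos l" using ij by simp
    then show ?thesis using V unfolding unitri_def by simp
  qed
  then have "(\<Sum>l\<in>UNIV. U $ i $ l * V $ l $ j) = 0" by (intro sum.neutral ballI)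
  then show "(U ** V) $ i $ j = 0" by (simp add: matrix_matrix_mult_def)
next
  fix i :: 'n
  have "U $ i $ l * V $ l $ i = (if l = i then 1 else 0)" for l
  proof (cases "pos l" "pos i" rule: linorder_cases)
    case less then show ?thesis using U unfolding unitri_def by auto
  next
    case equal then have "l = i" by (metis idx_pos)
    then show ?thesis using U V unfolding unitri_def by simp
  next
    case greater then show ?thesis using V unfolding unitri_def by auto
  qed
  then have "(\<Sum>l\<in>UNIV. U $ i $ l * V $ l $ i) = (\<Sum>l\<in>UNIV. if l = i then 1 else 0)"
    by (intro sum.cong refl)
  then show "(U ** V) $ i $ i = 1" by (simp add: matrix_matrix_mult_def)
qed

lemma unitri_supp:
  fixes U :: "'n::{finite,linorder} rmat"
  assumes U: "unitri U" and x: "x \<in> supp {..<a}"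
  shows "U *v x \<in> supp {..<a}"
proof (rule suppI)
  fix i :: 'n assume i: "pos i \<notin> {..<a}"
  have "U $ i $ l * x $ l = 0" for l
  proof (cases "pos l < a")
    case True then show ?thesis using U i unfolding unitri_def by simp
  next
    case False then show ?thesis using suppD[OF x, of l] by simp
  qed
  then have "(\<Sum>l\<in>UNIV. U $ i $ l * x $ l) = 0" by (intro sum.neutral ballI)
  then show "(U *v x) $ i = 0" by (simp add: matrix_vector_mult_def)
qed

text \<open>The products $E_1(w_1) \cdots E_m(w_m)$, where \<open>bas m\<close> is $e_{m+1}$; the predicate is imposed
  on every partial product.\<close>

primrec cell :: "nat \<Rightarrow> nat \<Rightarrow> (nat \<Rightarrow> 'n::{finite,linorder} rmat \<Rightarrow> bool) \<Rightarrow> nat \<Rightarrow> 'n rmat set" where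
  "cell p q P 0 = {Finite_Cartesian_Product.mat 1}"
| "cell p q P (Suc m) = {V. P (Suc m) V \<and>
     (\<exists>U\<in>cell p q P m. \<exists>w\<in>supp {Suc m..<p + q - Suc m}. V = U ** eich p q (bas m) w)}"

text \<open>\<open>good p q k m U\<close> says that \<open>U\<close> moves the Lagrangian
  $\mathrm{Span}(e_{m+1},\dots,e_k,\tilde e_1,\dots,\tilde e_m)$ away from $F_0^k$; it fails only in
  codimension at least 3.\<close>

definition good :: "nat \<Rightarrow> nat \<Rightarrow> nat \<Rightarrow> nat \<Rightarrow> 'n::{finite,linorder} rmat \<Rightarrow> bool" where
  "good p q k m U \<longleftrightarrow> (\<forall>x\<in>supp ({m..<k} \<union> {p + q - m..<p + q}).
     U *v x \<in> supp {p + q - k..<p + q} \<longrightarrow> x = 0)"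

text \<open>A failure is witnessed by a unit vector, so the complement is the projection of a closed
  set along a compact piece of the sphere, hence closed.\<close>

lemma open_good: "open {U :: 'n::{finite,linorder} rmat. good p q k m U}"
proof -
  let ?A = "supp ({m..<k} \<union> {p + q - m..<p + q}) :: 'n rvec set"
  let ?S = "sphere 0 1 \<inter> ?A"
  let ?T = "{z :: 'n rvec \<times> 'n rmat. \<forall>i. pos i \<notin> {p + q - k..<p + q} \<longrightarrow> (snd z *v fst z) $ i = 0}"
  have "compact ?S" by (intro compact_Int_closed compact_sphere closed_subspace subspace_supp)
  moreover have "closed ?T"
  proof -
    have "?T = (\<Inter>i\<in>{i. pos i \<notin> {p + q - k..<p + q}}. {z. (snd z *v fst z) $ i = 0})" by auto
    moreover have "closed {z :: 'n rvec \<times> 'n rmat. (snd z *v fst z) $ i = 0}" for i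
      unfolding matrix_vector_mult_def by (intro closed_Collect_eq) (simp_all, intro continuous_intros)
    ultimately show ?thesis by (simp only:) (intro closed_INT ballI)
  qed
  ultimately have "closed {U. \<exists>x. x \<in> ?S \<and> (x, U) \<in> ?T}" by (rule closed_compact_projection)
  moreover have "{U. \<exists>x. x \<in> ?S \<and> (x, U) \<in> ?T} = - {U. good p q k m U}"
  proof (intro equalityI subsetI)
    fix U :: "'n rmat" assume "U \<in> {U. \<exists>x. x \<in> ?S \<and> (x, U) \<in> ?T}"
    then obtain x where x: "norm x = 1" "x \<in> ?A" "(x, U) \<in> ?T" by auto
    from x(3) have "U *v x \<in> supp {p + q - k..<p + q}" by (intro suppI) auto
    note x = x(1,2) this
    then have "x \<noteq> 0" by auto
    with x show "U \<in> - {U. good p q k m U}" unfolding good_def by auto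
  next
    fix U :: "'n rmat" assume "U \<in> - {U. good p q k m U}"
    then obtain x where x: "x \<in> ?A" "U *v x \<in> supp {p + q - k..<p + q}" "x \<noteq> 0"
      unfolding good_def by auto
    let ?y = "(1 / norm x) *\<^sub>R x"
    have "?y \<in> ?S" using x by (auto intro: subspace_scale)
    moreover have "U *v ?y \<in> supp {p + q - k..<p + q}"
      using x by (simp add: matrix_vector_mult_scaleR subspace_scale)
    then have "(?y, U) \<in> ?T" by (auto dest: suppD)
    ultimately have "\<exists>x. x \<in> ?S \<and> (x, U) \<in> ?T" by (intro exI[of _ ?y] conjI)
    then show "U \<in> {U. \<exists>x. x \<in> ?S \<and> (x, U) \<in> ?T}" by (rule CollectI)
  qed
  ultimately show ?thesis by (simp add: closed_def)
qed

lemma continuous_det_ur: "continuous_on S (det_ur j :: 'n::{finite,linorder} rmat \<Rightarrow> real)"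
  unfolding det_ur_minor matrix_vector_mult_def by (intro continuous_intros)

lemma det_ur_0 [simp]: "det_ur 0 U = 1"
  unfolding det_ur_def by simp

context rpq
begin

abbreviation Cell :: "(nat \<Rightarrow> 'n rmat \<Rightarrow> bool) \<Rightarrow> nat \<Rightarrow> 'n rmat set" where "Cell \<equiv> cell p q"
abbreviation F0k :: "'n rvec set" where "F0k \<equiv> supp {n - k..<n}"

lemma bas_nth_idx: "a < n \<Longrightarrow> b < n \<Longrightarrow> (bas a :: 'n rvec) $ idx b = (if a = b then 1 else 0)"
  by (simp add: bas_nth)

lemma E_step_orth:
  assumes "m < k" "w \<in> Wsp (Suc m)"
  shows "bf (bas m) (bas m) = 0" "bf (bas m) w = 0"
proof -
  have m: "m < n" "n - 1 - m < n" "m \<noteq> n - 1 - m" "m < k + 2" using assms(1) kq qp by auto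
  show "bf (bas m) (bas m) = 0" using m by (simp add: bf_bas bas_nth_idx)
  have "pos (idx (n - 1 - m) :: 'n) \<notin> {Suc m..<n - Suc m}" using m by simp
  then show "bf (bas m) w = 0" using m by (simp add: bf_bas suppD[OF assms(2)])
qed

lemma E_step_SO0: "m < k \<Longrightarrow> w \<in> Wsp (Suc m) \<Longrightarrow> E (bas m) w \<in> SO0 p q"
  by (rule E_SO0) (fact E_step_orth)+

lemma E_step_vec:
  assumes "m < k"
  shows "E (bas m) w *v x = x + x $ idx (n - 1 - m) *\<^sub>R w - bf w x *\<^sub>R bas m
    - (bf w w / 2 * x $ idx (n - 1 - m)) *\<^sub>R bas m"
  using assms kq qp by (simp add: E_vec bf_bas)

text \<open>This makes the parametrization triangular: the factor with index m + 1 does not move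
  tilde e_1, ..., tilde e_m, because \<open>w\<close> has no component along e_1, ..., e_m.\<close>

lemma E_step_fix:
  assumes "m < k" "w \<in> Wsp (Suc m)" "i < m"
  shows "E (bas m) w *v bas (n - 1 - i) = bas (n - 1 - i)"
proof -
  have i: "n - 1 - i < n" "n - k - 2 \<le> n - 1 - i" "n - 1 - (n - 1 - i) = i" "n - 1 - m < n"
    "n - 1 - i \<noteq> n - 1 - m" "i < n"
    using assms kq qp by auto
  have "bf w (bas (n - 1 - i)) = w $ idx i" using i by (simp add: bf_bas')
  also have "\<dots> = 0" using assms i by (intro suppD[OF assms(2)]) auto
  finally show ?thesis using i assms(1) by (simp add: E_step_vec bas_nth_idx)
qed

lemma E_step_tilde:
  assumes "m < k" "w \<in> Wsp (Suc m)"
  shows "E (bas m) w *v bas (n - 1 - m) = bas (n - 1 - m) + w - (bf w w / 2) *\<^sub>R bas m"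
proof -
  have i: "n - 1 - m < n" "n - k - 2 \<le> n - 1 - m" "n - 1 - (n - 1 - m) = m" "m < n"
    using assms kq qp by auto
  have "bf w (bas (n - 1 - m)) = w $ idx m" using i by (simp add: bf_bas')
  also have "\<dots> = 0" using assms i by (intro suppD[OF assms(2)]) auto
  finally show ?thesis using i assms(1) by (simp add: E_step_vec bas_nth_idx)
qed

lemma E_step_unitri:
  assumes m: "m < k" and w: "w \<in> Wsp (Suc m)"
  shows "unitri (E (bas m) w)"
proof -
  have mn: "m < n" using m kq qp by auto
  have *: "E (bas m) w $ i $ j = (if i = j then 1 else 0)" if ij: "pos j \<le> pos i" for i j :: 'n
  proof -
    have b1: "(bas m :: 'n rvec) $ i = 0 \<or> pos i = m" using mn by (auto simp: bas_nth)
    have b2: "(bas m :: 'n rvec) $ dual p q j = 0 \<or> pos j = n - 1 - m"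
    proof -
      have "pos (dual p q j) = m \<Longrightarrow> pos j = n - 1 - m"
        using pos_lt[of j] m kq qp by (auto simp: pos_dual split: if_splits)
      then show ?thesis using mn by (auto simp: bas_nth)
    qed
    have w1: "w $ i = 0 \<or> pos i < n - 1 - m" using suppD[OF w, of i] by force
    have w2: "w $ dual p q j = 0 \<or> m < pos j"
    proof -
      have "pos (dual p q j) \<in> {Suc m..<n - Suc m} \<Longrightarrow> m < pos j"
        using pos_lt[of j] m kq qp by (auto simp: pos_dual split: if_splits)
      then show ?thesis using suppD[OF w, of "dual p q j"] by force
    qed
    have z1: "w $ i * (bas m :: 'n rvec) $ dual p q j = 0" using b2 w1 ij by auto
    have z2: "(bas m :: 'n rvec) $ i * w $ dual p q j = 0" using b1 w2 ij by auto
    have z3: "(bas m :: 'n rvec) $ i * (bas m :: 'n rvec) $ dual p q j = 0"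
      using b1 b2 ij m kq qp by auto
    show ?thesis unfolding eich_def by (simp only: vec_lambda_beta mult.assoc z1 z2 z3)
  qed
  show ?thesis unfolding unitri_def
  proof (intro conjI allI impI)
    fix i j :: 'n assume "pos j < pos i"
    then show "E (bas m) w $ i $ j = 0" using *[of j i] by auto
  qed (use * in auto)
qed

lemma Cell_mono:
  assumes "\<And>j V. P j V \<Longrightarrow> Q j V"
  shows "Cell P m \<subseteq> Cell Q m"
proof (induction m)
  case (Suc m)
  then show ?case using assms by auto
qed simp

lemma Cell_SO0_unitri: "m \<le> k \<Longrightarrow> U \<in> Cell P m \<Longrightarrow> U \<in> SO0 p q \<and> unitri U"
proof (induction m arbitrary: U)
  case 0 then show ?case using one_SO0 by (auto simp: unitri_def Finite_Cartesian_Product.mat_def)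
next
  case (Suc m)
  then obtain V w where V: "V \<in> Cell P m" "w \<in> Wsp (Suc m)" "U = V ** E (bas m) w" by auto
  then have "V \<in> SO0 p q" "unitri V" using Suc by auto
  moreover have "E (bas m) w \<in> SO0 p q" "unitri (E (bas m) w)"
    using V(2) Suc.prems by (auto intro: E_step_SO0 E_step_unitri)
  ultimately show ?case unfolding V(3) by (intro conjI SO0_mult unitri_mult)
qed

lemma det_ur_step:
  assumes "m < k" "w \<in> Wsp (Suc m)" "j \<le> m"
  shows "det_ur j (U ** E (bas m) w) = det_ur j U"
  unfolding det_ur_minor card_n
proof (rule minor_cong)
  fix b assume "b < j"
  \<comment> \<open>Column b of det_j belongs to tilde e_(j-b), which is
    \<open>bas (n - 1 - i)\<close> for i = j - 1 - b.\<close>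
  then have "n - j + b = n - 1 - (j - 1 - b)" "j - 1 - b < m" using assms kq qp by auto
  then show "(U ** E (bas m) w) *v bas (n - j + b) = U *v bas (n - j + b)"
    using E_step_fix[OF assms(1,2)] by (simp flip: matrix_vector_mul_assoc)
qed

text \<open>Later factors do not change det_j, by \<open>det_ur_step\<close>, so the sign imposed on
  the j-th partial product is that of det_j of the whole product.\<close>

lemma Cell_sign:
  assumes "\<And>j V. P j V \<Longrightarrow> \<epsilon> j * det_ur j V > 0"
  shows "m \<le> k \<Longrightarrow> U \<in> Cell P m \<Longrightarrow> j \<in> {1..m} \<Longrightarrow> \<epsilon> j * det_ur j U > 0"
proof (induction m arbitrary: U)
  case (Suc m)
  then obtain V w where V: "V \<in> Cell P m" "w \<in> Wsp (Suc m)" "U = V ** E (bas m) w" "P (Suc m) U" by auto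
  show ?case
  proof (cases "j = Suc m")
    case True then show ?thesis using assms V(4) by simp
  next
    case False
    then show ?thesis using Suc V det_ur_step[of m w j V] by auto
  qed
qed simp

lemma Cell_signI:
  assumes "U \<in> Cell (\<lambda>_ _. True) m" "m \<le> k" "\<And>j. j \<in> {1..m} \<Longrightarrow> \<epsilon> j * det_ur j U > 0"
  shows "U \<in> Cell (\<lambda>j V. \<epsilon> j * det_ur j V > 0) m"
  using assms
proof (induction m arbitrary: U)
  case (Suc m)
  then obtain V w where V: "V \<in> Cell (\<lambda>_ _. True) m" "w \<in> Wsp (Suc m)" "U = V ** E (bas m) w" by auto
  have "V \<in> Cell (\<lambda>j V. \<epsilon> j * det_ur j V > 0) m"
  proof (rule Suc.IH[OF V(1)])
    fix j assume "j \<in> {1..m}"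
    then show "\<epsilon> j * det_ur j V > 0" using Suc.prems(2) Suc.prems(3)[of j] V det_ur_step[of m w j V] by auto
  qed (use Suc.prems in simp)
  then show ?case using V Suc.prems(3)[of "Suc m"] by auto
qed simp

lemma supp_top_expand:
  fixes z :: "'n rvec"
  assumes "z \<in> supp {n - m..<n}" "m \<le> n"
  shows "z = (\<Sum>a<m. z $ idx (n - 1 - a) *\<^sub>R bas (n - 1 - a))"
proof -
  have "(\<Sum>a<m. z $ idx (n - 1 - a) * (bas (n - 1 - a) :: 'n rvec) $ i) = z $ i" for i :: 'n
  proof -
    have "(\<Sum>a<m. z $ idx (n - 1 - a) * (bas (n - 1 - a) :: 'n rvec) $ i)
        = (\<Sum>a<m. if a = n - 1 - pos i then z $ i else 0)"
    proof (rule sum.cong[OF refl])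
      fix a assume a: "a \<in> {..<m}"
      have "a = n - 1 - pos i \<longleftrightarrow> pos i = n - 1 - a" using pos_lt[of i] a assms(2) by auto
      moreover have "idx (n - 1 - a) = i" if "pos i = n - 1 - a" using idx_pos[of i] that by simp
      ultimately show "z $ idx (n - 1 - a) * (bas (n - 1 - a) :: 'n rvec) $ i = (if a = n - 1 - pos i then z $ i else 0)"
        using a assms(2) by (auto simp: bas_nth)
    qed
    also have "\<dots> = z $ i" using suppD[OF assms(1), of i] pos_lt[of i] by (auto simp: sum.delta)
    finally show ?thesis .
  qed
  then show ?thesis by (simp add: vec_eq_iff)
qed

lemma bf_supp_top:
  assumes "z \<in> supp {n - m..<n}" "m \<le> k + 2"
  shows "bf x z = (\<Sum>a<m. x $ idx a * z $ idx (n - 1 - a))"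
proof -
  have mn: "m \<le> n" using assms kq qp by auto
  have "bf x z = bf x (\<Sum>a<m. z $ idx (n - 1 - a) *\<^sub>R bas (n - 1 - a))"
    using supp_top_expand[OF assms(1) mn] by simp
  also have "\<dots> = (\<Sum>a<m. z $ idx (n - 1 - a) * bf x (bas (n - 1 - a)))"
    by (simp add: bf_sum_right)
  also have "\<dots> = (\<Sum>a<m. x $ idx a * z $ idx (n - 1 - a))"
  proof (rule sum.cong[OF refl])
    fix a assume "a \<in> {..<m}"
    then have "n - 1 - a < n" "n - k - 2 \<le> n - 1 - a" "n - 1 - (n - 1 - a) = a" using assms kq qp by auto
    then show "z $ idx (n - 1 - a) * bf x (bas (n - 1 - a)) = x $ idx a * z $ idx (n - 1 - a)"
      by (simp add: bf_bas')
  qed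
  finally show ?thesis .
qed

text \<open>The pairings of U F_0^m with F_0^m are given by the upper-right block of
  \<open>U\<close>: orthogonality of \<open>z\<close> is a relation among the rows of that block,
  with the coordinates of \<open>z\<close> as coefficients.\<close>

lemma supp_top_nondeg:
  assumes z: "z \<in> supp {n - m..<n}" and m: "m \<le> k" and d: "det_ur m (U :: 'n rmat) \<noteq> 0"
    and orth: "\<And>i. i < m \<Longrightarrow> bf (U *v bas (n - 1 - i)) z = 0"
  shows "z = 0"
proof (rule ccontr)
  assume "z \<noteq> 0"
  have mn: "m \<le> n" using m kq qp by auto
  have "\<exists>a<m. z $ idx (n - 1 - a) \<noteq> 0"
  proof (rule ccontr)
    assume "\<not> ?thesis"
    then have "z = 0" using supp_top_expand[OF z mn] by simp
    with \<open>z \<noteq> 0\<close> show False by simp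
  qed
  moreover have "(\<Sum>a<m. z $ idx (n - 1 - a) * (U *v bas (n - m + b)) $ idx a) = 0" if b: "b < m" for b
  proof -
    have "n - m + b = n - 1 - (m - 1 - b)" "m - 1 - b < m" using b mn by auto
    then show ?thesis using orth[of "m - 1 - b"] bf_supp_top[OF z, of "U *v bas (n - m + b)"] m
      by (simp add: mult.commute)
  qed
  ultimately have "minor idx m (\<lambda>b. U *v bas (n - m + b)) = 0"
    unfolding minor_zero_iff by (intro exI[of _ "\<lambda>a. z $ idx (n - 1 - a)"]) auto
  with d show False unfolding det_ur_minor card_n by simp
qed


section \<open>One Eichler step: the minor as a quadratic function, and genericity\<close>

abbreviation goodU :: "nat \<Rightarrow> 'n rmat \<Rightarrow> bool" where "goodU \<equiv> good p q k"

lemma bf_restr: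
  assumes w: "w \<in> Wsp m" and m: "m \<le> q"
  shows "bf w y = bf w (restr {m..<n - m} y)"
  unfolding bf_sum
proof (rule sum.cong[OF refl])
  fix i :: 'n
  have "pos i \<in> {m..<n - m} \<Longrightarrow> pos (dual p q i) \<in> {m..<n - m}"
    using m qp pos_lt[of i] by (auto simp: pos_dual)
  then show "w $ i * y $ dual p q i = w $ i * restr {m..<n - m} y $ dual p q i"
    using suppD[OF w, of i] by (auto simp: restr_nth)
qed

text \<open>Only column 0 involves \<open>w\<close>, so the minor is <U E tilde e_(m+1), z> for a
  fixed \<open>z\<close>, and the isometry \<open>U\<close> moves the pairing to <E tilde e_(m+1),
  y>. By \<open>E_step_tilde\<close> this sees only the components of \<open>y\<close> along
  e_(m+1), \<open>Wsp (Suc m)\<close> and tilde e_(m+1), which are c, v and \<alpha>.\<close>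

lemma det_ur_fibre:
  assumes U: "U \<in> Isom" and m: "m < k" and d: "det_ur m U \<noteq> 0" and g: "goodU m U"
  obtains \<alpha> c v where "v \<in> Wsp (Suc m)" "2 * \<alpha> * c + bf v v = 0" "\<alpha> \<noteq> 0 \<or> v \<noteq> 0"
    "\<And>w. w \<in> Wsp (Suc m) \<Longrightarrow> det_ur (Suc m) (U ** E (bas m) w) = c + bf w v - \<alpha> / 2 * bf w w"
proof -
  define f where "f b = U *v bas (n - Suc m + b)" for b
  have mn: "m < n" "n - 1 - m < n" "m < n - 1 - m" "Suc m \<le> k + 2" "Suc m \<le> n" using m kq qp by auto
  obtain cof where cof: "\<And>u. minor idx (Suc m) (f(0 := u)) = (\<Sum>a<Suc m. u $ idx a * cof a)"
    and cofm: "cof m = (- 1) ^ m * minor idx m (\<lambda>b. f (Suc b))"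
    using minor_expand_first[of idx m f] by auto
  have "(\<lambda>b. f (Suc b)) = (\<lambda>b. U *v bas (n - m + b))"
    unfolding f_def using mn by (auto simp: Suc_diff_Suc)
  then have cofm: "cof m \<noteq> 0" using d cofm unfolding det_ur_minor card_n by simp
  \<comment> \<open>The vector representing the expansion: its coordinate at tilde e_(a+1) is the
    cofactor \<open>cof a\<close>.\<close>
  define z :: "'n rvec" where "z = (\<chi> i. if pos i \<in> {n - Suc m..<n} then cof (n - 1 - pos i) else 0)"
  have zs: "z \<in> supp {n - Suc m..<n}" by (rule suppI) (auto simp: z_def)
  have z_nth: "z $ idx (n - 1 - a) = cof a" if a: "a < Suc m" for a
  proof -
    have "n - 1 - a \<in> {n - Suc m..<n}" "n - 1 - a < n" "n - 1 - (n - 1 - a) = a" using a mn by auto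
    then show ?thesis unfolding z_def by simp
  qed
  have bfz: "bf u z = minor idx (Suc m) (f(0 := u))" for u
    unfolding cof bf_supp_top[OF zs mn(4)] by (rule sum.cong[OF refl]) (simp only: z_nth lessThan_iff)
  obtain y where y: "U *v y = z" using Isom_surj[OF U] by blast
  have bfy: "bf (U *v x) z = bf x y" for x using Isom_bf[OF U, of x y] y by simp
  \<comment> \<open>Putting the image of tilde e_(i+1) into column 0 repeats column m - i, so the
    minor vanishes.\<close>
  have y0: "y $ idx i = 0" if i: "i < m" for i
  proof -
    have "bf (U *v bas (n - 1 - i)) z = 0"
      unfolding bfz
    proof (rule minor_repeat[of 0 _ "m - i"])
      have "n - Suc m + (m - i) = n - 1 - i" using i mn by auto
      then show "(f(0 := U *v bas (n - 1 - i))) 0 = (f(0 := U *v bas (n - 1 - i))) (m - i)"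
        using i by (simp add: f_def)
    qed (use i in auto)
    moreover have "bf (bas (n - 1 - i)) y = y $ idx (n - 1 - (n - 1 - i))"
      using i m kq qp by (intro bf_bas) auto
    moreover have "n - 1 - (n - 1 - i) = i" using i mn by auto
    ultimately show ?thesis using bfy by simp
  qed
  have "bf z z = (\<Sum>a<Suc m. z $ idx a * z $ idx (n - 1 - a))" by (rule bf_supp_top[OF zs mn(4)])
  also have "\<dots> = 0"
  proof (intro sum.neutral ballI)
    fix a assume "a \<in> {..<Suc m}"
    then have "z $ idx a = 0" using mn m kq qp by (intro suppD[OF zs]) auto
    then show "z $ idx a * z $ idx (n - 1 - a) = 0" by simp
  qed
  finally have yy: "bf y y = 0" using bfy[of y] y by simp
  define \<alpha> where "\<alpha> = y $ idx (n - 1 - m)"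
  define c where "c = y $ idx m"
  define v where "v = restr {Suc m..<n - Suc m} y"
  have vW: "v \<in> Wsp (Suc m)" unfolding v_def by (rule restr_supp)
  have bfv: "bf w y = bf w v" if "w \<in> Wsp (Suc m)" for w
    unfolding v_def using that m kq by (intro bf_restr) auto
  have bm: "bf x (bas m) = x $ idx (n - 1 - m)" for x using m mn by (intro bf_bas') auto
  have bt: "bf x (bas (n - 1 - m)) = x $ idx m" for x
  proof -
    have "n - k - 2 \<le> n - 1 - m" "n - 1 - (n - 1 - m) = m" using m mn by auto
    then show ?thesis using bf_bas'[of "n - 1 - m" x] mn by simp
  qed
  \<comment> \<open>The remainder lies in Span(tilde e_1, ..., tilde e_m), which pairs trivially
    with \<open>y\<close> since \<open>y\<close> has no coordinates along e_1, ..., e_m.\<close>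
  define r where "r = y - c *\<^sub>R bas m - v - \<alpha> *\<^sub>R bas (n - 1 - m)"
  have rs: "r \<in> supp {n - m..<n}"
  proof (rule suppI)
    fix i :: 'n assume i: "pos i \<notin> {n - m..<n}"
    have y_nth: "y $ i = y $ idx (pos i)" by simp
    consider "pos i < m" | "pos i = m" | "pos i \<in> {Suc m..<n - Suc m}" | "pos i = n - 1 - m"
      using i pos_lt[of i] mn by fastforce
    then show "r $ i = 0"
    proof cases
      case 1
      then show ?thesis using y0[of "pos i"] mn by (auto simp: r_def v_def restr_nth bas_nth)
    next
      case 2
      then show ?thesis using mn y_nth by (auto simp: r_def v_def restr_nth bas_nth c_def)
    next
      case 3
      then show ?thesis using mn by (auto simp: r_def v_def restr_nth bas_nth)
    next
      case 4
      then show ?thesis using mn y_nth by (auto simp: r_def v_def restr_nth bas_nth \<alpha>_def)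
    qed
  qed
  have "bf y r = (\<Sum>a<m. y $ idx a * r $ idx (n - 1 - a))" using m by (intro bf_supp_top[OF rs]) auto
  also have "\<dots> = 0" using y0 by (intro sum.neutral ballI) simp
  finally have "bf y r = 0" .
  moreover have "y = c *\<^sub>R bas m + v + \<alpha> *\<^sub>R bas (n - 1 - m) + r" unfolding r_def by simp
  then have "bf y y = bf y (c *\<^sub>R bas m + v + \<alpha> *\<^sub>R bas (n - 1 - m) + r)" by simp
  moreover have "bf y v = bf v v" using bfv[OF vW] bf_commute[of y v] by simp
  ultimately have rel: "2 * \<alpha> * c + bf v v = 0"
    using yy bm[of y, folded \<alpha>_def] bt[of y, folded c_def] by simp
  \<comment> \<open>Otherwise \<open>y\<close> would lie in Span(e_(m+1), tilde e_1, ..., tilde e_m)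
    while \<open>U\<close> sends it to \<open>z\<close> in F_0^k; \<open>good\<close> then gives y =
    0, against the nonzero cofactor.\<close>
  have ne: "\<alpha> \<noteq> 0 \<or> v \<noteq> 0"
  proof (rule ccontr)
    assume "\<not> ?thesis"
    then have 0: "\<alpha> = 0" "v = 0" by auto
    have "y \<in> supp ({m..<k} \<union> {n - m..<n})"
    proof (rule suppI)
      fix i :: 'n assume i: "pos i \<notin> {m..<k} \<union> {n - m..<n}"
      then have "r $ i = 0" using rs by (intro suppD[OF rs]) auto
      moreover have "(bas m :: 'n rvec) $ i = 0" using i m mn by (auto simp: bas_nth)
      ultimately show "y $ i = 0" using 0 unfolding r_def by simp
    qed
    moreover have "{n - Suc m..<n} \<subseteq> {n - k..<n}" using m by auto
    then have "U *v y \<in> F0k" using zs supp_mono unfolding y by blast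
    ultimately have "y = 0" using g unfolding good_def by blast
    then have "z = 0" using y by simp
    with z_nth[of m] cofm show False by simp
  qed
  have det: "det_ur (Suc m) (U ** E (bas m) w) = c + bf w v - \<alpha> / 2 * bf w w" if w: "w \<in> Wsp (Suc m)" for w
  proof -
    let ?u = "U *v (E (bas m) w *v bas (n - 1 - m))"
    have "det_ur (Suc m) (U ** E (bas m) w) = minor idx (Suc m) (f(0 := ?u))"
      unfolding det_ur_minor card_n
    proof (rule minor_cong)
      fix b assume b: "b < Suc m"
      show "U ** E (bas m) w *v bas (n - Suc m + b) = (f(0 := ?u)) b"
      proof (cases b)
        case 0 then show ?thesis by (simp flip: matrix_vector_mul_assoc)
      next
        case (Suc b')
        then have "n - Suc m + b = n - 1 - (m - b)" "m - b < m" using b mn by auto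
        then have "E (bas m) w *v bas (n - Suc m + b) = bas (n - Suc m + b)"
          using E_step_fix[OF m w] by presburger
        moreover have "b \<noteq> 0" using Suc by simp
        ultimately show ?thesis by (simp only: f_def fun_upd_apply if_False matrix_vector_mul_assoc[symmetric])
      qed
    qed
    also have "\<dots> = bf (E (bas m) w *v bas (n - 1 - m)) y" by (simp only: bfz[symmetric] bfy)
    also have "\<dots> = c + bf w v - \<alpha> / 2 * bf w w"
      unfolding E_step_tilde[OF m w] \<alpha>_def c_def
      using bfv[OF w] bm[of y] bt[of y] bf_commute[of "bas m" y] bf_commute[of "bas (n - 1 - m)" y]
      by simp
    finally show ?thesis .
  qed
  show thesis by (rule that[OF vW rel ne det])
qed

text \<open>The \<open>w\<close> for which genericity may be lost. If a tested vector
  \<open>l\<close> has coefficient \<delta> nonzero at tilde e_(m+1) and \<open>U\<close> sends y =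
  E l into F_0^k, comparing components in \<open>Wsp (Suc m)\<close> writes \<open>w\<close> as the
  component of y / \<delta> plus a vector of Span(e_(m+2), ..., e_k).\<close>

definition bad :: "'n rmat \<Rightarrow> nat \<Rightarrow> 'n rvec set" where
  "bad U m = {x + y | x y. x \<in> restr {Suc m..<n - Suc m} ` {y \<in> supp {m..<n}. U *v y \<in> F0k} \<and>
     y \<in> supp {Suc m..<k}}"

text \<open>The space \<open>?K\<close> has dimension at most k - m: by
  \<open>supp_top_nondeg\<close>, \<open>U\<close> maps it injectively into F_0^k modulo F_0^m.
  Hence \<open>bad U m\<close> has dimension at most 2k - 2m - 1, whereas dim W_(m+1) = n - 2m - 2
  is at least 2k - 2m + 2.\<close>

lemma bad_subspace:
  assumes U: "U \<in> Isom" and m: "m < k" and d: "det_ur m U \<noteq> 0"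
  shows "subspace (bad U m)" "bad U m \<subseteq> Wsp (Suc m)" "dim (bad U m) + 2 \<le> dim (Wsp (Suc m))"
proof -
  let ?K = "{y \<in> supp {m..<n}. U *v y \<in> F0k}" and ?R = "restr {Suc m..<n - Suc m} :: 'n rvec \<Rightarrow> _"
  have K: "subspace ?K"
  proof (rule subspaceI)
    show "0 \<in> ?K" by (simp add: subspace_0)
  qed (auto simp: matrix_vector_right_distrib matrix_vector_mult_scaleR intro: subspace_add subspace_scale)
  have RK: "subspace (?R ` ?K)" by (rule linear_subspace_image[OF linear_restr K])
  show "subspace (bad U m)" unfolding bad_def by (rule subspace_sums[OF RK subspace_supp])
  show "bad U m \<subseteq> Wsp (Suc m)"
  proof
    fix w assume "w \<in> bad U m"
    then obtain x y where w: "w = x + y" "x \<in> ?R ` ?K" "y \<in> supp {Suc m..<k}" unfolding bad_def by auto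
    have "x \<in> Wsp (Suc m)" using w(2) restr_supp by auto
    moreover have "{Suc m..<k} \<subseteq> {Suc m..<n - Suc m}" using m kq qp by (intro ivl_subset[THEN iffD2] disjI2 conjI) linarith+
    then have "y \<in> Wsp (Suc m)" using w(3) supp_mono by blast
    ultimately show "w \<in> Wsp (Suc m)" unfolding w(1) by (intro subspace_add subspace_supp)
  qed
  have dK: "dim ?K \<le> k - m"
  proof -
    define T where "T y = restr {n - k..<n - m} (U *v y)" for y
    have linT: "linear T" unfolding T_def
      by (intro linear_compose[OF matrix_vector_mul_linear linear_restr, unfolded o_def])
    have "inj_on T (span ?K)" unfolding span_eq_iff[THEN iffD2, OF K]
    proof (subst linear_inj_on_iff_eq_0[OF linT K], intro ballI impI)
      fix y assume y: "y \<in> ?K" "T y = 0"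
      have zs: "U *v y \<in> supp {n - m..<n}"
      proof (rule suppI)
        fix i :: 'n assume i: "pos i \<notin> {n - m..<n}"
        show "(U *v y) $ i = 0"
        proof (cases "pos i \<in> {n - k..<n - m}")
          case True
          then have "(U *v y) $ i = T y $ i" by (simp add: T_def restr_nth)
          then show ?thesis using y by simp
        next
          case False
          then show ?thesis using i y(1) pos_lt[of i] by (intro suppD[of _ "{n - k..<n}"]) auto
        qed
      qed
      have "U *v y = 0"
      proof (rule supp_top_nondeg[OF zs _ d])
        show "m \<le> k" using m by simp
        fix i assume i: "i < m"
        have "bf (U *v bas (n - 1 - i)) (U *v y) = bf (bas (n - 1 - i)) y" by (rule Isom_bf[OF U])
        also have "\<dots> = y $ idx (n - 1 - (n - 1 - i))" using i m kq qp by (intro bf_bas) auto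
        also have "\<dots> = 0" using i m kq qp y(1) by (intro suppD[of _ "{m..<n}"]) auto
        finally show "bf (U *v bas (n - 1 - i)) (U *v y) = 0" .
      qed
      then show "y = 0" using Isom_inj[OF U, of y 0] by simp
    qed
    then have "dim ?K = dim (T ` ?K)" by (simp add: dim_image_eq[OF linT])
    also have "\<dots> \<le> dim (supp {n - k..<n - m} :: 'n rvec set)"
      by (intro dim_subset) (auto simp: T_def restr_supp)
    also have "\<dots> = card {n - k..<n - m}" by (rule dim_supp) (auto simp: card_n)
    also have "\<dots> = k - m" using m kq qp by simp
    finally show ?thesis .
  qed
  have "dim (bad U m) \<le> dim (?R ` ?K) + dim (supp {Suc m..<k} :: 'n rvec set)"
    unfolding bad_def using dim_sums_Int[OF RK subspace_supp, of "{Suc m..<k}"] by linarith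
  also have "dim (?R ` ?K) \<le> k - m" using dim_image_le[OF linear_restr, of "{Suc m..<n - Suc m}" ?K] dK by linarith
  also have "dim (supp {Suc m..<k} :: 'n rvec set) = card {Suc m..<k}"
    using kq qp by (intro dim_supp) (auto simp: card_n)
  finally have "dim (bad U m) \<le> (k - m) + (k - Suc m)" by simp
  moreover have "dim (Wsp (Suc m)) = card {Suc m..<n - Suc m}"
    by (rule dim_supp) (auto simp: card_n)
  ultimately show "dim (bad U m) + 2 \<le> dim (Wsp (Suc m))" using m kq qp by simp
qed

text \<open>If \<open>l\<close> has no component along tilde e_(m+1), then E l differs from
  \<open>l\<close> by a multiple of e_(m+1) and lies in the subspace tested at stage m; here
  \<open>good\<close> has to include all of e_(m+1), ..., e_k. If it has one, \<open>w\<close> would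
  lie in \<open>bad U m\<close>.\<close>

lemma good_step:
  assumes m: "m < k" and g: "goodU m U" and w: "w \<in> Wsp (Suc m)" "w \<notin> bad U m"
  shows "goodU (Suc m) (U ** E (bas m) w)"
  unfolding good_def
proof (intro ballI impI)
  fix l :: "'n rvec"
  assume l: "l \<in> supp ({Suc m..<k} \<union> {n - Suc m..<n})" and Vl: "(U ** E (bas m) w) *v l \<in> F0k"
  have mn: "m < n" "n - 1 - m < n" using m kq qp by auto
  define y where "y = E (bas m) w *v l"
  define \<delta> where "\<delta> = l $ idx (n - 1 - m)"
  have y: "y = l + \<delta> *\<^sub>R w - (bf w l + bf w w / 2 * \<delta>) *\<^sub>R bas m"
    unfolding y_def \<delta>_def E_step_vec[OF m] by (simp add: algebra_simps)
  have Uy: "U *v y \<in> F0k" using Vl unfolding y_def by (simp add: matrix_vector_mul_assoc)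
  show "l = 0"
  proof (cases "\<delta> = 0")
    case True
    have "y \<in> supp ({m..<k} \<union> {n - m..<n})"
    proof (rule suppI)
      fix i :: 'n assume i: "pos i \<notin> {m..<k} \<union> {n - m..<n}"
      have "l $ i = 0"
      proof (cases "pos i = n - 1 - m")
        case p: True
        then have "i = idx (n - 1 - m)" by (metis idx_pos)
        then show ?thesis using True unfolding \<delta>_def by simp
      next
        case False
        then show ?thesis using i by (intro suppD[OF l]) auto
      qed
      moreover have "(bas m :: 'n rvec) $ i = 0" using i m mn by (auto simp: bas_nth)
      ultimately show "y $ i = 0" unfolding y True by simp
    qed
    then have "y = 0" using g Uy unfolding good_def by blast
    then have "E (bas m) w *v l = E (bas m) w *v 0" unfolding y_def by simp
    then show "l = 0" using Isom_inj[of "E (bas m) w"] E_step_SO0[OF m w(1)] SO0_Isom by blast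
  next
    case False
    have ys: "y \<in> supp {m..<n}"
    proof (rule suppI)
      fix i :: 'n assume i: "pos i \<notin> {m..<n}"
      have "l $ i = 0" using i m kq qp by (intro suppD[OF l]) auto
      moreover have "w $ i = 0" using i by (intro suppD[OF w(1)]) auto
      moreover have "(bas m :: 'n rvec) $ i = 0" using i mn by (auto simp: bas_nth)
      ultimately show "y $ i = 0" unfolding y by simp
    qed
    let ?R = "restr {Suc m..<n - Suc m} :: 'n rvec \<Rightarrow> _"
    have Ry: "?R y = ?R l + \<delta> *\<^sub>R w"
    proof -
      have "?R y $ i = ?R l $ i + \<delta> * w $ i" for i
        using suppD[OF w(1), of i] mn by (simp add: restr_nth y bas_nth)
      then show ?thesis by (simp add: vec_eq_iff)
    qed
    have "?R ((1 / \<delta>) *\<^sub>R y) = (1 / \<delta>) *\<^sub>R ?R y" by (rule linear_scale[OF linear_restr])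
    then have "w = ?R ((1 / \<delta>) *\<^sub>R y) + (- 1 / \<delta>) *\<^sub>R ?R l"
      using False by (simp add: Ry algebra_simps)
    moreover have "(1 / \<delta>) *\<^sub>R y \<in> {y \<in> supp {m..<n}. U *v y \<in> F0k}"
      using ys Uy by (simp add: matrix_vector_mult_scaleR subspace_scale)
    moreover have "?R l \<in> supp {Suc m..<k}"
    proof (rule suppI)
      fix i :: 'n assume "pos i \<notin> {Suc m..<k}"
      then show "?R l $ i = 0" using suppD[OF l, of i] by (auto simp: restr_nth)
    qed
    then have "(- 1 / \<delta>) *\<^sub>R ?R l \<in> supp {Suc m..<k}" by (intro subspace_scale subspace_supp)
    ultimately have "w \<in> bad U m" unfolding bad_def by blast
    with w(2) show ?thesis by simp
  qed
qed


lemma good_one: "goodU 0 (Finite_Cartesian_Product.mat 1)"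
  unfolding good_def
proof (intro ballI impI)
  fix x :: "'n rvec"
  assume x: "x \<in> supp ({0..<k} \<union> {n - 0..<n})" "Finite_Cartesian_Product.mat 1 *v x \<in> F0k"
  have "x $ i = 0" for i
  proof (cases "pos i < k")
    case True
    then show ?thesis using x(2) kq qp by (intro suppD[of _ "{n - k..<n}"]) auto
  next
    case False
    then show ?thesis by (intro suppD[OF x(1)]) auto
  qed
  then show "x = 0" by (simp add: vec_eq_iff)
qed

text \<open>The next cell is a continuous image of the pairs \<open>Z\<close>, to which
  \<open>connected_open_fibres\<close> applies: for fixed \<open>w\<close> the condition is open in
  \<open>U\<close>. The fibre itself is not computed; it is only known to lie between
  \<open>C U - bad U m\<close> and the quadric side \<open>C U\<close>.\<close>

lemma goodCell_connected:
  assumes \<epsilon>: "\<And>j. \<epsilon> j = 1 \<or> \<epsilon> j = (- 1 :: real)"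
  defines "P \<equiv> \<lambda>j V. \<epsilon> j * det_ur j V > 0 \<and> goodU j V"
  shows "m \<le> k \<Longrightarrow> connected (Cell P m) \<and> Cell P m \<noteq> {}"
proof (induction m)
  case (Suc m)
  then have m: "m < k" by simp
  have A: "connected (Cell P m)" "Cell P m \<noteq> {}" using Suc by auto
  have good: "goodU m U" and d: "det_ur m U \<noteq> 0" and I: "U \<in> Isom" if "U \<in> Cell P m" for U
  proof -
    show "goodU m U" using that good_one by (cases m) (auto simp: P_def)
    show "det_ur m U \<noteq> 0" using that by (cases m) (auto simp: P_def)
    show "U \<in> Isom" using Cell_SO0_unitri[of m U P] that m SO0_Isom by auto
  qed
  have openP: "open {V. P (Suc m) V}"
    unfolding P_def by (intro open_Collect_conj open_good open_Collect_less continuous_intros continuous_det_ur)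
  define C where "C U = {w \<in> Wsp (Suc m). \<epsilon> (Suc m) * det_ur (Suc m) (U ** E (bas m) w) > 0}" for U
  define Z where "Z = {(U, w). U \<in> Cell P m \<and> w \<in> Wsp (Suc m) \<and> P (Suc m) (U ** E (bas m) w)}"
  have C: "connected (C U)" "C U \<noteq> {}" "openin (top_of_set (Wsp (Suc m))) (C U)" if U: "U \<in> Cell P m" for U
  proof -
    obtain \<alpha> c v where v: "v \<in> Wsp (Suc m)" "2 * \<alpha> * c + bf v v = 0" "\<alpha> \<noteq> 0 \<or> v \<noteq> 0"
      "\<And>w. w \<in> Wsp (Suc m) \<Longrightarrow> det_ur (Suc m) (U ** E (bas m) w) = c + bf w v - \<alpha> / 2 * bf w w"
      using det_ur_fibre[OF I[OF U] m d[OF U] good[OF U]] by metis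
    have "C U = {w \<in> Wsp (Suc m). \<epsilon> (Suc m) * (c + bf w v - \<alpha> / 2 * bf w w) > 0}"
      unfolding C_def using v(4) by auto
    \<comment> \<open>The bound k < q - 1 enters here: it provides the two-dimensional eigenspaces
      of \<open>flip\<close> in \<open>Wsp (Suc m)\<close>.\<close>
    moreover have "Suc m \<le> q - 2" using m kq by simp
    ultimately show "connected (C U)" "C U \<noteq> {}" "openin (top_of_set (Wsp (Suc m))) (C U)"
      using quadric_side_connected[OF _ \<epsilon> v(1-3)] by auto
  qed
  have sub: "C U - bad U m \<subseteq> {w. (U, w) \<in> Z}" "{w. (U, w) \<in> Z} \<subseteq> C U" if U: "U \<in> Cell P m" for U
    using good_step[OF m good[OF U]] U by (auto simp: C_def Z_def P_def)
  have "connected Z"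
  proof (rule connected_open_fibres[OF A(1)])
    show "fst ` Z \<subseteq> Cell P m" by (auto simp: Z_def)
  next
    fix U assume U: "U \<in> Cell P m"
    note bad = bad_subspace[OF I[OF U] m d[OF U]]
    show "connected {w. (U, w) \<in> Z}"
      by (rule connected_open_inter_super[OF C(1)[OF U] C(3)[OF U] subspace_supp bad sub[OF U]])
    obtain w where "w \<in> C U" using C(2)[OF U] by blast
    then show "\<exists>w. (U, w) \<in> Z"
      using subspace_complement_dense[OF C(3)[OF U] subspace_supp bad(1,2), of w] bad(3) sub(1)[OF U] by auto
  next
    fix U w assume Uw: "(U, w) \<in> Z"
    let ?V = "(\<lambda>U. U ** E (bas m) w) -` {V. P (Suc m) V}"
    have "open ?V"
      by (intro open_vimage openP continuous_matrix_mult continuous_on_id continuous_on_const)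
    then show "\<exists>V. open V \<and> U \<in> V \<and> (\<forall>U'\<in>V \<inter> Cell P m. (U', w) \<in> Z)"
      using Uw by (intro exI[of _ ?V]) (auto simp: Z_def)
  qed
  then have "connected ((\<lambda>z. fst z ** E (bas m) (snd z)) ` Z)"
    by (intro connected_continuous_image continuous_intros)
  moreover have "(\<lambda>z. fst z ** E (bas m) (snd z)) ` Z = Cell P (Suc m)"
    by (force simp: Z_def image_iff)
  moreover have "Z \<noteq> {}"
  proof -
    obtain U where U: "U \<in> Cell P m" using A(2) by blast
    obtain w where "w \<in> C U" using C(2)[OF U] by blast
    then have "\<exists>w. (U, w) \<in> Z"
      using bad_subspace[OF I[OF U] m d[OF U]]
        subspace_complement_dense[OF C(3)[OF U] subspace_supp, of "bad U m" w] sub(1)[OF U] by auto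
    then show ?thesis by blast
  qed
  ultimately show ?case by auto
qed simp

text \<open>The approximation proceeds one factor at a time: \<open>U\<close> is first moved into
  the good cell with \<open>w\<close> fixed, and only then is \<open>w\<close> moved off
  \<open>bad U' m\<close>, which depends on the new \<open>U'\<close>.\<close>

lemma Cell_closure:
  assumes \<epsilon>: "\<And>j. \<epsilon> j = 1 \<or> \<epsilon> j = (- 1 :: real)"
  defines "P \<equiv> \<lambda>j V. \<epsilon> j * det_ur j V > 0 \<and> goodU j V" and "Q \<equiv> \<lambda>j V. \<epsilon> j * det_ur j V > 0"
  shows "m \<le> k \<Longrightarrow> Cell Q m \<subseteq> closure (Cell P m)"
proof (induction m)
  case (Suc m)
  then have m: "m < k" by simp
  show ?case
  proof
    fix V assume "V \<in> Cell Q (Suc m)"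
    then obtain U w where U: "U \<in> Cell Q m" and w: "w \<in> Wsp (Suc m)" and V: "V = U ** E (bas m) w"
      and QV: "Q (Suc m) V" by auto
    show "V \<in> closure (Cell P (Suc m))"
      unfolding closure_iff_nhds_not_empty
    proof (intro allI impI)
      fix A S assume S: "S \<subseteq> A" "open S" "V \<in> S"
      define N where "N = (\<lambda>z. fst z ** E (bas m) (snd z)) -` (S \<inter> {V. Q (Suc m) V})"
      have oN: "open N" unfolding N_def Q_def
        by (intro open_vimage open_Int S(2) open_Collect_less continuous_intros continuous_det_ur)
      have UN: "(U, w) \<in> N" unfolding N_def using S(3) QV V by simp
      have "open ((\<lambda>U. (U, w)) -` N)" by (intro open_vimage oN continuous_intros)
      moreover have "U \<in> closure (Cell P m)" using Suc U by auto
      ultimately obtain U' where U': "U' \<in> Cell P m" "(U', w) \<in> N"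
        using UN unfolding closure_iff_nhds_not_empty by blast
      have I: "U' \<in> Isom" using Cell_SO0_unitri[of m U' P] U' m SO0_Isom by auto
      have d: "det_ur m U' \<noteq> 0" using U'(1) by (cases m) (auto simp: P_def)
      have g: "goodU m U'" using U'(1) good_one by (cases m) (auto simp: P_def)
      note bad = bad_subspace[OF I m d]
      have "open ((\<lambda>w. (U', w)) -` N)" by (intro open_vimage oN continuous_intros)
      then have "openin (top_of_set (Wsp (Suc m))) (Wsp (Suc m) \<inter> (\<lambda>w. (U', w)) -` N)"
        by (rule openin_open_Int)
      from subspace_complement_dense[OF this subspace_supp bad(1,2), of w] bad(3) w U'(2)
      obtain w' where w': "w' \<in> Wsp (Suc m)" "(U', w') \<in> N" "w' \<notin> bad U' m" by auto
      have "U' ** E (bas m) w' \<in> S" "Q (Suc m) (U' ** E (bas m) w')"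
        using w'(2) unfolding N_def by auto
      moreover have "goodU (Suc m) (U' ** E (bas m) w')" by (rule good_step[OF m g w'(1,3)])
      ultimately have "U' ** E (bas m) w' \<in> Cell P (Suc m) \<inter> A"
        using U'(1) w'(1) S(1) by (auto simp: P_def Q_def)
      then show "Cell P (Suc m) \<inter> A \<noteq> {}" by blast
    qed
  qed
qed simp

proposition signCell_connected:
  assumes \<epsilon>: "\<And>j. \<epsilon> j = 1 \<or> \<epsilon> j = (- 1 :: real)"
  shows "connected (Cell (\<lambda>j V. \<epsilon> j * det_ur j V > 0) k)" "Cell (\<lambda>j V. \<epsilon> j * det_ur j V > 0) k \<noteq> {}"
proof -
  let ?P = "\<lambda>j V. \<epsilon> j * det_ur j V > 0 \<and> goodU j V" and ?Q = "\<lambda>j V. \<epsilon> j * det_ur j V > 0"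
  have sub: "Cell ?P k \<subseteq> Cell ?Q k" by (rule Cell_mono) simp
  show "connected (Cell ?Q k)"
    by (rule connected_intermediate_closure[OF _ sub Cell_closure]) (use goodCell_connected[of \<epsilon> k] \<epsilon> in auto)
  show "Cell ?Q k \<noteq> {}" using sub goodCell_connected[of \<epsilon> k] \<epsilon> by auto
qed

end


subsection \<open>Flags and transversality\<close>

context rpq
begin

abbreviation F0 :: "nat \<Rightarrow> 'n rvec set" where "F0 \<equiv> std_flag_0 p q k"
abbreviation Finf :: "nat \<Rightarrow> 'n rvec set" where "Finf \<equiv> std_flag_inf p q k"
text \<open>For a basis of a flag step, nonvanishing of the upper minor will mean transversality to
  F_0 at that level, and nonvanishing of the lower one transversality to F_inf.\<close>

abbreviation top_minor :: "nat \<Rightarrow> (nat \<Rightarrow> 'n rvec) \<Rightarrow> real" where "top_minor \<equiv> minor idx"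
abbreviation bot_minor :: "nat \<Rightarrow> (nat \<Rightarrow> 'n rvec) \<Rightarrow> real" where
  "bot_minor j \<equiv> minor (\<lambda>a. idx (n - j + a)) j"
abbreviation act :: "'n rmat \<Rightarrow> (nat \<Rightarrow> 'n rvec set) \<Rightarrow> nat \<Rightarrow> 'n rvec set" where "act \<equiv> flag_act k"

lemma span_bas:
  assumes "A \<subseteq> {..<n}"
  shows "span (bas ` A) = (supp A :: 'n rvec set)"
proof
  show "span (bas ` A) \<subseteq> (supp A :: 'n rvec set)"
    using assms by (intro span_minimal) (auto intro: bas_supp)
  show "(supp A :: 'n rvec set) \<subseteq> span (bas ` A)"
  proof
    fix x :: "'n rvec" assume x: "x \<in> supp A"
    have eq: "x = (\<Sum>i\<in>UNIV. x $ i *\<^sub>R axis i 1)"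
      by (simp only: scalar_mult_eq_scaleR[symmetric] basis_expansion)
    have "x $ i *\<^sub>R axis i 1 \<in> span (bas ` A)" for i
    proof (cases "pos i \<in> A")
      case True
      then have "(axis i 1 :: 'n rvec) \<in> bas ` A" by (intro image_eqI[of _ _ "pos i"]) (auto simp: bas_def)
      then show ?thesis by (intro span_scale span_base)
    next
      case False
      then show ?thesis using suppD[OF x, of i] by (simp add: span_zero)
    qed
    then have "(\<Sum>i\<in>UNIV. x $ i *\<^sub>R axis i 1) \<in> span (bas ` A)" by (rule span_sum)
    then show "x \<in> span (bas ` A)" by (subst eq)
  qed
qed

lemma F0_family: "j \<in> {1..k} \<Longrightarrow> F0 j = span ((\<lambda>b. bas (n - j + b)) ` {..<j})"
proof -
  assume j: "j \<in> {1..k}"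
  have "(\<lambda>a. axis (idx (p + q - a)) 1) ` {1..j} = ((\<lambda>b. bas (n - j + b)) ` {..<j} :: 'n rvec set)"
  proof (intro equalityI subsetI)
    fix x :: "'n rvec" assume "x \<in> (\<lambda>a. axis (idx (p + q - a)) 1) ` {1..j}"
    then obtain a where a: "a \<in> {1..j}" "x = axis (idx (n - a)) 1" by auto
    moreover have "n - j + (j - a) = n - a" using a j kq qp by auto
    ultimately show "x \<in> (\<lambda>b. bas (n - j + b)) ` {..<j}"
      by (intro image_eqI[of _ _ "j - a"]) (auto simp: bas_def)
  next
    fix x :: "'n rvec" assume "x \<in> (\<lambda>b. bas (n - j + b)) ` {..<j}"
    then obtain b where b: "b < j" "x = bas (n - j + b)" by auto
    moreover have "n - (j - b) = n - j + b" using b j kq qp by auto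
    ultimately show "x \<in> (\<lambda>a. axis (idx (p + q - a)) 1) ` {1..j}"
      by (intro image_eqI[of _ _ "j - b"]) (auto simp: bas_def)
  qed
  then show ?thesis using j by (simp add: std_flag_0_def)
qed

lemma Finf_family: "j \<in> {1..k} \<Longrightarrow> Finf j = span (bas ` {..<j})"
proof -
  assume j: "j \<in> {1..k}"
  have "(\<lambda>a. axis (idx (a - 1)) 1) ` {1..j} = (bas ` {..<j} :: 'n rvec set)"
  proof (intro equalityI subsetI)
    fix x :: "'n rvec" assume "x \<in> bas ` {..<j}"
    then obtain b where "b < j" "x = bas b" by auto
    then show "x \<in> (\<lambda>a. axis (idx (a - 1)) 1) ` {1..j}"
      by (intro image_eqI[of _ _ "Suc b"]) (auto simp: bas_def)
  qed (auto simp: bas_def)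
  then show ?thesis using j by (simp add: std_flag_inf_def)
qed

lemma Finf_supp: "j \<in> {1..k} \<Longrightarrow> Finf j = supp {..<j}"
  using kq qp by (simp add: Finf_family span_bas)

lemma F0_supp: "j \<in> {1..k} \<Longrightarrow> F0 j = supp {n - j..<n}"
proof -
  assume j: "j \<in> {1..k}"
  have "(\<lambda>b. n - j + b) ` {..<j} = {n - j..<n}"
  proof (intro equalityI subsetI)
    fix a assume "a \<in> {n - j..<n}"
    then show "a \<in> (\<lambda>b. n - j + b) ` {..<j}" by (intro image_eqI[of _ _ "a - (n - j)"]) auto
  qed (use j kq qp in auto)
  moreover have "(\<lambda>b. bas (n - j + b)) ` {..<j} = (bas ` (\<lambda>b. n - j + b) ` {..<j} :: 'n rvec set)"
    by (simp only: image_image)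
  ultimately have "(\<lambda>b. bas (n - j + b)) ` {..<j} = (bas ` {n - j..<n} :: 'n rvec set)" by (simp only:)
  moreover have "{n - j..<n} \<subseteq> {..<n}" by auto
  ultimately show ?thesis unfolding F0_family[OF j] by (simp only: span_bas)
qed

lemma supp_isotropic:
  assumes "\<And>i :: 'n. pos i \<in> A \<Longrightarrow> pos (dual p q i) \<notin> A" and "x \<in> supp A" "y \<in> supp A"
  shows "bf x y = 0"
  unfolding bf_sum
proof (intro sum.neutral ballI)
  fix i :: 'n
  show "x $ i * y $ dual p q i = 0"
    using assms(1)[of i] suppD[OF assms(2), of i] suppD[OF assms(3), of "dual p q i"] by auto
qed

lemma Finf_flag: "Finf \<in> flags p q k" and F0_flag: "F0 \<in> flags p q k"
proof -
  have "bf x y = 0" if "j \<in> {1..k}" "x \<in> supp {..<j}" "y \<in> supp {..<j}" for x y j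
    by (rule supp_isotropic[OF _ that(2,3)]) (use that(1) kq qp in \<open>auto simp: pos_dual\<close>)
  moreover have "(supp {..<i} :: 'n rvec set) \<subseteq> supp {..<j}" if "i \<le> j" for i j
    using that by (intro supp_mono) auto
  moreover have "Finf \<in> extensional {1..k}" by (simp add: std_flag_inf_def)
  moreover have "dim (supp {..<j} :: 'n rvec set) = j" if "j \<in> {1..k}" for j
    using that kq qp by (subst dim_supp) (auto simp: card_n)
  ultimately show "Finf \<in> flags p q k"
    unfolding flags_def by (auto simp: Finf_supp)
  have "bf x y = 0" if "j \<in> {1..k}" "x \<in> supp {n - j..<n}" "y \<in> supp {n - j..<n}" for x y j
    by (rule supp_isotropic[OF _ that(2,3)]) (use that(1) kq qp in \<open>auto simp: pos_dual\<close>)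
  moreover have "(supp {n - i..<n} :: 'n rvec set) \<subseteq> supp {n - j..<n}" if "i \<le> j" for i j
    using that by (intro supp_mono) auto
  moreover have "F0 \<in> extensional {1..k}" by (simp add: std_flag_0_def)
  moreover have "dim (supp {n - j..<n} :: 'n rvec set) = j" if "j \<in> {1..k}" for j
    using that kq qp by (subst dim_supp) (auto simp: card_n)
  ultimately show "F0 \<in> flags p q k"
    unfolding flags_def by (auto simp: F0_supp)
qed

lemma act_nth: "j \<in> {1..k} \<Longrightarrow> act U G j = (*v) U ` G j"
  by (simp add: flag_act_def)

lemma act_flag:
  assumes U: "U \<in> Isom" and G: "G \<in> flags p q k"
  shows "act U G \<in> flags p q k"
  unfolding flags_def
proof (intro CollectI conjI ballI impI)
  show "act U G \<in> extensional {1..k}" by (simp add: flag_act_def)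
next
  fix j assume j: "j \<in> {1..k}"
  have Gj: "subspace (G j)" "dim (G j) = j" "\<forall>x\<in>G j. \<forall>y\<in>G j. bf x y = 0"
    using G j unfolding flags_def by auto
  show "subspace (act U G j)"
    unfolding act_nth[OF j] using Gj(1) by (intro linear_subspace_image matrix_vector_mul_linear)
  have "inj_on ((*v) U) (span (G j))" using Isom_inj[OF U] by (simp add: inj_on_def)
  then show "dim (act U G j) = j"
    unfolding act_nth[OF j] using Gj(2) dim_image_eq[OF matrix_vector_mul_linear, of U "G j"] by simp
  fix x y assume "x \<in> act U G j" "y \<in> act U G j"
  then show "bf x y = 0" using Gj(3) Isom_bf[OF U] unfolding act_nth[OF j] by auto
next
  fix i j assume ij: "i \<in> {1..k}" "j \<in> {1..k}" "i \<le> j"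
  then show "act U G i \<subseteq> act U G j" using G unfolding flags_def act_nth[OF ij(1)] act_nth[OF ij(2)]
    by (intro image_mono) auto
qed

lemma act_mult: "act (U ** V) G = act U (act V G)"
  unfolding flag_act_def by (rule ext) (auto simp: image_image matrix_vector_mul_assoc)

lemma act_F0_family: "j \<in> {1..k} \<Longrightarrow> act U F0 j = span ((\<lambda>b. U *v bas (n - j + b)) ` {..<j})"
  unfolding act_nth F0_family linear_span_image[OF matrix_vector_mul_linear, symmetric]
  by (simp add: image_image)

lemma act_Finf_family: "j \<in> {1..k} \<Longrightarrow> act U Finf j = span ((\<lambda>b. U *v bas b) ` {..<j})"
  unfolding act_nth Finf_family linear_span_image[OF matrix_vector_mul_linear, symmetric]
  by (simp add: image_image)

text \<open>The coordinate subspace that pairs with exactly the rows \<open>r\<close>. F_0^j arises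
  from the first j rows and F_inf^j from the last j, so one lemma treats both transversality
  conditions.\<close>

definition dspan :: "(nat \<Rightarrow> 'n) \<Rightarrow> nat \<Rightarrow> 'n rvec set" where
  "dspan r j = {x. \<forall>i. x $ i \<noteq> 0 \<longrightarrow> dual p q i \<in> r ` {..<j}}"

lemma dspanD:
  assumes "x \<in> dspan r j" "i \<notin> r ` {..<j}"
  shows "x $ dual p q i = 0"
proof (rule ccontr)
  assume "x $ dual p q i \<noteq> 0"
  moreover have "\<forall>i. x $ i \<noteq> 0 \<longrightarrow> dual p q i \<in> r ` {..<j}"
    using assms(1) unfolding dspan_def by (rule CollectD)
  ultimately have "dual p q (dual p q i) \<in> r ` {..<j}" by iprover
  with assms(2) show False unfolding dual_dual by simp
qed

lemma bf_dspan:
  assumes r: "inj_on r {..<j}" and x: "x \<in> dspan r j"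
  shows "bf x y = (\<Sum>a<j. x $ dual p q (r a) * y $ r a)"
proof -
  have "bf x y = bf y x" by (rule bf_commute)
  also have "\<dots> = (\<Sum>i\<in>UNIV. x $ dual p q i * y $ i)"
    unfolding bf_sum by (intro sum.cong refl mult.commute)
  also have "\<dots> = (\<Sum>i\<in>r ` {..<j}. x $ dual p q i * y $ i)"
  proof (rule sum.mono_neutral_right)
    show "\<forall>i\<in>UNIV - r ` {..<j}. x $ dual p q i * y $ i = 0"
      using dspanD[OF x] by simp
  qed auto
  also have "\<dots> = (\<Sum>a<j. x $ dual p q (r a) * y $ r a)" using r by (simp add: sum.reindex)
  finally show ?thesis .
qed

text \<open>A vector of \<open>dspan r j\<close> orthogonal to all \<open>f b\<close> is the same
  datum as a row relation in \<open>minor_zero_iff\<close>, its coordinates at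
  \<open>dual p q (r a)\<close> being the coefficients.\<close>

lemma dspan_perp_iff:
  assumes r: "inj_on r {..<j}"
  shows "dspan r j \<inter> perp p q (span (f ` {..<j})) = {0} \<longleftrightarrow> minor r j f \<noteq> 0"
proof -
  have perp: "x \<in> perp p q (span (f ` {..<j})) \<longleftrightarrow> (\<forall>b<j. bf x (f b) = 0)" for x
  proof
    assume "x \<in> perp p q (span (f ` {..<j}))"
    then show "\<forall>b<j. bf x (f b) = 0" unfolding perp_def by (auto intro: span_base)
  next
    assume *: "\<forall>b<j. bf x (f b) = 0"
    have "subspace {y. bf x y = 0}" by (rule subspaceI) auto
    then have "span (f ` {..<j}) \<subseteq> {y. bf x y = 0}" using * by (intro span_minimal) auto
    then show "x \<in> perp p q (span (f ` {..<j}))" unfolding perp_def by auto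
  qed
  have "minor r j f = 0 \<longleftrightarrow> (\<exists>x. x \<in> dspan r j \<and> x \<noteq> 0 \<and> (\<forall>b<j. bf x (f b) = 0))"
    unfolding minor_zero_iff
  proof
    assume "\<exists>u. (\<exists>a<j. u a \<noteq> 0) \<and> (\<forall>b<j. (\<Sum>a<j. u a * f b $ r a) = 0)"
    then obtain u a0 where u: "a0 < j" "u a0 \<noteq> 0" "\<forall>b<j. (\<Sum>a<j. u a * f b $ r a) = 0" by auto
    define x :: "'n rvec" where
      "x = (\<chi> i. if dual p q i \<in> r ` {..<j} then u (the_inv_into {..<j} r (dual p q i)) else 0)"
    have x_nth: "x $ dual p q (r a) = u a" if "a < j" for a
      using that r by (auto simp: x_def the_inv_into_f_f)
    have x: "x \<in> dspan r j" unfolding dspan_def by (auto simp: x_def)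
    moreover have "x \<noteq> 0" using x_nth[OF u(1)] u(2) by auto
    moreover have "bf x (f b) = 0" if "b < j" for b
    proof -
      have "bf x (f b) = (\<Sum>a<j. u a * f b $ r a)"
        unfolding bf_dspan[OF r x] by (rule sum.cong[OF refl]) (simp add: x_nth)
      then show ?thesis using u(3) that by simp
    qed
    ultimately show "\<exists>x. x \<in> dspan r j \<and> x \<noteq> 0 \<and> (\<forall>b<j. bf x (f b) = 0)" by blast
  next
    assume "\<exists>x. x \<in> dspan r j \<and> x \<noteq> 0 \<and> (\<forall>b<j. bf x (f b) = 0)"
    then obtain x where x: "x \<in> dspan r j" "x \<noteq> 0" "\<forall>b<j. bf x (f b) = 0" by auto
    obtain i where i: "x $ i \<noteq> 0" using x(2) by (auto simp: vec_eq_iff)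
    then have "dual p q i \<in> r ` {..<j}" using x(1) unfolding dspan_def by simp
    then obtain a where a: "a < j" "dual p q i = r a" by auto
    then have "x $ dual p q (r a) \<noteq> 0" using i dual_dual[of i] a by simp
    then show "\<exists>u. (\<exists>a<j. u a \<noteq> 0) \<and> (\<forall>b<j. (\<Sum>a<j. u a * f b $ r a) = 0)"
      using x(3) a(1) unfolding bf_dspan[OF r x(1)]
      by (intro exI[of _ "\<lambda>a. x $ dual p q (r a)"]) auto
  qed
  also have "\<dots> \<longleftrightarrow> (\<exists>x. x \<in> dspan r j \<and> x \<noteq> 0 \<and> x \<in> perp p q (span (f ` {..<j})))"
    by (simp only: perp)
  finally have *: "minor r j f = 0 \<longleftrightarrow> \<dots>" .
  have "0 \<in> dspan r j" "0 \<in> perp p q (span (f ` {..<j}))" by (simp_all add: dspan_def perp)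
  then show ?thesis unfolding * by blast
qed

lemma subspace_perp: "subspace (perp p q S :: 'n rvec set)"
  unfolding perp_def by (rule subspaceI) auto

text \<open>The form is nondegenerate, so the orthogonal of a j-dimensional subspace has codimension
  j, and a trivial intersection fills the space by counting dimensions.\<close>

lemma perp_sum_UNIV:
  assumes "subspace S0" "dim S0 = j" "subspace S" "dim S = j" "S0 \<inter> perp p q S = {0}"
  shows "{x + y | x y. x \<in> S0 \<and> y \<in> perp p q S} = (UNIV :: 'n rvec set)"
proof -
  have fS: "subspace (flip ` S)" using assms(3) by (intro linear_subspace_image matrix_vector_mul_linear)
  have "inj_on flip (span S)" by (rule inj_on_inverseI[of _ flip]) simp
  then have dfS: "dim (flip ` S) = j" using dim_image_eq[OF matrix_vector_mul_linear, of "gram p q" S] assms(4) by simp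
  have perp: "perp p q S = {y \<in> UNIV. \<forall>x\<in>flip ` S. orthogonal x y}"
    unfolding perp_def bform_def orthogonal_def by (auto simp: inner_commute)
  have "dim (perp p q S) + j = dim (UNIV :: 'n rvec set)"
    using dim_subspace_orthogonal_to_vectors[OF fS subspace_UNIV subset_UNIV] dfS unfolding perp by simp
  moreover have "dim {x + y | x y. x \<in> S0 \<and> y \<in> perp p q S} + dim (S0 \<inter> perp p q S) = j + dim (perp p q S)"
    using dim_sums_Int[OF assms(1) subspace_perp, of S] assms(2) by simp
  ultimately have "dim {x + y | x y. x \<in> S0 \<and> y \<in> perp p q S} = dim (UNIV :: 'n rvec set)"
    unfolding assms(5) by simp
  then have full: "span {x + y | x y. x \<in> S0 \<and> y \<in> perp p q S} = (UNIV :: 'n rvec set)"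
    by (simp only: dim_UNIV dim_eq_full)
  have "span {x + y | x y. x \<in> S0 \<and> y \<in> perp p q S} = {x + y | x y. x \<in> S0 \<and> y \<in> perp p q S}"
    by (rule span_eq_iff[THEN iffD2, OF subspace_sums[OF assms(1) subspace_perp]])
  then show ?thesis using full by (rule trans[OF sym])
qed

lemma F0_dspan: "j \<in> {1..k} \<Longrightarrow> F0 j = dspan idx j" and inj_top: "j \<in> {1..k} \<Longrightarrow> inj_on (idx :: nat \<Rightarrow> 'n) {..<j}"
proof -
  assume j: "j \<in> {1..k}"
  have jn: "j \<le> n" using j kq qp by auto
  show "inj_on (idx :: nat \<Rightarrow> 'n) {..<j}"
    using jn by (auto intro!: inj_onI simp: idx_eq_iff)
  have "pos i \<in> {n - j..<n} \<longleftrightarrow> dual p q i \<in> idx ` {..<j}" for i :: 'n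
  proof -
    have "dual p q i \<in> idx ` {..<j} \<longleftrightarrow> pos (dual p q i) < j"
    proof
      assume "dual p q i \<in> idx ` {..<j}"
      then show "pos (dual p q i) < j" using jn by auto
    next
      assume "pos (dual p q i) < j"
      then show "dual p q i \<in> idx ` {..<j}" by (intro image_eqI[of _ _ "pos (dual p q i)"]) auto
    qed
    then show ?thesis using pos_lt[of i] j kq qp by (auto simp: pos_dual)
  qed
  then show "F0 j = dspan idx j" unfolding F0_supp[OF j] supp_def dspan_def by simp
qed

lemma Finf_dspan: "j \<in> {1..k} \<Longrightarrow> Finf j = dspan (\<lambda>a. idx (n - j + a)) j"
  and inj_bot: "j \<in> {1..k} \<Longrightarrow> inj_on (\<lambda>a. idx (n - j + a) :: 'n) {..<j}"
proof -
  assume j: "j \<in> {1..k}"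
  have jn: "j \<le> n" using j kq qp by auto
  show "inj_on (\<lambda>a. idx (n - j + a) :: 'n) {..<j}"
    using jn by (auto intro!: inj_onI simp: idx_eq_iff)
  have "pos i \<in> {..<j} \<longleftrightarrow> dual p q i \<in> (\<lambda>a. idx (n - j + a)) ` {..<j}" for i :: 'n
  proof -
    have "dual p q i \<in> (\<lambda>a. idx (n - j + a)) ` {..<j} \<longleftrightarrow> n - j \<le> pos (dual p q i)"
    proof
      assume "dual p q i \<in> (\<lambda>a. idx (n - j + a)) ` {..<j}"
      then show "n - j \<le> pos (dual p q i)" using jn by auto
    next
      assume "n - j \<le> pos (dual p q i)"
      then show "dual p q i \<in> (\<lambda>a. idx (n - j + a)) ` {..<j}"
        using pos_lt[of "dual p q i"] jn by (intro image_eqI[of _ _ "pos (dual p q i) - (n - j)"]) auto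
    qed
    then show ?thesis using pos_lt[of i] j kq qp by (auto simp: pos_dual)
  qed
  then show "Finf j = dspan (\<lambda>a. idx (n - j + a)) j" unfolding Finf_supp[OF j] supp_def dspan_def by simp
qed

lemma Omega_iff:
  assumes G: "G \<in> flags p q k" and f: "\<And>j. j \<in> {1..k} \<Longrightarrow> G j = span (f j ` {..<j})"
  shows "G \<in> \<Omega> p q k F0 \<longleftrightarrow> (\<forall>j\<in>{1..k}. top_minor j (f j) \<noteq> 0)"
    and "G \<in> \<Omega> p q k Finf \<longleftrightarrow> (\<forall>j\<in>{1..k}. bot_minor j (f j) \<noteq> 0)"
proof -
  have sum: "H j \<inter> perp p q (G j) = {0} \<and> {x + y | x y. x \<in> H j \<and> y \<in> perp p q (G j)} = UNIV
      \<longleftrightarrow> H j \<inter> perp p q (G j) = {0}" if j: "j \<in> {1..k}" and H: "H \<in> flags p q k" for j H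
    using perp_sum_UNIV[of "H j" j "G j"] G H j unfolding flags_def by auto
  show "G \<in> \<Omega> p q k F0 \<longleftrightarrow> (\<forall>j\<in>{1..k}. top_minor j (f j) \<noteq> 0)"
    unfolding \<Omega>_def transverse_def using G sum[OF _ F0_flag]
    by (simp add: F0_dspan f dspan_perp_iff inj_top)
  show "G \<in> \<Omega> p q k Finf \<longleftrightarrow> (\<forall>j\<in>{1..k}. bot_minor j (f j) \<noteq> 0)"
    unfolding \<Omega>_def transverse_def using G sum[OF _ Finf_flag]
    by (simp add: Finf_dspan f dspan_perp_iff inj_bot)
qed


section \<open>Every flag transverse to F_inf comes from an Eichler product\<close>

lemma unitri_Finf:
  assumes U: "U \<in> Isom" "unitri U"
  shows "(*v) U ` supp {..<a} = supp {..<a}"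
proof (rule subspace_dim_equal)
  show "subspace ((*v) U ` supp {..<a})" by (intro linear_subspace_image matrix_vector_mul_linear subspace_supp)
  show "(*v) U ` supp {..<a} \<subseteq> supp {..<a}" using unitri_supp[OF U(2)] by auto
  have "inj_on ((*v) U) (span (supp {..<a}))" using Isom_inj[OF U(1)] by (simp add: inj_on_def)
  then show "dim (supp {..<a} :: 'n rvec set) \<le> dim ((*v) U ` supp {..<a})"
    using dim_image_eq[OF matrix_vector_mul_linear, of U "supp {..<a}"] by simp
qed simp

text \<open>Transversality yields g in G^(m+1) whose pullback y = U^-1 g has tilde-part exactly
  tilde e_(m+1); isotropy of G^(m+1) then forces y to have the shape E(w) tilde e_(m+1).\<close>

lemma Omega_Finf_step:
  assumes G: "G \<in> \<Omega> p q k Finf" and m: "m < k" and U: "U \<in> Isom" "unitri U"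
    and GU: "\<And>j. j \<in> {1..m} \<Longrightarrow> G j = (*v) U ` F0 j"
  obtains w where "w \<in> Wsp (Suc m)" "U *v (E (bas m) w *v bas (n - 1 - m)) \<in> G (Suc m)"
proof -
  let ?J = "Suc m"
  have J: "?J \<in> {1..k}" using m by simp
  have mn: "m < n" "m < n - 1 - m" "n - 1 - m < n" using m kq qp by auto
  have GF: "G \<in> flags p q k" and sumU: "{x + y | x y. x \<in> Finf ?J \<and> y \<in> perp p q (G ?J)} = UNIV"
    using G J unfolding \<Omega>_def transverse_def by auto
  have "subspace (G ?J) \<and> dim (G ?J) = ?J \<and> (\<forall>x\<in>G ?J. \<forall>y\<in>G ?J. bf x y = 0)"
    using GF J unfolding flags_def by blast
  then have GJ: "subspace (G ?J)" "dim (G ?J) = ?J" "\<And>x y. x \<in> G ?J \<Longrightarrow> y \<in> G ?J \<Longrightarrow> bf x y = 0"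
    by blast+
  obtain V where V: "V ** U = Finite_Cartesian_Product.mat 1" "U ** V = Finite_Cartesian_Product.mat 1"
    using U(1) unfolding isometries_def invertible_def by auto
  have UV: "U *v (V *v g) = g" for g by (simp add: V matrix_vector_mul_assoc)
  have bfV: "bf (U *v x) g = bf x (V *v g)" for x g
    using Isom_bf[OF U(1), of x "V *v g"] by (simp add: UV)
  \<comment> \<open>\<open>T\<close> reads the coordinates of U^-1 g along tilde e_1, ..., tilde
    e_(m+1). A vector in its kernel is orthogonal to F_inf^(m+1) and to the orthogonal of G^(m+1),
    hence to everything.\<close>
  define T where "T g = restr {n - ?J..<n} (V *v g)" for g
  have linT: "linear T" unfolding T_def
    by (intro linear_compose[OF matrix_vector_mul_linear linear_restr, unfolded o_def])
  have inj: "g = 0" if g: "g \<in> G ?J" "T g = 0" for g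
  proof (rule bf_nondeg)
    fix z
    obtain x y where z: "z = x + y" "x \<in> Finf ?J" "y \<in> perp p q (G ?J)" using sumU by blast
    obtain x' where x': "x' \<in> supp {..<?J}" "x = U *v x'"
      using z(2) unitri_Finf[OF U, of ?J] unfolding Finf_supp[OF J] by auto
    have "bf x g = bf x' (V *v g)" unfolding x'(2) by (rule bfV)
    also have "\<dots> = 0" unfolding bf_sum
    proof (intro sum.neutral ballI)
      fix i :: 'n
      show "x' $ i * (V *v g) $ dual p q i = 0"
      proof (cases "pos i < ?J")
        case True
        then have "pos (dual p q i) \<in> {n - ?J..<n}" using m kq qp by (auto simp: pos_dual)
        then have "(V *v g) $ dual p q i = T g $ dual p q i" by (simp add: T_def restr_nth)
        then show ?thesis using g(2) by simp
      next
        case False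
        then show ?thesis using suppD[OF x'(1), of i] by simp
      qed
    qed
    finally have "bf g x = 0" using bf_commute[of g x] by simp
    moreover have "bf g y = 0" using z(3) g(1) bf_commute[of g y] unfolding perp_def by auto
    ultimately show "bf g z = 0" unfolding z(1) by simp
  qed
  have "inj_on T (span (G ?J))" unfolding span_eq_iff[THEN iffD2, OF GJ(1)]
    by (subst linear_inj_on_iff_eq_0[OF linT GJ(1)]) (use inj in auto)
  then have "dim (T ` G ?J) = ?J" using dim_image_eq[OF linT, of "G ?J"] GJ(2) by simp
  moreover have "dim (supp {n - ?J..<n} :: 'n rvec set) = card {n - ?J..<n}"
    by (rule dim_supp) (auto simp: card_n)
  ultimately have "dim (supp {n - ?J..<n} :: 'n rvec set) \<le> dim (T ` G ?J)" using mn by simp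
  then have "T ` G ?J = supp {n - ?J..<n}"
    by (intro subspace_dim_equal linear_subspace_image[OF linT GJ(1)] subspace_supp) (auto simp: T_def restr_supp)
  moreover have "(bas (n - 1 - m) :: 'n rvec) \<in> supp {n - ?J..<n}" using mn by (intro bas_supp) auto
  ultimately obtain g where g: "g \<in> G ?J" "bas (n - 1 - m) = T g" by auto
  define y where "y = V *v g"
  have y_top: "y $ i = (bas (n - 1 - m) :: 'n rvec) $ i" if "pos i \<in> {n - ?J..<n}" for i
    using that unfolding g(2) T_def y_def by (simp add: restr_nth)
  \<comment> \<open>\<open>g\<close> is orthogonal to G^m = U F_0^m, so its pullback has no
    coordinates along e_1, ..., e_m.\<close>
  have y_bot: "y $ i = 0" if i: "pos i < m" for i
  proof -
    have k: "n - k - 2 \<le> n - 1 - pos i" "n - 1 - pos i < n" "n - 1 - (n - 1 - pos i) = pos i"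
      using i m kq qp by auto
    have "(bas (n - 1 - pos i) :: 'n rvec) \<in> F0 m" using i m mn by (subst F0_supp) (auto intro!: bas_supp)
    then have "U *v bas (n - 1 - pos i) \<in> G m" using GU[of m] i by auto
    moreover have "G m \<subseteq> G ?J" using GF i m unfolding flags_def by auto
    ultimately have "bf (U *v bas (n - 1 - pos i)) g = 0" using GJ(3) g(1) by blast
    then show ?thesis unfolding bfV y_def[symmetric] using bf_bas[of "n - 1 - pos i" y] k by simp
  qed
  define w where "w = restr {?J..<n - ?J} y"
  have w: "w \<in> Wsp ?J" unfolding w_def by (rule restr_supp)
  define c where "c = y $ idx m"
  have y: "y = bas (n - 1 - m) + w + c *\<^sub>R bas m"
  proof -
    have "y $ i = (bas (n - 1 - m) + w + c *\<^sub>R bas m) $ i" for i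
    proof -
      consider "pos i < m" | "pos i = m" | "pos i \<in> {?J..<n - ?J}" | "pos i \<in> {n - ?J..<n}"
        using pos_lt[of i] by fastforce
      then show ?thesis
      proof cases
        case 1
        then show ?thesis using y_bot[of i] mn by (auto simp: w_def restr_nth bas_nth)
      next
        case 2
        then have "idx m = i" by (metis idx_pos)
        then show ?thesis using 2 mn by (auto simp: w_def restr_nth bas_nth c_def)
      next
        case 3
        then show ?thesis using mn by (auto simp: w_def restr_nth bas_nth)
      next
        case 4
        then show ?thesis using y_top[of i] mn by (auto simp: w_def restr_nth bas_nth)
      qed
    qed
    then show ?thesis by (simp add: vec_eq_iff)
  qed
  have "bf y y = bf (U *v y) g" unfolding bfV y_def ..
  also have "\<dots> = 0" unfolding y_def UV by (rule GJ(3)[OF g(1) g(1)])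
  finally have yy: "bf y y = 0" .
  have "bf (bas (n - 1 - m)) y = y $ idx (n - 1 - (n - 1 - m))" using m mn by (intro bf_bas) auto
  moreover have "n - 1 - (n - 1 - m) = m" using mn by auto
  ultimately have b1: "bf y (bas (n - 1 - m)) = c" using bf_commute[of y "bas (n - 1 - m)"] by (simp add: c_def)
  have "bf y (bas m) = y $ idx (n - 1 - m)" using m mn by (intro bf_bas') auto
  also have "\<dots> = 1" using y_top[of "idx (n - 1 - m)"] mn by (auto simp: bas_nth)
  finally have b2: "bf y (bas m) = 1" .
  have b3: "bf y w = bf w w" using bf_restr[OF w, of y] m kq bf_commute[of y w] unfolding w_def by simp
  have "bf y y = bf y (bas (n - 1 - m) + w + c *\<^sub>R bas m)" using y by simp
  \<comment> \<open>Isotropy of \<open>y\<close> reads 2 c + <w,w> = 0, which is precisely the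
    coefficient in \<open>E_step_tilde\<close>.\<close>
  then have "c = - (bf w w / 2)" using yy b1 b2 b3 by simp
  then have "y = E (bas m) w *v bas (n - 1 - m)" unfolding E_step_tilde[OF m w] using y by simp
  then have "U *v (E (bas m) w *v bas (n - 1 - m)) = g" unfolding y_def using UV by metis
  then show thesis using that[OF w] g(1) by simp
qed

text \<open>The new vector and G^m together span a subspace of G^(m+1) of full dimension, and the
  earlier steps are untouched because the new factor fixes tilde e_1, ..., tilde e_m.\<close>

lemma Omega_Finf_Cell:
  assumes G: "G \<in> \<Omega> p q k Finf"
  shows "m \<le> k \<Longrightarrow> \<exists>U\<in>Cell (\<lambda>_ _. True) m. \<forall>j\<in>{1..m}. G j = act U F0 j"
proof (induction m)
  case (Suc m)
  then have m: "m < k" by simp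
  obtain U where U: "U \<in> Cell (\<lambda>_ _. True) m" and GU: "\<forall>j\<in>{1..m}. G j = act U F0 j" using Suc by auto
  have UI: "U \<in> Isom" "unitri U" using Cell_SO0_unitri[OF _ U] m SO0_Isom by auto
  have "G j = (*v) U ` F0 j" if "j \<in> {1..m}" for j using GU that m by (simp add: act_nth)
  from Omega_Finf_step[OF G m UI this]
  obtain w where w: "w \<in> Wsp (Suc m)" and g: "U *v (E (bas m) w *v bas (n - 1 - m)) \<in> G (Suc m)" by auto
  let ?V = "U ** E (bas m) w"
  have Vfix: "?V *v bas (n - 1 - i) = U *v bas (n - 1 - i)" if "i < m" for i
    using E_step_fix[OF m w that] by (simp flip: matrix_vector_mul_assoc)
  have old: "act ?V F0 j = G j" if j: "j \<in> {1..m}" for j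
  proof -
    have jk: "j \<in> {1..k}" using j m by simp
    have "(\<lambda>b. ?V *v bas (n - j + b)) ` {..<j} = (\<lambda>b. U *v bas (n - j + b)) ` {..<j}"
    proof (rule image_cong[OF refl])
      fix b assume "b \<in> {..<j}"
      then have "n - j + b = n - 1 - (j - 1 - b)" "j - 1 - b < m" using j m kq qp by auto
      then show "?V *v bas (n - j + b) = U *v bas (n - j + b)" using Vfix by presburger
    qed
    then show ?thesis using GU j unfolding act_F0_family[OF jk] by (simp only: act_F0_family[OF jk])
  qed
  have J: "Suc m \<in> {1..k}" using m by simp
  have GF: "G \<in> flags p q k" using G unfolding \<Omega>_def by simp
  have GJ: "subspace (G (Suc m))" "dim (G (Suc m)) = Suc m" using GF J unfolding flags_def by auto
  have VI: "?V \<in> Isom" using UI E_step_SO0[OF m w] SO0_Isom by (intro Isom_mult) auto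
  have AF: "subspace (act ?V F0 (Suc m))" "dim (act ?V F0 (Suc m)) = Suc m"
    using act_flag[OF VI F0_flag] J unfolding flags_def by auto
  have "act ?V F0 (Suc m) \<subseteq> G (Suc m)" unfolding act_F0_family[OF J]
  proof (rule span_minimal[OF _ GJ(1)], safe)
    fix b assume b: "b < Suc m"
    show "?V *v bas (n - Suc m + b) \<in> G (Suc m)"
    proof (cases b)
      case 0
      then show ?thesis using g by (simp flip: matrix_vector_mul_assoc)
    next
      case (Suc b')
      have "n - Suc m + b = n - m + b'" using Suc m kq qp by auto
      moreover have "b' < m" "m \<in> {1..m}" "m \<in> {1..k}" using Suc b m by auto
      ultimately have "?V *v bas (n - Suc m + b) \<in> act ?V F0 m"
        unfolding act_F0_family[OF \<open>m \<in> {1..k}\<close>] by (auto intro!: span_base)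
      also have "\<dots> = G m" using old \<open>m \<in> {1..m}\<close> by blast
      also have "\<dots> \<subseteq> G (Suc m)" using GF \<open>m \<in> {1..k}\<close> J unfolding flags_def by auto
      finally show ?thesis .
    qed
  qed
  then have "act ?V F0 (Suc m) = G (Suc m)"
    using AF GJ by (intro subspace_dim_equal) auto
  then have "\<forall>j\<in>{1..Suc m}. G j = act ?V F0 j" using old by (auto simp: le_Suc_eq)
  moreover have "?V \<in> Cell (\<lambda>_ _. True) (Suc m)" using U w by auto
  ultimately show ?case by blast
qed simp

section \<open>A sign attached to a flag step without reference to \<open>U\<close>\<close>

definition fsign :: "nat \<Rightarrow> 'n rvec set \<Rightarrow> real" where
  "fsign j S = (let f = SOME f. span (f ` {..<j}) = S in sgn (top_minor j f * bot_minor j f))"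

text \<open>A change of spanning family multiplies both minors by the same \<open>d\<close>, hence
  their product by a square, so the choice made inside \<open>fsign\<close> is harmless.\<close>

lemma fsign_span: "fsign j (span (f ` {..<j})) = sgn (top_minor j f * bot_minor j f)"
proof -
  define g where "g = (SOME g. span (g ` {..<j}) = span (f ` {..<j}))"
  have g: "span (g ` {..<j}) = span (f ` {..<j})" unfolding g_def
    by (rule someI[of "\<lambda>g. span (g ` {..<j}) = span (f ` {..<j})" f]) (rule refl)
  obtain d where d: "\<And>r. minor r j g = minor r j f * d"
    using span_family_change[of g j f] g by auto
  obtain d' where d': "\<And>r. minor r j f = minor r j g * d'"
    using span_family_change[of f j g] g by auto
  have "sgn (top_minor j g * bot_minor j g) = sgn (top_minor j f * bot_minor j f)"
  proof (cases "d = 0")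
    \<comment> \<open>If d = 0 the minors of \<open>g\<close> vanish, and through \<open>d'\<close>
      so do those of \<open>f\<close>.\<close>
    case True
    then show ?thesis using d d' by simp
  next
    case False
    have "top_minor j g * bot_minor j g = (top_minor j f * bot_minor j f) * (d * d)"
      unfolding d by (simp only: mult_ac)
    moreover have "sgn (d * d) = 1" using False by (simp add: sgn_mult sgn_if)
    ultimately show ?thesis by (simp add: sgn_mult[of _ "d * d"])
  qed
  then show ?thesis unfolding fsign_def g_def[symmetric] Let_def .
qed

lemma matrix_bas: "(U *v bas a) $ i = (U :: 'n rmat) $ i $ idx a"
  by (simp add: bas_def matrix_vector_mult_basis column_def)

lemma unitri_bot_minor:
  assumes "unitri U" "j \<in> {1..k}"
  shows "bot_minor j (\<lambda>b. U *v bas (n - j + b)) = 1"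
proof (rule minor_unitriangular)
  have jn: "j \<le> n" using assms(2) kq qp by auto
  fix a b assume "b < a" "a < j"
  then have "pos (idx (n - j + b) :: 'n) < pos (idx (n - j + a) :: 'n)" using jn by simp
  then show "(U *v bas (n - j + b)) $ idx (n - j + a) = 0"
    using assms(1) unfolding matrix_bas unitri_def by blast
qed (use assms(1) in \<open>simp add: matrix_bas unitri_def\<close>)

lemma fsign_act_F0:
  assumes "bot_minor j (\<lambda>b. U *v bas (n - j + b)) = 1" "j \<in> {1..k}"
  shows "fsign j (act U F0 j) = sgn (det_ur j U)"
  unfolding act_F0_family[OF assms(2)] fsign_span assms(1) det_ur_minor card_n by simp

text \<open>The analogue of a Weyl element of SL_2 written as a product of three unipotents. The
  normalization <w,w> = 2 makes the coefficient <w,w>/2 equal to 1, so that e goes to e + w - f and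
  then to -f.\<close>

lemma swap_step:
  assumes ef: "bf e e = 0" "bf f f = 0" "bf e f = 1" and w: "bf e w = 0" "bf f w = 0" "bf w w = 2"
  defines "S \<equiv> E e w ** (E f w ** E e w)"
  shows "S \<in> SO0 p q" "S *v e = - f"
    "\<And>x. bf e x = 0 \<Longrightarrow> bf f x = 0 \<Longrightarrow> bf w x = 0 \<Longrightarrow> S *v x = x"
proof -
  have sym: "bf f e = 1" "bf w e = 0" "bf w f = 0"
    using ef w bf_commute[of f e] bf_commute[of w e] bf_commute[of w f] by auto
  show "S \<in> SO0 p q" unfolding S_def using ef w by (intro SO0_mult E_SO0)
  show "S *v e = - f"
  proof -
    have "E e w *v e = e" by (simp add: E_vec ef sym)
    moreover have "E f w *v e = e + w - f" by (simp add: E_vec ef w sym)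
    moreover have "E e w *v (e + w - f) = - f" by (simp add: E_vec ef w sym vec_eq_iff)
    ultimately show ?thesis unfolding S_def by (simp add: matrix_vector_mul_assoc[symmetric])
  qed
  show "S *v x = x" if "bf e x = 0" "bf f x = 0" "bf w x = 0" for x
    unfolding S_def by (simp add: matrix_vector_mul_assoc[symmetric] E_vec that)
qed

text \<open>The pairs e_i, tilde e_i are exchanged one at a time, always with the auxiliary vector
  e_(k+1) + tilde e_(k+1) of norm 2. It lies beyond the flag, so each exchange fixes the other e_i
  and tilde e_i with i <= k.\<close>

lemma swap_exists:
  "m \<le> k \<Longrightarrow> \<exists>s\<in>(SO0 p q :: 'n rmat set). (\<forall>i<m. s *v bas i = - bas (n - 1 - i)) \<and> (\<forall>i<k. m \<le> i \<longrightarrow> s *v bas i = bas i)"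
proof (induction m)
  case 0
  then show ?case using one_SO0 by (intro bexI[of _ "Finite_Cartesian_Product.mat 1"]) auto
next
  case (Suc m)
  then obtain s :: "'n rmat" where s: "s \<in> SO0 p q" "\<And>i. i < m \<Longrightarrow> s *v bas i = - bas (n - 1 - i)"
    "\<And>i. i < k \<Longrightarrow> m \<le> i \<Longrightarrow> s *v bas i = bas i" by auto
  have kn: "k < n - 1 - k" "Suc k < n" using kq qp by auto
  define e where "e = (bas m :: 'n rvec)"
  define f where "f = (bas (n - 1 - m) :: 'n rvec)"
  define w where "w = (bas k + bas (n - 1 - k) :: 'n rvec)"
  have B: "bf (bas a) (bas b) = (if b = n - 1 - a then 1 else 0)"
    if "a < k + 2 \<or> n - k - 2 \<le> a" "a < n" "b < n" for a b
    using that bf_bas[of a "bas b"] by (simp add: bas_nth_idx)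
  have B': "bf (bas (n - 1 - a)) (bas b) = (if b = a then 1 else 0)" if "a \<le> k" "b < n" for a b
  proof -
    have "n - k - 2 \<le> n - 1 - a" "n - 1 - a < n" "n - 1 - (n - 1 - a) = a" using that kn by auto
    then show ?thesis using B[of "n - 1 - a" b] that(2) by presburger
  qed
  have mk: "m \<le> k" "k \<le> k" "m < k + 2" "k < k + 2" "m < n" "k < n" "n - 1 - m < n" "n - 1 - k < n"
    "m \<noteq> n - 1 - m" "k \<noteq> n - 1 - m" "n - 1 - k \<noteq> n - 1 - m" "k \<noteq> m" "n - 1 - k \<noteq> m" "n - 1 - m \<noteq> m"
    "k \<noteq> n - 1 - k" "n - 1 - k \<noteq> k"
    using Suc.prems kn by auto
  note R = B[OF disjI1, OF mk(3) mk(5)] B[OF disjI1, OF mk(4) mk(6)] B'[OF mk(1)] B'[OF mk(2)]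
  have ef: "bf e e = 0" "bf f f = 0" "bf e f = 1" "bf e w = 0" "bf f w = 0" "bf w w = 2"
    unfolding e_def f_def w_def bf_linear
    by (simp_all only: R mk if_True if_False refl add_0_left add_0_right one_add_one)
  define S where "S = E e w ** (E f w ** E e w)"
  note S = swap_step[OF ef, folded S_def]
  have fix1: "S *v bas b = bas b" if "b < n" "b < k \<or> n - k \<le> b" "b \<noteq> m" "b \<noteq> n - 1 - m" for b
  proof (rule S(3))
    have "b \<noteq> k" "b \<noteq> n - 1 - k" using that kn by auto
    then show "bf e (bas b) = 0" "bf f (bas b) = 0" "bf w (bas b) = 0"
      unfolding e_def f_def w_def bf_linear R[OF that(1)] using that(3,4) by simp_all
  qed
  show ?case
  proof (intro bexI[of _ "S ** s"] conjI allI impI)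
    show "S ** s \<in> SO0 p q" by (rule SO0_mult[OF S(1) s(1)])
  next
    fix i assume i: "i < Suc m"
    show "S ** s *v bas i = - bas (n - 1 - i)"
    proof (cases "i = m")
      case True
      have "s *v bas m = e" unfolding e_def by (rule s(3)) (use Suc.prems in auto)
      then have "S ** s *v bas m = - f" using S(2) by (simp only: matrix_vector_mul_assoc[symmetric])
      then show ?thesis unfolding True f_def .
    next
      case False
      then have im: "i < m" using i by simp
      have "S *v bas (n - 1 - i) = bas (n - 1 - i)" using im Suc.prems kn by (intro fix1) auto
      then have "S *v (- bas (n - 1 - i)) = - bas (n - 1 - i)"
        by (simp add: linear_neg[OF matrix_vector_mul_linear])
      then show ?thesis using s(2)[OF im] by (simp only: matrix_vector_mul_assoc[symmetric])
    qed
  next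
    fix i assume i: "i < k" "Suc m \<le> i"
    have "S *v bas i = bas i" using i Suc.prems kn by (intro fix1) auto
    then show "S ** s *v bas i = bas i" using s(3)[of i] i by (simp flip: matrix_vector_mul_assoc)
  qed
qed

text \<open>The flag topology is defined through the orbit of F_inf while the cells act on F_0;
  \<open>s\<close> rewrites U F_0 as (U s) F_inf with U s still in SO_0.\<close>

lemma swap_flag: "\<exists>s\<in>SO0 p q. act s Finf = F0"
proof -
  obtain s :: "'n rmat" where s: "s \<in> SO0 p q" "\<And>i. i < k \<Longrightarrow> s *v bas i = - bas (n - 1 - i)"
    using swap_exists[of k] by auto
  have "act s Finf j = F0 j" for j
  proof (cases "j \<in> {1..k}")
    case j: True
    have A: "act s Finf \<in> flags p q k" using s(1) SO0_Isom by (intro act_flag Finf_flag) auto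
    have "act s Finf j \<subseteq> supp {n - j..<n}"
      unfolding act_Finf_family[OF j]
    proof (rule span_minimal, safe)
      fix b assume "b < j"
      then have b: "b < k" "n - 1 - b \<in> {n - j..<n}" "n - 1 - b < n" using j kq qp by auto
      then show "s *v bas b \<in> supp {n - j..<n}"
        unfolding s(2)[OF b(1)] by (intro subspace_neg subspace_supp bas_supp)
    qed simp
    then show ?thesis unfolding F0_supp[OF j, symmetric]
      using A F0_flag j by (intro subspace_dim_equal) (auto simp: flags_def)
  next
    case False
    then show ?thesis by (simp only: flag_act_def std_flag_0_def restrict_apply if_False)
  qed
  then show ?thesis using s(1) by auto
qed

end


subsection \<open>The components\<close>

context rpq
begin

text \<open>\<open>U\<close> is triangular on the first k basis vectors, so the m-th power of U - 1
  has (d - 1)^m at the diagonal place of e_(a+1); nilpotency forces d = 1.\<close>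

lemma stable_unipotent_diag:
  assumes st: "\<And>l. l < k \<Longrightarrow> (*v) U ` supp {..<Suc l} = supp {..<Suc l}"
    and un: "unipotent U" and a: "a < k"
  shows "(U :: 'n rmat) $ idx a $ idx a = 1"
proof -
  let ?N = "U - Finite_Cartesian_Product.mat 1"
  let ?d = "U $ idx a $ idx a"
  have an: "a < n" using a kq qp by auto
  have col: "U $ idx a $ i = 0" if "pos i < a" for i
  proof -
    have pa: "pos i < k" using that a by simp
    have "U *v bas (pos i) \<in> supp {..<Suc (pos i)}"
      using st[OF pa] bas_supp[of "pos i" "{..<Suc (pos i)}"] pos_lt[of i] by auto
    then have "(U *v bas (pos i)) $ idx a = 0" using that an by (intro suppD) auto
    then show ?thesis by (simp add: matrix_bas)
  qed
  have row: "(U *v x) $ idx a = ?d * x $ idx a" if x: "x \<in> supp {..<Suc a}" for x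
  proof -
    have "U $ idx a $ i * x $ i = (if i = idx a then ?d * x $ idx a else 0)" for i
    proof (cases "pos i" a rule: linorder_cases)
      case less then show ?thesis using col an by auto
    next
      case equal then have "i = idx a" by (metis idx_pos)
      then show ?thesis by simp
    next
      case greater then show ?thesis using suppD[OF x, of i] an by auto
    qed
    then have "(\<Sum>i\<in>UNIV. U $ idx a $ i * x $ i) = (\<Sum>i::'n\<in>UNIV. if i = idx a then ?d * x $ idx a else 0)"
      by (intro sum.cong refl)
    then show ?thesis by (simp add: matrix_vector_mult_def)
  qed
  have pw: "(((**) ?N ^^ m) (Finite_Cartesian_Product.mat 1)) *v bas a \<in> supp {..<Suc a} \<and>
      ((((**) ?N ^^ m) (Finite_Cartesian_Product.mat 1)) *v bas a) $ idx a = (?d - 1) ^ m" for m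
  proof (induction m)
    case 0
    then show ?case using an by (auto simp: bas_nth intro!: bas_supp)
  next
    case (Suc m)
    define x where "x = (((**) ?N ^^ m) (Finite_Cartesian_Product.mat 1)) *v bas a"
    have x: "x \<in> supp {..<Suc a}" "x $ idx a = (?d - 1) ^ m" using Suc unfolding x_def by auto
    have eq: "(((**) ?N ^^ Suc m) (Finite_Cartesian_Product.mat 1)) *v bas a = U *v x - x"
      unfolding x_def by (simp add: matrix_vector_mult_diff_rdistrib flip: matrix_vector_mul_assoc)
    have "U *v x \<in> supp {..<Suc a}" using st[OF a] x(1) by blast
    then show ?case unfolding eq using x row[OF x(1)]
      by (auto intro: subspace_diff simp: algebra_simps)
  qed
  obtain m where m: "((**) ?N ^^ m) (Finite_Cartesian_Product.mat 1) = 0"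
    using un unfolding unipotent_def by blast
  have "(?d - 1) ^ m = 0" using pw[of m] unfolding m by simp
  then show ?thesis by simp
qed

text \<open>The entries of the lower-right block are pairings <e_l, U tilde e_i> = <U^-1 e_l, tilde
  e_i>, and U^-1 e_l stays in F_inf^l. Stability of the flag gives the zeros, unipotence the ones on
  the diagonal.\<close>

lemma U_group_bot_minor:
  assumes U: "U \<in> U_group p q k"
  shows "U \<in> SO0 p q" "\<And>j. j \<in> {1..k} \<Longrightarrow> bot_minor j (\<lambda>b. U *v bas (n - j + b)) = 1"
proof -
  let ?G = "flag_stabilizer p q k Finf"
  obtain H where H: "U \<in> H" "H \<lhd> matrix_group ?G" "\<forall>A\<in>H. unipotent A"
    using U unfolding U_group_def unipotent_radical_def by blast
  have "H \<subseteq> carrier (matrix_group ?G)"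
    using normal_imp_subgroup[OF H(2)] by (rule subgroup.subset)
  then have UG: "U \<in> ?G" using H(1) unfolding matrix_group_def by auto
  then show US: "U \<in> SO0 p q" unfolding flag_stabilizer_def by simp
  then have UI: "U \<in> Isom" using SO0_Isom by blast
  have un: "unipotent U" using H by blast
  have stab: "act U Finf = Finf" using UG unfolding flag_stabilizer_def by simp
  have st: "(*v) U ` supp {..<Suc l} = supp {..<Suc l}" if "l < k" for l
  proof -
    have l: "Suc l \<in> {1..k}" using that by simp
    show ?thesis using fun_cong[OF stab, of "Suc l"] unfolding act_nth[OF l] Finf_supp[OF l] .
  qed
  have entry: "(U *v bas (n - 1 - i)) $ idx (n - 1 - l) = (if i = l then 1 else 0)"
    if il: "l \<le> i" "i < k" for i l
  proof -
    have ln: "l < k" "l < n" "i < n" "n - 1 - i < n" "n - k - 2 \<le> n - 1 - i" "n - 1 - (n - 1 - i) = i"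
      using il kq qp by auto
    have "(bas l :: 'n rvec) \<in> supp {..<Suc l}" using ln by (intro bas_supp) auto
    then obtain x where x: "x \<in> supp {..<Suc l}" "bas l = U *v x" using st[OF ln(1)] by blast
    have "(U *v bas (n - 1 - i)) $ idx (n - 1 - l) = bf (bas l) (U *v bas (n - 1 - i))"
      using ln by (intro bf_bas[symmetric]) auto
    also have "\<dots> = bf x (bas (n - 1 - i))" unfolding x(2) by (rule Isom_bf[OF UI])
    also have "\<dots> = x $ idx i" using bf_bas'[of "n - 1 - i" x] ln(4-6) by presburger
    finally have *: "(U *v bas (n - 1 - i)) $ idx (n - 1 - l) = x $ idx i" .
    show ?thesis
    proof (cases "i = l")
      case True
      have "(U *v x) $ idx l = (\<Sum>i\<in>UNIV. U $ idx l $ i * x $ i)" by (simp add: matrix_vector_mult_def)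
      also have "\<dots> = (\<Sum>i::'n\<in>UNIV. if i = idx l then x $ idx l else 0)"
      proof (rule sum.cong[OF refl])
        fix i :: 'n
        show "U $ idx l $ i * x $ i = (if i = idx l then x $ idx l else 0)"
        proof (cases "pos i" l rule: linorder_cases)
          case less
          then have "U *v bas (pos i) \<in> supp {..<Suc (pos i)}"
            using st[of "pos i"] ln bas_supp[of "pos i" "{..<Suc (pos i)}"] pos_lt[of i] by auto
          then have "(U *v bas (pos i)) $ idx l = 0" using less ln by (intro suppD) auto
          then show ?thesis using less ln by (auto simp: matrix_bas)
        next
          case equal then have "i = idx l" by (metis idx_pos)
          then show ?thesis using stable_unipotent_diag[OF st un ln(1)] by simp
        next
          case greater then show ?thesis using suppD[OF x(1), of i] ln by auto
        qed
      qed
      finally have "(U *v x) $ idx l = x $ idx l" by simp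
      moreover have "(bas l :: 'n rvec) $ idx l = 1" using ln by (simp add: bas_nth)
      ultimately show ?thesis using * True x(2) by simp
    next
      case False
      then have "x $ idx i = 0" using il ln by (intro suppD[OF x(1)]) auto
      then show ?thesis using * False by simp
    qed
  qed
  show "bot_minor j (\<lambda>b. U *v bas (n - j + b)) = 1" if j: "j \<in> {1..k}" for j
  proof (rule minor_unitriangular)
    fix a b assume ab: "b < a" "a < j"
    have "n - j + b = n - 1 - (j - 1 - b)" "n - j + a = n - 1 - (j - 1 - a)"
      "j - 1 - a \<le> j - 1 - b" "j - 1 - b < k" "j - 1 - b \<noteq> j - 1 - a"
      using ab j kq qp by auto
    then show "(U *v bas (n - j + b)) $ idx (n - j + a) = 0" using entry[of "j - 1 - a" "j - 1 - b"] by simp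
  next
    fix a assume a: "a < j"
    have "n - j + a = n - 1 - (j - 1 - a)" "j - 1 - a < k" using a j kq qp by auto
    then show "(U *v bas (n - j + a)) $ idx (n - j + a) = 1" using entry[of "j - 1 - a" "j - 1 - a"] by simp
  qed
qed

abbreviation XX :: "(nat \<Rightarrow> 'n rvec set) set" where "XX \<equiv> \<Omega> p q k F0 \<inter> \<Omega> p q k Finf"

definition fsigns :: "(nat \<Rightarrow> 'n rvec set) \<Rightarrow> nat \<Rightarrow> real" where
  "fsigns G = (\<lambda>j\<in>{1..k}. fsign j (G j))"

lemma topspace_flag_topology: "topspace (flag_topology p q k) = (flags p q k :: (nat \<Rightarrow> 'n rvec set) set)"
proof -
  have "{g \<in> SO0 p q. act g Finf \<in> flags p q k} = SO0 p q"
    using act_flag[OF _ Finf_flag] SO0_Isom by blast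
  then have "openin (flag_topology p q k) (flags p q k :: (nat \<Rightarrow> 'n rvec set) set)"
    unfolding openin_flag_topology by simp
  then have "flags p q k \<subseteq> topspace (flag_topology p q k :: (nat \<Rightarrow> 'n rvec set) topology)"
    by (rule openin_subset)
  moreover have "topspace (flag_topology p q k) \<subseteq> (flags p q k :: (nat \<Rightarrow> 'n rvec set) set)"
    using openin_topspace[of "flag_topology p q k"] unfolding openin_flag_topology by (rule conjunct1)
  ultimately show ?thesis by (rule subset_antisym[rotated])
qed

lemma orbit_map_continuous:
  "continuous_map (top_of_set (SO0 p q)) (flag_topology p q k) (\<lambda>g :: 'n rmat. act g Finf)"
  unfolding continuous_map_def topspace_flag_topology
proof (intro conjI allI impI)
  show "(\<lambda>g. act g Finf) \<in> topspace (top_of_set (SO0 p q)) \<rightarrow> flags p q k"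
    using act_flag[OF _ Finf_flag] SO0_Isom by auto
  fix S :: "(nat \<Rightarrow> 'n rvec set) set" assume "openin (flag_topology p q k) S"
  then show "openin (top_of_set (SO0 p q)) {g \<in> topspace (top_of_set (SO0 p q)). act g Finf \<in> S}"
    unfolding openin_flag_topology by simp
qed

text \<open>Openness is tested on the preimage in SO_0. There the first j columns of
  \<open>g\<close> form a basis of the j-th step of g F_inf, and the class is cut out by finitely
  many strict inequalities between polynomials in \<open>g\<close>.\<close>

lemma sign_class_open:
  assumes \<epsilon>: "\<And>j. j \<in> {1..k} \<Longrightarrow> \<epsilon> j = 1 \<or> \<epsilon> j = (- 1 :: real)" and ext: "\<epsilon> \<in> extensional {1..k}"
  shows "openin (flag_topology p q k) {G \<in> XX. fsigns G = \<epsilon>}"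
  unfolding openin_flag_topology
proof
  show "{G \<in> XX. fsigns G = \<epsilon>} \<subseteq> flags p q k" by (auto simp: \<Omega>_def)
  define h where "h j g = \<epsilon> j * (top_minor j (\<lambda>b. g *v bas b) * bot_minor j (\<lambda>b. g *v bas b))"
    for j and g :: "'n rmat"
  have "(act g Finf \<in> XX \<and> fsigns (act g Finf) = \<epsilon>) \<longleftrightarrow> (\<forall>j\<in>{1..k}. h j g > 0)"
    if g: "g \<in> SO0 p q" for g
  proof -
    have gI: "g \<in> Isom" using g SO0_Isom by blast
    let ?t = "\<lambda>j. top_minor j (\<lambda>b. g *v bas b)" and ?b = "\<lambda>j. bot_minor j (\<lambda>b. g *v bas b)"
    have "act g Finf \<in> XX \<longleftrightarrow> (\<forall>j\<in>{1..k}. ?t j \<noteq> 0 \<and> ?b j \<noteq> 0)"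
      using Omega_iff[OF act_flag[OF gI Finf_flag], of "\<lambda>j b. g *v bas b"] act_Finf_family by auto
    moreover have "fsigns (act g Finf) = \<epsilon> \<longleftrightarrow> (\<forall>j\<in>{1..k}. sgn (?t j * ?b j) = \<epsilon> j)"
    proof -
      have e: "fsigns (act g Finf) j = sgn (?t j * ?b j)" if "j \<in> {1..k}" for j
        using that by (simp add: fsigns_def act_Finf_family fsign_span)
      have "fsigns (act g Finf) \<in> extensional {1..k}" by (simp add: fsigns_def)
      then have "fsigns (act g Finf) = \<epsilon> \<longleftrightarrow> (\<forall>j\<in>{1..k}. fsigns (act g Finf) j = \<epsilon> j)"
        using ext by (auto intro: extensionalityI)
      then show ?thesis using e by simp
    qed
    moreover have "(?t j \<noteq> 0 \<and> ?b j \<noteq> 0 \<and> sgn (?t j * ?b j) = \<epsilon> j) \<longleftrightarrow> h j g > 0" if "j \<in> {1..k}" for j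
    proof -
      \<comment> \<open>For a sign, one strict inequality encodes both the nonvanishing of
        \<open>z\<close> and the value of its sign.\<close>
      have z: "(z \<noteq> 0 \<and> sgn z = \<epsilon> j) \<longleftrightarrow> \<epsilon> j * z > 0" for z :: real
      proof (cases "\<epsilon> j = 1")
        case True
        show ?thesis unfolding True by (auto simp: sgn_if)
      next
        case False
        then have "\<epsilon> j = - 1" using \<epsilon>[OF that] by simp
        then show ?thesis by (simp only:) (auto simp: sgn_if)
      qed
      show ?thesis unfolding h_def z[symmetric] mult_eq_0_iff de_Morgan_disj by blast
    qed
    ultimately show ?thesis by blast
  qed
  then have "{g \<in> SO0 p q. act g Finf \<in> {G \<in> XX. fsigns G = \<epsilon>}} = SO0 p q \<inter> (\<Inter>j\<in>{1..k}. {g. h j g > 0})"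
    by blast
  moreover have "open {g. h j g > 0}" for j
    unfolding h_def matrix_vector_mult_def by (intro open_Collect_less continuous_intros)
  then have "open (\<Inter>j\<in>{1..k}. {g. h j g > 0})" by (intro open_INT) auto
  ultimately show "openin (top_of_set (SO0 p q)) {g \<in> SO0 p q. act g Finf \<in> {G \<in> XX. fsigns G = \<epsilon>}}"
    by (simp add: openin_open_Int)
qed

lemma XX_det_ur:
  assumes U: "U \<in> SO0 p q" and b: "\<And>j. j \<in> {1..k} \<Longrightarrow> bot_minor j (\<lambda>b. U *v bas (n - j + b)) = 1"
  shows "act U F0 \<in> XX \<longleftrightarrow> (\<forall>j\<in>{1..k}. det_ur j U \<noteq> 0)"
proof -
  have "U \<in> Isom" using U SO0_Isom by blast
  from Omega_iff[OF act_flag[OF this F0_flag], of "\<lambda>j b. U *v bas (n - j + b)"]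
  show ?thesis using act_F0_family b unfolding det_ur_minor card_n by simp
qed

text \<open>The class is the image of a sign cell: \<open>Omega_Finf_Cell\<close> gives a product
  \<open>U\<close> for each flag, and lower minors equal to 1 turn the sign of the flag into that of
  det_j. Continuity comes from the orbit map after right multiplication by \<open>s\<close>.\<close>

lemma sign_class_connected:
  assumes \<epsilon>: "\<And>j. j \<in> {1..k} \<Longrightarrow> \<epsilon> j = 1 \<or> \<epsilon> j = (- 1 :: real)" and ext: "\<epsilon> \<in> extensional {1..k}"
  shows "connectedin (flag_topology p q k) {G \<in> XX. fsigns G = \<epsilon>}" "{G \<in> XX. fsigns G = \<epsilon>} \<noteq> {}"
proof -
  \<comment> \<open>\<open>signCell_connected\<close> asks for a sign at every index, so \<epsilon>
    is extended by 1 outside \<open>{1..k}\<close>.\<close>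
  define \<delta> where "\<delta> j = (if j \<in> {1..k} then \<epsilon> j else 1)" for j
  have \<delta>: "\<delta> j = 1 \<or> \<delta> j = - 1" for j using \<epsilon>[of j] by (auto simp: \<delta>_def)
  define C where "C = Cell (\<lambda>j V. \<delta> j * det_ur j V > 0) k"
  have C: "connected C" "C \<noteq> {}" unfolding C_def using signCell_connected[of \<delta>] \<delta> by auto
  have CU: "U \<in> SO0 p q" "unitri U" if "U \<in> C" for U using that Cell_SO0_unitri[of k U] unfolding C_def by auto
  have eq: "(\<lambda>U. act U F0) ` C = {G \<in> XX. fsigns G = \<epsilon>}"
  proof (intro equalityI subsetI)
    fix G assume "G \<in> (\<lambda>U. act U F0) ` C"
    then obtain U where U: "U \<in> C" "G = act U F0" by blast
    have pos: "\<delta> j * det_ur j U > 0" if "j \<in> {1..k}" for j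
      using Cell_sign[of "\<lambda>j V. \<delta> j * det_ur j V > 0" \<delta> k U j] U(1) that unfolding C_def by auto
    note b = unitri_bot_minor[OF CU(2)[OF U(1)]]
    have "\<forall>j\<in>{1..k}. det_ur j U \<noteq> 0"
    proof (intro ballI notI)
      fix j assume "j \<in> {1..k}" "det_ur j U = 0"
      then show False using pos[of j] by simp
    qed
    then have "G \<in> XX" unfolding U(2) using XX_det_ur[OF CU(1)[OF U(1)] b] by blast
    moreover have "fsigns G = \<epsilon>"
    proof (rule extensionalityI[of _ "{1..k}"])
      fix j assume j: "j \<in> {1..k}"
      have "fsigns G j = sgn (det_ur j U)" unfolding U(2) fsigns_def using j fsign_act_F0[OF b[OF j] j] by simp
      also have "\<dots> = \<epsilon> j" using pos[OF j] \<epsilon>[OF j] j by (auto simp: \<delta>_def sgn_if)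
      finally show "fsigns G j = \<epsilon> j" .
    qed (use ext in \<open>simp_all add: fsigns_def\<close>)
    ultimately show "G \<in> {G \<in> XX. fsigns G = \<epsilon>}" by simp
  next
    fix G assume G: "G \<in> {G \<in> XX. fsigns G = \<epsilon>}"
    then obtain U where U: "U \<in> Cell (\<lambda>_ _. True) k" "\<forall>j\<in>{1..k}. G j = act U F0 j"
      using Omega_Finf_Cell[of G k] by auto
    have "G \<in> extensional {1..k}" using G by (auto simp: \<Omega>_def flags_def)
    then have GU: "G = act U F0"
      using U(2) by (intro extensionalityI[of _ "{1..k}"]) (auto simp: flag_act_def)
    have U': "U \<in> SO0 p q" "unitri U" using Cell_SO0_unitri[OF _ U(1)] by auto
    note b = unitri_bot_minor[OF U'(2)]
    have nz: "\<forall>j\<in>{1..k}. det_ur j U \<noteq> 0" using G XX_det_ur[OF U'(1) b] unfolding GU by blast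
    have "U \<in> C" unfolding C_def
    proof (rule Cell_signI[OF U(1)])
      fix j assume j: "j \<in> {1..k}"
      have "\<epsilon> j = fsigns G j" using G by simp
      also have "\<dots> = sgn (det_ur j U)" unfolding GU fsigns_def using j fsign_act_F0[OF b[OF j] j] by simp
      finally have "\<delta> j = sgn (det_ur j U)" using j by (simp add: \<delta>_def)
      moreover have "det_ur j U \<noteq> 0" using nz j by blast
      ultimately show "\<delta> j * det_ur j U > 0" by (auto simp: sgn_if)
    qed simp
    then show "G \<in> (\<lambda>U. act U F0) ` C" using GU by blast
  qed
  obtain s :: "'n rmat" where s: "s \<in> SO0 p q" "act s Finf = F0" using swap_flag by blast
  have "(\<lambda>U. U ** s) ` C \<subseteq> SO0 p q" using CU(1) SO0_mult s(1) by blast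
  moreover have "connected ((\<lambda>U. U ** s) ` C)"
    by (intro connected_continuous_image C(1) continuous_matrix_mult continuous_on_id continuous_on_const)
  ultimately have "connectedin (top_of_set (SO0 p q)) ((\<lambda>U. U ** s) ` C)"
    by (simp add: connectedin_subtopology)
  from connectedin_continuous_map_image[OF orbit_map_continuous this]
  have "connectedin (flag_topology p q k) ((\<lambda>g. act g Finf) ` (\<lambda>U. U ** s) ` C)" .
  also have "(\<lambda>g. act g Finf) ` (\<lambda>U. U ** s) ` C = (\<lambda>U. act U F0) ` C"
    unfolding image_image act_mult s(2) ..
  finally show "connectedin (flag_topology p q k) {G \<in> XX. fsigns G = \<epsilon>}" unfolding eq .
  show "{G \<in> XX. fsigns G = \<epsilon>} \<noteq> {}" unfolding eq[symmetric] using C(2) by simp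
qed

lemma fsigns_range: "G \<in> XX \<Longrightarrow> fsigns G \<in> {1..k} \<rightarrow>\<^sub>E {1, - 1}"
proof -
  assume G: "G \<in> XX"
  obtain U where U: "U \<in> Cell (\<lambda>_ _. True) k" "\<forall>j\<in>{1..k}. G j = act U F0 j"
    using Omega_Finf_Cell[of G k] G by auto
  have U': "U \<in> SO0 p q" "unitri U" using Cell_SO0_unitri[OF _ U(1)] by auto
  note b = unitri_bot_minor[OF U'(2)]
  have "G \<in> extensional {1..k}" using G by (auto simp: \<Omega>_def flags_def)
  then have GU: "G = act U F0"
    using U(2) by (intro extensionalityI[of _ "{1..k}"]) (auto simp: flag_act_def)
  have "\<forall>j\<in>{1..k}. det_ur j U \<noteq> 0" using G XX_det_ur[OF U'(1) b] unfolding GU by blast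
  then have "sgn (det_ur j U) \<in> {1, - 1}" if "j \<in> {1..k}" for j using that by (auto simp: sgn_if)
  moreover have "fsigns G j = sgn (det_ur j U)" if "j \<in> {1..k}" for j
    unfolding GU fsigns_def using that fsign_act_F0[OF b[OF that] that] by simp
  ultimately show ?thesis by (auto simp: fsigns_def PiE_def)
qed

theorem components:
  defines "T \<equiv> subtopology (flag_topology p q k) XX"
  shows "card (connected_components_of T) = 2 ^ k"
    and "\<And>G H. G \<in> XX \<Longrightarrow> H \<in> XX \<Longrightarrow> connected_component_of T G H \<longleftrightarrow> fsigns G = fsigns H"
proof -
  have XXf: "XX \<subseteq> flags p q k" by (auto simp: \<Omega>_def)
  have top: "topspace T = XX" unfolding T_def topspace_subtopology topspace_flag_topology using XXf by blast
  let ?S = "{1..k} \<rightarrow>\<^sub>E {1, - 1 :: real}"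
  have sub: "{G \<in> topspace T. fsigns G = \<epsilon>} \<subseteq> XX" for \<epsilon> unfolding top by blast
  have conT: "connectedin T A \<longleftrightarrow> connectedin (flag_topology p q k) A \<and> A \<subseteq> XX" for A
    unfolding T_def by (rule connectedin_subtopology)
  have op: "openin T {G \<in> topspace T. fsigns G = \<epsilon>}" and con: "connectedin T {G \<in> topspace T. fsigns G = \<epsilon>}"
    and ne: "{G \<in> topspace T. fsigns G = \<epsilon>} \<noteq> {}" if \<epsilon>: "\<epsilon> \<in> ?S" for \<epsilon>
  proof -
    have e: "\<epsilon> j = 1 \<or> \<epsilon> j = - 1" if "j \<in> {1..k}" for j using \<epsilon> that by auto
    have x: "\<epsilon> \<in> extensional {1..k}" using \<epsilon> by (simp add: PiE_def)
    have "openin (flag_topology p q k) {G \<in> topspace T. fsigns G = \<epsilon>}"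
      unfolding top by (rule sign_class_open[OF e x])
    then have "openin T (XX \<inter> {G \<in> topspace T. fsigns G = \<epsilon>})"
      unfolding T_def by (rule openin_subtopology_Int2)
    then show "openin T {G \<in> topspace T. fsigns G = \<epsilon>}" using sub[of \<epsilon>] by (simp add: Int_absorb1)
    show "connectedin T {G \<in> topspace T. fsigns G = \<epsilon>}"
      unfolding conT top using sign_class_connected(1)[OF e x] by auto
    show "{G \<in> topspace T. fsigns G = \<epsilon>} \<noteq> {}"
      unfolding top by (rule sign_class_connected(2)[OF e x])
  qed
  have surj: "fsigns ` topspace T = ?S"
  proof
    show "fsigns ` topspace T \<subseteq> ?S" unfolding top using fsigns_range by blast
    show "?S \<subseteq> fsigns ` topspace T" using ne by blast
  qed
  note comp = connected_components_of_fibres[OF op con surj]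
  have "card ?S = 2 ^ k" by (simp add: card_PiE card_insert_if numeral_2_eq_2)
  then show "card (connected_components_of T) = 2 ^ k" using comp(1) by simp
  show "connected_component_of T G H \<longleftrightarrow> fsigns G = fsigns H" if "G \<in> XX" "H \<in> XX" for G H
    by (rule comp(2)) (use that top in simp_all)
qed

end

theorem proposition3p11:
  fixes p q k :: nat
    and F0 Finf :: "nat \<Rightarrow> 'n::{finite,linorder} rvec set"
  assumes "CARD('n) = p + q" and "p \<ge> q" and "q \<ge> 2" and "1 \<le> k" and "k < q - 1"
    and "F0 = std_flag_0 p q k" and "Finf = std_flag_inf p q k"
  shows "card (connected_components_of
           (subtopology (flag_topology p q k) (\<Omega> p q k F0 \<inter> \<Omega> p q k Finf))) = 2 ^ k \<and>
    (\<forall>U\<in>U_group p q k. \<forall>V\<in>U_group p q k.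
       flag_act k U F0 \<in> \<Omega> p q k F0 \<inter> \<Omega> p q k Finf \<longrightarrow>
       flag_act k V F0 \<in> \<Omega> p q k F0 \<inter> \<Omega> p q k Finf \<longrightarrow>
       (connected_component_of
          (subtopology (flag_topology p q k) (\<Omega> p q k F0 \<inter> \<Omega> p q k Finf))
          (flag_act k U F0) (flag_act k V F0) \<longleftrightarrow>
        (\<forall>j\<in>{1..k}. sgn (det_ur j U) = sgn (det_ur j V))))"
proof -
  interpret rpq p q k "TYPE('n)"
    by unfold_locales (use assms in auto)
  \<comment> \<open>On the unipotent radical the lower minors are 1, so the intrinsic sign of the
    flag is the sign of det_j.\<close>
  have sign: "fsigns (flag_act k U (std_flag_0 p q k)) j = sgn (det_ur j U)"
    if "U \<in> U_group p q k" "j \<in> {1..k}" for U :: "'n rmat" and j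
    unfolding fsigns_def using fsign_act_F0[OF U_group_bot_minor(2)[OF that] that(2)] that(2) by simp
  have eq: "fsigns G = fsigns H \<longleftrightarrow> (\<forall>j\<in>{1..k}. fsigns G j = fsigns H j)" for G H
    by (auto simp: fsigns_def restrict_def fun_eq_iff)
  show ?thesis unfolding assms(6,7)
  proof (intro conjI ballI impI)
    fix U V :: "'n rmat"
    assume UV: "U \<in> U_group p q k" "V \<in> U_group p q k"
      and X: "flag_act k U (std_flag_0 p q k) \<in> XX" "flag_act k V (std_flag_0 p q k) \<in> XX"
    show "connected_component_of (subtopology (flag_topology p q k) XX)
        (flag_act k U (std_flag_0 p q k)) (flag_act k V (std_flag_0 p q k)) \<longleftrightarrow>
      (\<forall>j\<in>{1..k}. sgn (det_ur j U) = sgn (det_ur j V))"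
      unfolding components(2)[OF X] eq using sign[OF UV(1)] sign[OF UV(2)] by simp
  qed (rule components(1))
qed

end
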